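(* Let $f:\mathbb{R}^n\to\mathbb{R}$ be a Borel measurable function with bounded Chebyshev degree $d_f$ and associated constant $A_f$. Let $s\le1$ and let $\mu$ be an $s$-concave probability measure on $\mathbb{R}^n$. Denote by $M_f$ the $\mu$-median of $|f|^{1/d_f}$ and let $c_s:=(1-2^{-s})/s$ for $s\ne0$ and $c_0=\ln2$. Then for every $0<\varepsilon<1$ $$\mu(\{|f|^{1/d_f}\le M_f\,\varepsilon\})\le A_f\,c_s\,\varepsilon,$$ and for every $-1<q<0$ $$\bigl\||f|^{1/d_f}\bigr\|_{L^q(\mu)}\ge M_f\left(1-\frac{qA_fc_s}{q+1}\right)^{1/q}\ge M_f\,e^{-\frac{A_fc_s}{q+1}}.$$
   Context: A Borel function $f:\mathbb{R}^n\to\mathbb{R}$ has bounded Chebyshev degree if there exist $A>0$ and $d>0$ such that for every interval $I$ in $\mathbb{R}^n$ and every Borel subset $J$ of $I$ (with $|J|>0$) $$\sup_I|f|\le\left(\frac{A|I|}{|J|}\right)^{d}\sup_J|f|.$$ The smallest such power $d$ is called the Chebyshev degree of $f$, denoted $d_f$, and the best (smallest) constant $A$ corresponding to this power is denoted $A_f$. An interval in $\mathbb{R}^n$ is an interval (segment) contained in an affine line, and $|\cdot|$ is one-dimensional Lebesgue measure. For $q\neq0$, $\|g\|_{L^q(\mu)}=\left(\int|g|^q\,d\mu\right)^{1/q}$ (also for $q<0$). A median $M$ of a function $g$ satisfies $\mu(g\ge M)\ge\frac12$ and $\mu(g\le M)\ge\frac12$. For $s\in(-\infty,1]$, a (Borel)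 measure $\mu$ on $\mathbb{R}^n$ is $s$-concave if $$\mu(\alpha A+(1-\alpha)B)\ge[\alpha\mu(A)^s+(1-\alpha)\mu(B)^s]^{1/s}$$ for all compact $A,B\subset\mathbb{R}^n$ with $\mu(A)\mu(B)>0$ and all $\alpha\in[0,1]$, where $\alpha A+(1-\alpha)B=\{\alpha x+(1-\alpha)y: x\in A,\ y\in B\}$; for $s=0$ the right-hand side is interpreted as $\mu(A)^\alpha\mu(B)^{1-\alpha}$.
   Formalization: The first inequality is stated only when f is not μ-almost everywhere zero; if f = 0 μ-a.e. (e.g. f(x) = x and μ the Dirac mass at 0), then M_f = 0, the left side is 1 and the bound fails for small ε. *)

theory Defs
  imports "HOL-Probability.Probability"
begin

text \<open>For a unit vector \<open>u\<close> and a set \<open>S\<close> contained in the line \<open>p + \<real> u\<close>, this is the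
  one-dimensional Lebesgue measure of \<open>S\<close>; it does not depend on the choice of \<open>p\<close> and \<open>u\<close>.\<close>

definition line_measure :: "real ^ 'n \<Rightarrow> real ^ 'n \<Rightarrow> (real ^ 'n) set \<Rightarrow> real" where
  "line_measure p u S = measure lborel {t::real. p + t *\<^sub>R u \<in> S}"

text \<open>Intervals are bounded convex subsets of a line. The suprema are taken in \<^typ>\<open>ennreal\<close>,
  since \<open>f\<close> may be unbounded on \<open>I\<close>.\<close>

definition chebyshev_bound :: "(real ^ 'n \<Rightarrow> real) \<Rightarrow> real \<Rightarrow> real \<Rightarrow> bool" where
  "chebyshev_bound f A d \<longleftrightarrow>
     (\<forall>p u I J. norm u = 1 \<and> I \<subseteq> range (\<lambda>t. p + t *\<^sub>R u) \<and> convex I \<and> bounded I \<and>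
        J \<in> sets borel \<and> J \<subseteq> I \<and> line_measure p u J > 0 \<longrightarrow>
        (SUP x\<in>I. ennreal \<bar>f x\<bar>) \<le>
          ennreal ((A * line_measure p u I / line_measure p u J) powr d) * (SUP x\<in>J. ennreal \<bar>f x\<bar>))"

text \<open>The smallest power need not exist (for a nonzero constant \<open>f\<close> every \<open>d > 0\<close> is admissible),
  so the degree and its constant are relations.\<close>

definition is_chebyshev_degree :: "(real ^ 'n \<Rightarrow> real) \<Rightarrow> real \<Rightarrow> bool" where
  "is_chebyshev_degree f d \<longleftrightarrow>
     d > 0 \<and> (\<exists>A>0. chebyshev_bound f A d) \<and>
     (\<forall>d'>0. (\<exists>A>0. chebyshev_bound f A d') \<longrightarrow> d \<le> d')"

definition is_chebyshev_constant :: "(real ^ 'n \<Rightarrow> real) \<Rightarrow> real \<Rightarrow> real \<Rightarrow> bool" where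
  "is_chebyshev_constant f d A \<longleftrightarrow>
     A > 0 \<and> chebyshev_bound f A d \<and> (\<forall>A'>0. chebyshev_bound f A' d \<longrightarrow> A \<le> A')"

text \<open>Powers in \<open>[0, \<infinity>]\<close>. In contrast to \<open>powr\<close> on the reals, \<open>0\<close> to a negative power is \<open>\<infinity>\<close>.\<close>

definition enn_powr :: "ennreal \<Rightarrow> real \<Rightarrow> ennreal" where
  "enn_powr x a =
     (if a = 0 then 1
      else if x = 0 then (if a < 0 then \<infinity> else 0)
      else if x = \<infinity> then (if a < 0 then 0 else \<infinity>)
      else ennreal (enn2real x powr a))"

definition Lq_norm :: "'a measure \<Rightarrow> real \<Rightarrow> ('a \<Rightarrow> real) \<Rightarrow> ennreal" where
  "Lq_norm \<mu> q g = enn_powr (\<integral>\<^sup>+x. enn_powr (ennreal \<bar>g x\<bar>) q \<partial>\<mu>) (1 / q)"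

definition is_median :: "'a measure \<Rightarrow> ('a \<Rightarrow> real) \<Rightarrow> real \<Rightarrow> bool" where
  "is_median \<mu> g M \<longleftrightarrow>
     measure \<mu> {x \<in> space \<mu>. g x \<ge> M} \<ge> 1 / 2 \<and> measure \<mu> {x \<in> space \<mu>. g x \<le> M} \<ge> 1 / 2"

definition s_concave :: "real \<Rightarrow> (real ^ 'n) measure \<Rightarrow> bool" where
  "s_concave s \<mu> \<longleftrightarrow>
     (\<forall>A B \<alpha>. compact A \<and> compact B \<and> emeasure \<mu> A * emeasure \<mu> B > 0 \<and> 0 \<le> \<alpha> \<and> \<alpha> \<le> 1 \<longrightarrow>
        emeasure \<mu> {\<alpha> *\<^sub>R x + (1 - \<alpha>) *\<^sub>R y | x y. x \<in> A \<and> y \<in> B} \<ge>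
          (if s = 0 then enn_powr (emeasure \<mu> A) \<alpha> * enn_powr (emeasure \<mu> B) (1 - \<alpha>)
           else enn_powr (ennreal \<alpha> * enn_powr (emeasure \<mu> A) s +
                          ennreal (1 - \<alpha>) * enn_powr (emeasure \<mu> B) s) (1 / s)))"

definition c_const :: "real \<Rightarrow> real" where
  "c_const s = (if s = 0 then ln 2 else (1 - 2 powr (- s)) / s)"

end

theory Submission
  imports Defs
begin

text \<open>The heart of the matter is a sharp dilation inequality: if \<open>B\<close> and \<open>F\<close> are disjoint compact sets
  such that \<open>F\<close> occupies at most a proportion \<open>\<delta>\<close> of every segment starting in \<open>B\<close>, then
  \<open>\<mu> F \<le> \<delta> (1 - (\<mu> B)\<^sup>s) / s\<close>. The Chebyshev bound provides this with \<open>B\<close>, \<open>F\<close> approximating the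
  sets where \<open>\<bar>f\<bar> powr (1/d)\<close> is at least \<open>M\<close>, respectively at most \<open>M \<epsilon>\<close>, and \<open>\<delta> = A \<epsilon>\<close>.

  The inequality is localized: bisecting a ball by hyperplanes while keeping the relative masses of
  \<open>B\<close> and \<open>F\<close> produces a decreasing sequence of convex bodies that shrinks to a segment. Projecting a
  body far along the sequence to the line of this segment gives an \<open>s\<close>-concave probability on the
  real line, to which the one-dimensional inequality applies after a slight fattening of the sets.

  On the line, the smoothed density increases up to a mode \<open>c\<close> and decreases afterwards. For the last
  point \<open>p \<le> c\<close> of \<open>B\<close>, the density is bounded on \<open>[p, \<infinity>)\<close> by a decreasing majorant, the cost of which
  is controlled by the concavity of \<open>boxcox s \<circ> cdf\<close>. Choosing the side of \<open>c\<close> on which \<open>B\<close> has the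
  larger relative mass yields the sharp constant.\<close>

section \<open>The Box--Cox transform\<close>

text \<open>No conditional measure on the limiting segment is ever formed; that would require weak
  limits of conditional measures and control of them on \<open>B\<close> and \<open>F\<close>. A
  body that is merely close to the segment already has an exactly s-concave marginal, because
  conditioning on a convex body changes \<open>boxcox s\<close> of the masses only by an increasing
  affine map (\<open>boxcox_divide\<close>). The price is that \<open>B\<close> and \<open>F\<close>
  within that body are only close to their traces on the segment. This is why the two sets are
  compact and disjoint: they can then be fattened at the cost of an arbitrarily small increase of
  \<open>\<delta>\<close>. The transform also explains the constant: the median leaves mass at least
  1/2 for the set approximated by \<open>B\<close>, and \<open>- boxcox s (1/2)\<close> is
  \<open>c_const s\<close>. The case \<open>\<delta> = 0\<close> of the dilation inequality is what
  treats a vanishing median.\<close>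

text \<open>In terms of this transform, \<open>s\<close>-concavity says that \<open>boxcox s \<circ> \<mu>\<close> is concave along
  Minkowski combinations.\<close>

definition boxcox :: "real \<Rightarrow> real \<Rightarrow> real" where
  "boxcox s t = (if s = 0 then ln t else (t powr s - 1) / s)"

lemma boxcox_one [simp]: "boxcox s 1 = 0"
  by (simp add: boxcox_def)

lemma boxcox_half: "- boxcox s (1/2) = c_const s"
proof -
  have "(1/2) powr s = 2 powr (- s)" for s :: real
    by (simp add: powr_divide powr_minus_divide)
  then show ?thesis
    by (simp add: boxcox_def c_const_def ln_div minus_divide_left)
qed

lemma DERIV_boxcox:
  assumes "0 < t"
  shows "(boxcox s has_real_derivative t powr (s - 1)) (at t)"
proof (cases "s = 0")
  case True
  then have "boxcox s = ln" by (auto simp: boxcox_def)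
  with True assms show ?thesis
    by (auto intro!: derivative_eq_intros simp: powr_minus_divide)
next
  case False
  then have "boxcox s = (\<lambda>t. (t powr s - 1) / s)" by (auto simp: boxcox_def)
  with False assms show ?thesis
    by (auto intro!: derivative_eq_intros)
qed

lemma isCont_boxcox: "0 < t \<Longrightarrow> isCont (boxcox s) t"
  using DERIV_boxcox DERIV_isCont by blast

text \<open>For \<open>s \<le> 1\<close> the derivative \<open>z powr (s - 1)\<close> is
  nonincreasing, so its value at the right end bounds the mean slope from below.\<close>

lemma boxcox_diff_ge:
  assumes "s \<le> 1" "0 < t" "t \<le> u"
  shows "u powr (s - 1) * (u - t) \<le> boxcox s u - boxcox s t"
proof (cases "t = u")
  case False
  with assms obtain z where z: "t < z" "z < u"
      "boxcox s u - boxcox s t = (u - t) * z powr (s - 1)"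
    using MVT2[of t u "boxcox s" "\<lambda>z. z powr (s - 1)"] DERIV_boxcox[of _ s] by force
  have "u powr (s - 1) \<le> z powr (s - 1)"
    using z assms by (intro powr_mono2') auto
  with z assms show ?thesis by (simp add: mult.commute mult_left_mono)
qed simp

lemma boxcox_less_iff:
  assumes "0 < t" "0 < u"
  shows "boxcox s t < boxcox s u \<longleftrightarrow> t < u"
proof -
  have "boxcox s x < boxcox s y" if "0 < x" "x < y" for x y
  proof (rule DERIV_pos_imp_increasing[where f = "boxcox s"])
    fix z assume "x \<le> z" "z \<le> y"
    with that show "\<exists>D. (boxcox s has_real_derivative D) (at z) \<and> 0 < D"
      by (intro exI[of _ "z powr (s - 1)"]) (simp add: DERIV_boxcox)
  qed fact
  from this[of t u] this[of u t] assms show ?thesis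
    by (cases t u rule: linorder_cases) auto
qed

lemma boxcox_le_iff: "0 < t \<Longrightarrow> 0 < u \<Longrightarrow> boxcox s t \<le> boxcox s u \<longleftrightarrow> t \<le> u"
  using boxcox_less_iff[of u t s] by (simp add: not_less [symmetric])

lemma boxcox_divide:
  assumes "0 < t" "0 < m"
  shows "boxcox s (t / m) = m powr (- s) * (boxcox s t - boxcox s m)"
  using assms by (simp add: boxcox_def ln_div powr_divide powr_minus field_simps)

lemma boxcox_diff_ge_diff:
  assumes "s \<le> 1" "0 < t" "t \<le> u" "u \<le> 1"
  shows "u - t \<le> boxcox s u - boxcox s t"
proof -
  have "1 powr (s - 1) \<le> u powr (s - 1)"
    using assms by (intro powr_mono2') auto
  then have "1 * (u - t) \<le> u powr (s - 1) * (u - t)"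
    using assms by (intro mult_right_mono) auto
  with boxcox_diff_ge[OF assms(1-3)] show ?thesis by simp
qed

text \<open>On (0, 1] the transform has slope at least 1. Between the mixture and \<open>l\<close>
  this pays for \<open>R * (l - r)\<close>; between \<open>l\<close> and 1 it replaces
  \<open>1 - l\<close> by the larger \<open>- boxcox s l\<close> on the part of weight
  \<open>R\<close>. So charging one side only linearly costs no more than charging the
  mixture.\<close>

lemma boxcox_mixture_le:
  assumes "s \<le> 1" "0 < l" "l \<le> 1" "r \<le> l" "0 \<le> R" "0 < (1 - R) * l + R * r"
  shows "(1 - R) * (- boxcox s l) + R * (1 - r) \<le> - boxcox s ((1 - R) * l + R * r)"
proof -
  let ?m = "(1 - R) * l + R * r"
  have lm: "l - ?m = R * (l - r)" by (simp add: algebra_simps)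
  have "0 \<le> R * (l - r)" using assms by simp
  with lm have "?m \<le> l" by linarith
  then have "R * (l - r) \<le> boxcox s l - boxcox s ?m"
    using boxcox_diff_ge_diff[of s ?m l] assms lm by simp
  moreover have "1 - l \<le> - boxcox s l"
    using boxcox_diff_ge_diff[of s l 1] assms by simp
  then have "R * (1 - l) \<le> R * (- boxcox s l)"
    using assms by (intro mult_left_mono) auto
  ultimately show ?thesis by (simp add: algebra_simps)
qed

text \<open>\<open>L1\<close> and \<open>R1\<close> are the masses on either side of the mode (overlapping in mass \<open>\<kappa>\<close>), \<open>\<beta>L\<close> and
  \<open>\<beta>R\<close> the parts of them in \<open>B\<close>, \<open>L0\<close> is the mass to the left of the last point of \<open>B\<close> before the
  mode, and \<open>X\<close> is the cost of replacing the density by its maximum between that point and the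
  mode.\<close>

lemma boxcox_balance:
  fixes L1 R1 \<kappa> \<beta>L \<beta>R L0 X b s :: real
  assumes s: "s \<le> 1" and k: "0 \<le> \<kappa>" "\<kappa> < b" "\<kappa> \<le> 1" and tot: "L1 + R1 = 1 + \<kappa>"
    and "R1 \<le> 1" "0 \<le> R1" "0 < \<beta>L" "0 \<le> \<beta>R" "\<beta>L \<le> L0" "L0 \<le> L1" "\<beta>R \<le> R1"
    and bal: "\<beta>R * L1 \<le> \<beta>L * R1" and sum: "b \<le> \<beta>L + \<beta>R"
    and X: "X \<le> L1 * (- boxcox s (L0 / L1)) + \<kappa>"
  shows "X + (L0 - \<beta>L) + (R1 - \<beta>R) \<le> - boxcox s (b - \<kappa>) + \<kappa> * (1 - boxcox s (b / 2))"
proof -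
  \<comment> \<open>Proportions of \<open>B\<close> on the two sides; \<open>bal\<close> says that
    \<open>r \<le> l\<close>. If \<open>R1 = 0\<close>, division by zero gives \<open>r = 0\<close>,
    in agreement with \<open>\<beta>R = 0\<close>.\<close>
  define l r where "l = \<beta>L / L1" and "r = \<beta>R / R1"
  have L1: "0 < L1" using assms by linarith
  have r: "\<beta>R = R1 * r" using assms by (cases "R1 = 0") (auto simp: r_def)
  have l: "\<beta>L = L1 * l" using L1 by (simp add: l_def)
  have "0 < l" "l \<le> 1" "0 \<le> r" using assms L1 by (auto simp: l_def r_def)
  have rl: "r \<le> l"
  proof (cases "R1 = 0")
    case False
    with assms L1 show ?thesis by (simp add: l_def r_def field_simps)
  qed (use \<open>0 < l\<close> in \<open>simp add: r_def\<close>)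
  \<comment> \<open>Slope at least 1 absorbs the mass \<open>L0 - \<beta>L\<close> outside
    \<open>B\<close>: the argument \<open>L0 / L1\<close> becomes \<open>l\<close>.\<close>
  have "L0 / L1 - l \<le> boxcox s (L0 / L1) - boxcox s l"
    using assms L1 \<open>0 < l\<close> by (intro boxcox_diff_ge_diff) (auto simp: l_def divide_right_mono)
  then have "L1 * (L0 / L1 - l) \<le> L1 * (boxcox s (L0 / L1) - boxcox s l)"
    using L1 by (intro mult_left_mono) auto
  then have "L0 - \<beta>L \<le> L1 * (boxcox s (L0 / L1) - boxcox s l)"
    using L1 by (simp add: l right_diff_distrib)
  with X have 1: "X + (L0 - \<beta>L) + (R1 - \<beta>R) \<le> L1 * (- boxcox s l) + R1 * (1 - r) + \<kappa>"
    by (simp add: r algebra_simps)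
  have m: "(1 - R1) * l + R1 * r = \<beta>L + \<beta>R - \<kappa> * l"
  proof -
    have "1 - R1 = L1 - \<kappa>" using tot by simp
    then show ?thesis unfolding l r by (simp add: left_diff_distrib)
  qed
  have "\<kappa> * l \<le> \<kappa>" using k \<open>l \<le> 1\<close> by (simp add: mult_left_le)
  then have m': "b - \<kappa> \<le> (1 - R1) * l + R1 * r" using sum m by linarith
  have 2: "(1 - R1) * (- boxcox s l) + R1 * (1 - r) \<le> - boxcox s (b - \<kappa>)"
  proof -
    have "(1 - R1) * (- boxcox s l) + R1 * (1 - r) \<le> - boxcox s ((1 - R1) * l + R1 * r)"
      using boxcox_mixture_le[of s l r R1] s \<open>0 < l\<close> \<open>l \<le> 1\<close> rl assms m' by linarith
    also have "\<dots> \<le> - boxcox s (b - \<kappa>)"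
      using m' k boxcox_le_iff[of "b - \<kappa>" "(1 - R1) * l + R1 * r" s] by linarith
    finally show ?thesis .
  qed
  \<comment> \<open>The lower bound \<open>b / 2\<close> for \<open>l\<close> keeps
    \<open>- boxcox s l\<close> bounded independently of \<open>\<kappa>\<close>, so that the excess
    \<open>\<kappa> * (- boxcox s l)\<close> vanishes as \<open>\<kappa>\<close> tends to 0.\<close>
  have "b \<le> L1 * l + R1 * r" using sum l r by simp
  also have "\<dots> \<le> L1 * l + R1 * l" using rl assms by (intro add_left_mono mult_left_mono) auto
  also have "\<dots> = (1 + \<kappa>) * l" using tot by (simp flip: distrib_right)
  also have "\<dots> \<le> 2 * l" using k \<open>0 < l\<close> by (intro mult_right_mono) auto
  finally have "b / 2 \<le> l" by simp
  then have "boxcox s (b / 2) \<le> boxcox s l"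
    using k \<open>0 < l\<close> boxcox_le_iff[of "b / 2" l s] by auto
  then have 3: "\<kappa> * (- boxcox s l) \<le> \<kappa> * (- boxcox s (b / 2))"
    using k by (intro mult_left_mono) auto
  have "L1 = (1 - R1) + \<kappa>" using tot by simp
  then have "L1 * (- boxcox s l) = (1 - R1) * (- boxcox s l) + \<kappa> * (- boxcox s l)"
    by (metis distrib_right)
  with 1 2 3 show ?thesis by (simp add: algebra_simps)
qed

section \<open>Proportions on the real line and unimodal densities\<close>

lemma measure_Int_interval_le:
  fixes E :: "real set"
  assumes "E \<in> sets borel" "a \<le> b"
  shows "measure lborel (E \<inter> {a..b}) \<le> b - a"
proof -
  have "measure lborel (E \<inter> {a..b}) \<le> measure lborel {a..b}"
    using assms by (intro measure_mono_fmeasurable) (auto simp: fmeasurable_def)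
  with assms show ?thesis by simp
qed

lemma emeasure_Int_interval:
  fixes E :: "real set"
  assumes "E \<in> sets borel"
  shows "emeasure lborel (E \<inter> {a..b}) = ennreal (measure lborel (E \<inter> {a..b}))"
proof (rule emeasure_eq_ennreal_measure)
  have "emeasure lborel (E \<inter> {a..b}) \<le> emeasure lborel {a..b}"
    using assms by (intro emeasure_mono) auto
  then show "emeasure lborel (E \<inter> {a..b}) \<noteq> top"
    by (auto simp: top_unique emeasure_lborel_Icc_eq split: if_splits)
qed

lemma measure_Int_interval_split:
  fixes E :: "real set"
  assumes [measurable]: "E \<in> sets borel" and "a \<le> b" "b \<le> c"
  shows "measure lborel (E \<inter> {a..c}) = measure lborel (E \<inter> {a..b}) + measure lborel (E \<inter> {b..c})"
proof -
  have "E \<inter> {a..c} = (E \<inter> {a..b}) \<union> (E \<inter> {b..c})" using assms by auto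
  moreover have "measure lborel ((E \<inter> {a..b}) \<union> (E \<inter> {b..c})) =
      measure lborel (E \<inter> {a..b}) + measure lborel (E \<inter> {b..c})"
  proof (rule measure_Un_AE)
    show "AE x in lborel. x \<notin> E \<inter> {a..b} \<or> x \<notin> E \<inter> {b..c}"
      using AE_lborel_singleton[of b] by eventually_elim auto
  qed (auto simp: fmeasurable_def emeasure_Int_interval)
  ultimately show ?thesis by simp
qed

text \<open>Fubini for the region under the graph. The variable \<open>t\<close> runs over the whole
  line, so \<open>0 \<le> t\<close> is part of the level set; negative values of \<open>w\<close>
  contribute nothing on either side.\<close>

lemma nn_integral_layer_cake:
  fixes w :: "real \<Rightarrow> real"
  assumes [measurable]: "w \<in> borel_measurable borel" "E \<in> sets borel"
  shows "(\<integral>\<^sup>+x\<in>E. ennreal (w x) \<partial>lborel) =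
    (\<integral>\<^sup>+t. emeasure lborel (E \<inter> {x. 0 \<le> t \<and> t < w x}) \<partial>lborel)"
proof -
  have "(\<integral>\<^sup>+x\<in>E. ennreal (w x) \<partial>lborel) =
      (\<integral>\<^sup>+x. \<integral>\<^sup>+t. indicator (E \<inter> {x. 0 \<le> t \<and> t < w x}) x \<partial>lborel \<partial>lborel)"
  proof (intro nn_integral_cong)
    fix x :: real
    have "(\<integral>\<^sup>+t. indicator (E \<inter> {x. 0 \<le> t \<and> t < w x}) x \<partial>lborel) =
        (\<integral>\<^sup>+t. indicator E x * indicator {0..<w x} t \<partial>lborel)"
      by (intro nn_integral_cong) (auto split: split_indicator)
    also have "\<dots> = indicator E x * emeasure lborel {0..<w x}"
      by (simp add: nn_integral_cmult)
    also have "\<dots> = ennreal (w x) * indicator E x"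
      by (cases "0 \<le> w x") (simp_all add: mult.commute ennreal_neg)
    finally show "ennreal (w x) * indicator E x =
        (\<integral>\<^sup>+t. indicator (E \<inter> {x. 0 \<le> t \<and> t < w x}) x \<partial>lborel)" ..
  qed
  also have "\<dots> = (\<integral>\<^sup>+t. \<integral>\<^sup>+x. indicator (E \<inter> {x. 0 \<le> t \<and> t < w x}) x \<partial>lborel \<partial>lborel)"
    by (intro lborel_pair.Fubini') measurable
  finally show ?thesis by simp
qed

text \<open>On \<open>{p..}\<close> the superlevel sets of an antimonotone weight are initial
  intervals, for which the bound is assumed; the layer-cake formula integrates it over the
  levels.\<close>

lemma nn_integral_antimono_le:
  fixes w :: "real \<Rightarrow> real"
  assumes w [measurable]: "w \<in> borel_measurable borel"
    and [measurable]: "F \<in> sets borel" "C \<in> sets borel"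
    and anti: "\<And>x y. p \<le> x \<Longrightarrow> x \<le> y \<Longrightarrow> w y \<le> w x"
    and zero: "\<And>x. Y < x \<Longrightarrow> w x = 0" and \<delta>: "0 \<le> \<delta>"
    and le: "\<And>y. p \<le> y \<Longrightarrow> measure lborel (F \<inter> {p..y}) \<le> \<delta> * measure lborel (C \<inter> {p..y})"
  shows "(\<integral>\<^sup>+x\<in>F \<inter> {p..}. ennreal (w x) \<partial>lborel) \<le> ennreal \<delta> * (\<integral>\<^sup>+x\<in>C \<inter> {p..}. ennreal (w x) \<partial>lborel)"
proof -
  have level: "emeasure lborel (F \<inter> {p..} \<inter> {x. 0 \<le> t \<and> t < w x}) \<le>
      ennreal \<delta> * emeasure lborel (C \<inter> {p..} \<inter> {x. 0 \<le> t \<and> t < w x})" for t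
  proof (cases "{p..} \<inter> {x. 0 \<le> t \<and> t < w x} = {}")
    case True
    then have "F \<inter> {p..} \<inter> {x. 0 \<le> t \<and> t < w x} = {}" by auto
    then show ?thesis by simp
  next
    case False
    define S where "S = {p..} \<inter> {x. 0 \<le> t \<and> t < w x}"
    have [measurable]: "S \<in> sets borel" unfolding S_def by measurable
    have bdd: "bdd_above S"
      using zero by (intro bdd_aboveI[of _ Y]) (force simp: S_def not_less [symmetric])
    have "S \<subseteq> {p..Sup S}" using bdd by (auto simp: S_def intro!: cSup_upper)
    moreover have "{p..<Sup S} \<subseteq> S"
    proof
      fix x assume x: "x \<in> {p..<Sup S}"
      then obtain z where "z \<in> S" "x < z"
        using False less_cSupD[of S x] by (auto simp: S_def)
      with x anti[of x z] show "x \<in> S" by (auto simp: S_def)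
    qed
    \<comment> \<open>Whether the supremum belongs to the level set is immaterial, since a point is
      null.\<close>
    ultimately have eq: "emeasure lborel (E \<inter> S) = emeasure lborel (E \<inter> {p..Sup S})"
      if [measurable]: "E \<in> sets borel" for E
    proof (intro emeasure_eq_AE)
      show "AE x in lborel. x \<in> E \<inter> S \<longleftrightarrow> x \<in> E \<inter> {p..Sup S}"
        using AE_lborel_singleton[of "Sup S"]
        by eventually_elim (use \<open>S \<subseteq> _\<close> \<open>_ \<subseteq> S\<close> in force)
    qed auto
    from False obtain x where "x \<in> S" by (auto simp: S_def)
    with \<open>S \<subseteq> _\<close> have "p \<le> Sup S" by force
    from le[OF this] have "emeasure lborel (F \<inter> S) \<le> ennreal \<delta> * emeasure lborel (C \<inter> S)"
      using \<delta> by (simp add: eq emeasure_Int_interval flip: ennreal_mult)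
    then show ?thesis by (simp add: S_def Int_assoc)
  qed
  have "(\<integral>\<^sup>+x\<in>F \<inter> {p..}. ennreal (w x) \<partial>lborel) =
      (\<integral>\<^sup>+t. emeasure lborel (F \<inter> {p..} \<inter> {x. 0 \<le> t \<and> t < w x}) \<partial>lborel)"
    by (rule nn_integral_layer_cake) auto
  also have "\<dots> \<le> (\<integral>\<^sup>+t. ennreal \<delta> * emeasure lborel (C \<inter> {p..} \<inter> {x. 0 \<le> t \<and> t < w x}) \<partial>lborel)"
    by (intro nn_integral_mono level)
  also have "\<dots> = ennreal \<delta> * (\<integral>\<^sup>+t. emeasure lborel (C \<inter> {p..} \<inter> {x. 0 \<le> t \<and> t < w x}) \<partial>lborel)"
    by (intro nn_integral_cmult) measurable
  also have "(\<integral>\<^sup>+t. emeasure lborel (C \<inter> {p..} \<inter> {x. 0 \<le> t \<and> t < w x}) \<partial>lborel) =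
      (\<integral>\<^sup>+x\<in>C \<inter> {p..}. ennreal (w x) \<partial>lborel)"
    by (rule nn_integral_layer_cake [symmetric]) auto
  finally show ?thesis .
qed

text \<open>If the bound failed, let \<open>t0\<close> be the infimum of the bad \<open>y\<close>. If \<open>t0 \<in> B\<close>, then \<open>F\<close> misses a
  neighbourhood of \<open>t0\<close>; otherwise the hypothesis applies from the last point of \<open>B\<close> before \<open>t0\<close>.\<close>

lemma proportion_outside:
  fixes B F :: "real set"
  assumes B: "closed B" and F: "closed F" and disj: "B \<inter> F = {}" and \<delta>: "0 \<le> \<delta>"
    and dens: "\<And>x y. x \<in> B \<Longrightarrow> x \<le> y \<Longrightarrow> measure lborel (F \<inter> {x..y}) \<le> \<delta> * (y - x)"
    and p: "p \<in> B" "p \<le> y"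
  shows "measure lborel (F \<inter> {p..y}) \<le> \<delta> * measure lborel (- B \<inter> {p..y})"
proof (rule ccontr)
  define h where "h t = \<delta> * measure lborel (- B \<inter> {p..t}) - measure lborel (F \<inter> {p..t})" for t
  assume "\<not> ?thesis"
  then have "h y < 0" by (simp add: h_def)
  have [measurable]: "F \<in> sets borel" "- B \<in> sets borel"
    using B F by (auto simp: borel_closed intro!: borel_open)
  have h_split: "h t = h a + \<delta> * measure lborel (- B \<inter> {a..t}) - measure lborel (F \<inter> {a..t})"
    if "p \<le> a" "a \<le> t" for a t
    unfolding h_def using that measure_Int_interval_split[of F p a t]
      measure_Int_interval_split[of "- B" p a t] by (simp add: algebra_simps)
  define N where "N = {t. p \<le> t \<and> h t < 0}"
  have N: "y \<in> N" "bdd_below N" using p \<open>h y < 0\<close> by (auto simp: N_def)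
  define t0 where "t0 = Inf N"
  have "p \<le> t0" using N by (auto simp: t0_def N_def intro!: cInf_greatest)
  have before: "0 \<le> h t" if "p \<le> t" "t < t0" for t
    using that cInf_lower[OF _ N(2), of t] by (force simp: t0_def N_def)
  have "h p = 0"
  proof -
    have "measure lborel (F \<inter> {p..p}) = 0" "measure lborel (- B \<inter> {p..p}) = 0"
      using measure_Int_interval_le[of F p p] measure_Int_interval_le[of "- B" p p]
      by (auto simp: measure_le_0_iff)
    then show ?thesis by (simp add: h_def)
  qed
  \<comment> \<open>\<open>h\<close> loses at most \<open>t0 - t\<close> between \<open>t\<close>
    and \<open>t0\<close>, so nonnegativity before \<open>t0\<close> extends to
    \<open>t0\<close>.\<close>
  have "0 \<le> h t0"
  proof (cases "p = t0")
    case False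
    show ?thesis
    proof (rule field_le_epsilon)
      fix e :: real assume "0 < e"
      define t where "t = max p (t0 - e)"
      have "p \<le> t" "t < t0" "t0 - t \<le> e" using False \<open>p \<le> t0\<close> \<open>0 < e\<close> by (auto simp: t_def)
      then have "0 \<le> h t" "measure lborel (F \<inter> {t..t0}) \<le> t0 - t"
          "h t0 = h t + \<delta> * measure lborel (- B \<inter> {t..t0}) - measure lborel (F \<inter> {t..t0})"
        by (auto intro!: before h_split measure_Int_interval_le)
      moreover have "0 \<le> \<delta> * measure lborel (- B \<inter> {t..t0})" using \<delta> by simp
      ultimately show "0 \<le> h t0 + e" using \<open>t0 - t \<le> e\<close> by linarith
    qed
  qed (use \<open>h p = 0\<close> in simp)
  obtain \<eta> where \<eta>: "0 < \<eta>" "\<And>t. t0 \<le> t \<Longrightarrow> t < t0 + \<eta> \<Longrightarrow> 0 \<le> h t"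
  proof (cases "t0 \<in> B")
    case True
    with disj have "t0 \<in> - F" by auto
    with F obtain \<eta> where \<eta>: "0 < \<eta>" "ball t0 \<eta> \<subseteq> - F"
      using open_contains_ball[of "- F"] by (auto simp: open_Compl)
    show ?thesis
    proof (rule that[OF \<eta>(1)])
      fix t assume t: "t0 \<le> t" "t < t0 + \<eta>"
      then have "{t0..t} \<subseteq> ball t0 \<eta>" by (auto simp: dist_real_def)
      with \<eta> have "F \<inter> {t0..t} = {}" by auto
      then show "0 \<le> h t"
        using \<open>0 \<le> h t0\<close> \<open>p \<le> t0\<close> t h_split[of t0 t] \<delta> by simp
    qed
  next
    case False
    with B obtain \<eta> where \<eta>: "0 < \<eta>" "ball t0 \<eta> \<subseteq> - B"
      using open_contains_ball[of "- B"] by (auto simp: open_Compl)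
    have "compact (B \<inter> {p..t0})" using B by (simp add: closed_Int_compact)
    moreover have "B \<inter> {p..t0} \<noteq> {}" using p \<open>p \<le> t0\<close> by auto
    ultimately obtain a where a: "a \<in> B \<inter> {p..t0}" "\<And>z. z \<in> B \<inter> {p..t0} \<Longrightarrow> z \<le> a"
      using compact_attains_sup[of "B \<inter> {p..t0}"] by meson
    then have "a < t0" using False by (cases "a = t0") auto
    show ?thesis
    proof (rule that[OF \<eta>(1)])
      fix t assume t: "t0 \<le> t" "t < t0 + \<eta>"
      \<comment> \<open>From the last point \<open>a\<close> of \<open>B\<close> up to
        \<open>t\<close> everything lies outside \<open>B\<close>, so there the full length in
        \<open>dens\<close> is the length outside \<open>B\<close> that the claim needs.\<close>
      have "- B \<inter> {a<..t} = {a<..t}"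
      proof -
        have "z \<notin> B" if "a < z" "z \<le> t" for z
        proof (cases "z \<le> t0")
          case True
          with a that show ?thesis by force
        next
          case False
          with that t have "z \<in> ball t0 \<eta>" by (auto simp: dist_real_def)
          with \<eta> show ?thesis by auto
        qed
        then show ?thesis by auto
      qed
      moreover have "measure lborel (- B \<inter> {a<..t}) \<le> measure lborel (- B \<inter> {a..t})"
        by (intro measure_mono_fmeasurable) (auto simp: fmeasurable_def emeasure_Int_interval)
      ultimately have "t - a \<le> measure lborel (- B \<inter> {a..t})" using \<open>a < t0\<close> t by simp
      then have "\<delta> * (t - a) \<le> \<delta> * measure lborel (- B \<inter> {a..t})"
        using \<delta> by (rule mult_left_mono)
      moreover have "measure lborel (F \<inter> {a..t}) \<le> \<delta> * (t - a)"
        using a t \<open>a < t0\<close> by (intro dens) auto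
      moreover have "0 \<le> h a" using a \<open>a < t0\<close> by (intro before) auto
      ultimately show "0 \<le> h t" using h_split[of a t] a t \<open>a < t0\<close> by auto
    qed
  qed
  from N(1) have "\<exists>t\<in>N. t < t0 + \<eta>"
    using cInf_lessD[of N "t0 + \<eta>"] \<eta>(1) by (auto simp: t0_def)
  then obtain t where t: "t \<in> N" "t < t0 + \<eta>" by blast
  moreover have "t0 \<le> t" using t N by (auto simp: t0_def intro!: cInf_lower)
  ultimately show False using \<eta>(2)[of t] by (auto simp: N_def)
qed

section \<open>Comparison of masses under a unimodal density\<close>

lemma nn_integral_lborel_uminus:
  fixes f :: "real \<Rightarrow> ennreal"
  assumes "f \<in> borel_measurable borel"
  shows "(\<integral>\<^sup>+x. f (- x) \<partial>lborel) = (\<integral>\<^sup>+x. f x \<partial>lborel)"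
proof -
  have "(\<integral>\<^sup>+x. f x \<partial>distr lborel borel uminus) = (\<integral>\<^sup>+x. f (- x) \<partial>lborel)"
    using assms by (intro nn_integral_distr) auto
  then show ?thesis by (simp add: lborel_distr_uminus)
qed

lemma measure_lborel_uminus:
  fixes E :: "real set"
  assumes "E \<in> sets borel"
  shows "measure lborel {x. - x \<in> E} = measure lborel E"
proof -
  have "measure (distr lborel borel uminus) E = measure lborel (uminus -` E \<inter> space lborel)"
    using assms by (intro measure_distr) auto
  then show ?thesis by (simp add: lborel_distr_uminus vimage_def)
qed

text \<open>To the right of \<open>p\<close> the density is replaced by the antimonotone majorant that is constant on
  \<open>[p, c]\<close>.\<close>

lemma nn_integral_unimodal_le:
  fixes \<phi> :: "real \<Rightarrow> real"
  assumes [measurable]: "\<phi> \<in> borel_measurable borel"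
    and inc: "\<And>x y. x \<le> y \<Longrightarrow> y \<le> c \<Longrightarrow> \<phi> x \<le> \<phi> y"
    and dec: "\<And>x y. c \<le> x \<Longrightarrow> x \<le> y \<Longrightarrow> \<phi> y \<le> \<phi> x"
    and nonneg: "\<And>x. 0 \<le> \<phi> x" and zero: "\<And>x. Y < \<bar>x\<bar> \<Longrightarrow> \<phi> x = 0"
    and B: "closed B" and F: "closed F" and disj: "B \<inter> F = {}" and \<delta>: "0 \<le> \<delta>"
    and right: "\<And>x y. x \<in> B \<Longrightarrow> x \<le> y \<Longrightarrow> measure lborel (F \<inter> {x..y}) \<le> \<delta> * (y - x)"
    and left: "\<And>x y. x \<in> B \<Longrightarrow> y \<le> x \<Longrightarrow> measure lborel (F \<inter> {y..x}) \<le> \<delta> * (x - y)"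
    and p: "p \<in> B" "p \<le> c"
  shows "(\<integral>\<^sup>+x\<in>F. ennreal (\<phi> x) \<partial>lborel) \<le>
    ennreal \<delta> * (ennreal ((c - p) * \<phi> c) + (\<integral>\<^sup>+x\<in>- B \<inter> {..p}. ennreal (\<phi> x) \<partial>lborel)
      + (\<integral>\<^sup>+x\<in>- B \<inter> {c..}. ennreal (\<phi> x) \<partial>lborel))"
proof -
  have [measurable]: "F \<in> sets borel" "B \<in> sets borel" using B F by (auto simp: borel_closed)
  define w where "w x = \<phi> (max x c)" for x
  have [measurable]: "w \<in> borel_measurable borel" unfolding w_def by measurable
  have \<phi>w: "\<phi> x \<le> w x" for x using inc[of x c] by (auto simp: w_def max_def)
  have "(\<integral>\<^sup>+x\<in>F \<inter> {p..}. ennreal (\<phi> x) \<partial>lborel) \<le> (\<integral>\<^sup>+x\<in>F \<inter> {p..}. ennreal (w x) \<partial>lborel)"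
    by (intro nn_integral_mono mult_right_mono ennreal_leI \<phi>w) auto
  also have "\<dots> \<le> ennreal \<delta> * (\<integral>\<^sup>+x\<in>- B \<inter> {p..}. ennreal (w x) \<partial>lborel)"
  proof (rule nn_integral_antimono_le[where Y = "max c Y"])
    show "w y \<le> w x" if "x \<le> y" for x y using dec that by (auto simp: w_def max_def)
    show "w x = 0" if "max c Y < x" for x using zero that by (auto simp: w_def)
    show "measure lborel (F \<inter> {p..y}) \<le> \<delta> * measure lborel (- B \<inter> {p..y})" if "p \<le> y" for y
      using proportion_outside[OF B F disj \<delta> right p(1) that] .
  qed (use \<delta> in auto)
  \<comment> \<open>Between \<open>p\<close> and \<open>c\<close> the whole interval is charged,
    points of \<open>B\<close> included; this is the term \<open>(c - p) * \<phi> c\<close>.\<close>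
  also have "(\<integral>\<^sup>+x\<in>- B \<inter> {p..}. ennreal (w x) \<partial>lborel) \<le>
      (\<integral>\<^sup>+x. ennreal (\<phi> c) * indicator {p..c} x + ennreal (\<phi> x) * indicator (- B \<inter> {c..}) x \<partial>lborel)"
    by (intro nn_integral_mono) (auto simp: w_def max_def split: split_indicator)
  also have "\<dots> = ennreal ((c - p) * \<phi> c) + (\<integral>\<^sup>+x\<in>- B \<inter> {c..}. ennreal (\<phi> x) \<partial>lborel)"
    using p nonneg by (subst nn_integral_add) (auto simp: nn_integral_cmult mult.commute simp flip: ennreal_mult)
  finally have R: "(\<integral>\<^sup>+x\<in>F \<inter> {p..}. ennreal (\<phi> x) \<partial>lborel) \<le>
      ennreal \<delta> * (ennreal ((c - p) * \<phi> c) + (\<integral>\<^sup>+x\<in>- B \<inter> {c..}. ennreal (\<phi> x) \<partial>lborel))"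
    by (simp add: mult_left_mono)
  \<comment> \<open>To the left of \<open>p\<close> the density itself is monotone, so the
    antimonotone comparison applies after the reflection, without a majorant.\<close>
  have refl: "(\<integral>\<^sup>+x\<in>{x. - x \<in> E} \<inter> {-p..}. ennreal (\<phi> (- x)) \<partial>lborel) =
      (\<integral>\<^sup>+x\<in>E \<inter> {..p}. ennreal (\<phi> x) \<partial>lborel)" if [measurable]: "E \<in> sets borel" for E
  proof -
    have "(\<integral>\<^sup>+x\<in>{x. - x \<in> E} \<inter> {-p..}. ennreal (\<phi> (- x)) \<partial>lborel) =
        (\<integral>\<^sup>+x. (ennreal (\<phi> (- x)) * indicator (E \<inter> {..p}) (- x)) \<partial>lborel)"
      by (intro nn_integral_cong) (auto split: split_indicator)
    also have "\<dots> = (\<integral>\<^sup>+x\<in>E \<inter> {..p}. ennreal (\<phi> x) \<partial>lborel)"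
      by (intro nn_integral_lborel_uminus) measurable
    finally show ?thesis .
  qed
  have "(\<integral>\<^sup>+x\<in>{x. - x \<in> F} \<inter> {-p..}. ennreal (\<phi> (- x)) \<partial>lborel) \<le>
      ennreal \<delta> * (\<integral>\<^sup>+x\<in>{x. - x \<in> - B} \<inter> {-p..}. ennreal (\<phi> (- x)) \<partial>lborel)"
  proof (rule nn_integral_antimono_le[where Y = Y])
    have cl: "closed {x. - x \<in> E}" if "closed E" for E :: "real set"
      using that by (intro continuous_closed_preimage[of UNIV uminus, simplified vimage_def, simplified])
        (auto intro!: continuous_intros)
    have neg: "measure lborel ({x. - x \<in> F} \<inter> {x..y}) = measure lborel (F \<inter> {-y..-x})" for x y
    proof -
      have "{x. - x \<in> F} \<inter> {x..y} = {z. - z \<in> F \<inter> {-y..-x}}" by auto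
      then show ?thesis using measure_lborel_uminus[of "F \<inter> {-y..-x}"] by simp
    qed
    show "measure lborel ({x. - x \<in> F} \<inter> {-p..y}) \<le> \<delta> * measure lborel ({x. - x \<in> - B} \<inter> {-p..y})"
      if "- p \<le> y" for y
    proof -
      have "measure lborel ({x. - x \<in> F} \<inter> {-p..y}) \<le> \<delta> * measure lborel (- {x. - x \<in> B} \<inter> {-p..y})"
      proof (rule proportion_outside)
        show "measure lborel ({x. - x \<in> F} \<inter> {x..z}) \<le> \<delta> * (z - x)" if "x \<in> {x. - x \<in> B}" "x \<le> z" for x z
          unfolding neg using left[of "- x" "- z"] that by simp
      qed (use cl B F disj \<delta> p that in auto)
      then show ?thesis by (simp add: Collect_neg_eq)
    qed
    show "\<phi> (- y) \<le> \<phi> (- x)" if "- p \<le> x" "x \<le> y" for x y using inc[of "- y" "- x"] that p by auto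
  qed (use zero \<delta> in auto)
  then have L: "(\<integral>\<^sup>+x\<in>F \<inter> {..p}. ennreal (\<phi> x) \<partial>lborel) \<le> ennreal \<delta> * (\<integral>\<^sup>+x\<in>- B \<inter> {..p}. ennreal (\<phi> x) \<partial>lborel)"
    by (subst (asm) (1 2) refl) auto
  have "(\<integral>\<^sup>+x\<in>F. ennreal (\<phi> x) \<partial>lborel) \<le>
      (\<integral>\<^sup>+x. ennreal (\<phi> x) * indicator (F \<inter> {..p}) x + ennreal (\<phi> x) * indicator (F \<inter> {p..}) x \<partial>lborel)"
    by (intro nn_integral_mono) (auto split: split_indicator)
  also have "\<dots> = (\<integral>\<^sup>+x\<in>F \<inter> {..p}. ennreal (\<phi> x) \<partial>lborel) + (\<integral>\<^sup>+x\<in>F \<inter> {p..}. ennreal (\<phi> x) \<partial>lborel)"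
    by (intro nn_integral_add) measurable
  also have "\<dots> \<le> ennreal \<delta> * (ennreal ((c - p) * \<phi> c) + (\<integral>\<^sup>+x\<in>- B \<inter> {..p}. ennreal (\<phi> x) \<partial>lborel)
      + (\<integral>\<^sup>+x\<in>- B \<inter> {c..}. ennreal (\<phi> x) \<partial>lborel))"
    using add_mono[OF L R] by (simp add: distrib_left add_ac)
  finally show ?thesis .
qed

section \<open>Concave probabilities on the line\<close>

text \<open>Intervals are enough, since they correspond to slabs of a convex body. Positivity of the
  combined interval is a separate conclusion because \<open>boxcox s 0\<close> is a meaningless
  default: \<open>ln 0 = 0\<close>, and for \<open>s < 0\<close> the value \<open>- 1 / s\<close> is
  even positive. The bounded support lets half-lines be treated as intervals.\<close>

locale boxcox_concave_line = real_distribution \<nu> for \<nu> +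
  fixes s r :: real
  assumes s_le: "s \<le> 1"
    and bounded: "measure \<nu> {-r..r} = 1"
    and concave: "\<And>a b a' b' t. 0 \<le> t \<Longrightarrow> t \<le> 1 \<Longrightarrow> 0 < measure \<nu> {a..b} \<Longrightarrow> 0 < measure \<nu> {a'..b'} \<Longrightarrow>
      0 < measure \<nu> {(1 - t) * a + t * a'..(1 - t) * b + t * b'} \<and>
      (1 - t) * boxcox s (measure \<nu> {a..b}) + t * boxcox s (measure \<nu> {a'..b'}) \<le>
        boxcox s (measure \<nu> {(1 - t) * a + t * a'..(1 - t) * b + t * b'})"
begin

text \<open>This form also covers intervals of mass zero. It suffices for the analysis of atoms and
  for the unimodality of the smoothed density.\<close>

lemma quasi_concave:
  assumes "0 \<le> t" "t \<le> 1"
  shows "min (measure \<nu> {a..b}) (measure \<nu> {a'..b'}) \<le>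
    measure \<nu> {(1 - t) * a + t * a'..(1 - t) * b + t * b'}"
proof (cases "0 < min (measure \<nu> {a..b}) (measure \<nu> {a'..b'})")
  case True
  let ?m = "min (measure \<nu> {a..b}) (measure \<nu> {a'..b'})"
  from True have pos: "0 < measure \<nu> {a..b}" "0 < measure \<nu> {a'..b'}" by auto
  have "boxcox s ?m = (1 - t) * boxcox s ?m + t * boxcox s ?m" by (simp add: algebra_simps)
  also have "\<dots> \<le> (1 - t) * boxcox s (measure \<nu> {a..b}) + t * boxcox s (measure \<nu> {a'..b'})"
    using assms True pos by (intro add_mono mult_left_mono) (auto simp: boxcox_le_iff)
  also have "\<dots> \<le> boxcox s (measure \<nu> {(1 - t) * a + t * a'..(1 - t) * b + t * b'})"
    using concave[OF assms pos] by blast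
  finally show ?thesis using concave[OF assms pos] True by (simp add: boxcox_le_iff)
next
  case False
  then have "min (measure \<nu> {a..b}) (measure \<nu> {a'..b'}) \<le> 0" by linarith
  then show ?thesis using measure_nonneg order_trans by blast
qed

section \<open>Atoms of a concave probability\<close>

lemma AE_bounded: "AE x in \<nu>. x \<in> {-r..r}"
  using bounded by (subst prob_eq_1 [symmetric]) (auto simp: measurable_cong)

lemma measure_eq_Int_bounded:
  assumes [measurable]: "E \<in> sets borel" "E' \<in> sets borel"
    and "\<And>x. x \<in> {-r..r} \<Longrightarrow> x \<in> E \<longleftrightarrow> x \<in> E'"
  shows "measure \<nu> E = measure \<nu> E'"
  by (intro finite_measure_eq_AE) (use AE_bounded assms(3) in \<open>auto elim: eventually_mono\<close>)

lemma reflect: "boxcox_concave_line (distr \<nu> borel uminus) s r"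
proof -
  have m: "measure (distr \<nu> borel uminus) {a..b} = measure \<nu> {-b..-a}" for a b
  proof -
    have "uminus -` {a..b} = {-b..-a}" by force
    then show ?thesis by (subst measure_distr) auto
  qed
  interpret R: real_distribution "distr \<nu> borel uminus" by (rule real_distribution_distr) simp
  show ?thesis
  proof
    fix a b a' b' t :: real
    assume "0 \<le> t" "t \<le> 1" "0 < measure (distr \<nu> borel uminus) {a..b}"
      "0 < measure (distr \<nu> borel uminus) {a'..b'}"
    then show "0 < measure (distr \<nu> borel uminus) {(1 - t) * a + t * a'..(1 - t) * b + t * b'} \<and>
      (1 - t) * boxcox s (measure (distr \<nu> borel uminus) {a..b}) +
        t * boxcox s (measure (distr \<nu> borel uminus) {a'..b'}) \<le>
        boxcox s (measure (distr \<nu> borel uminus) {(1 - t) * a + t * a'..(1 - t) * b + t * b'})"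
      using concave[of t "- b" "- a" "- b'" "- a'"] by (simp add: m algebra_simps)
  qed (use s_le bounded in \<open>simp_all add: m\<close>)
qed

text \<open>If \<open>a\<close> and an interval \<open>{c..r}\<close> to its right both had mass at
  least \<open>v > 0\<close>, so would every interval obtained by contracting \<open>{c..r}\<close>
  towards \<open>a\<close>. These lie in the sets \<open>{a<..a + t * (r - a)}\<close>, which shrink
  to the empty set as \<open>t\<close> tends to 0.\<close>

lemma atom_right_null:
  assumes "0 < measure \<nu> {a}"
  shows "measure \<nu> {a<..} = 0"
proof (rule ccontr)
  assume "measure \<nu> {a<..} \<noteq> 0"
  moreover have "(\<lambda>n. measure \<nu> {a + inverse (Suc n)..}) \<longlonglongrightarrow> measure \<nu> (\<Union>n. {a + inverse (Suc n)..})"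
    by (intro finite_Lim_measure_incseq) (auto simp: incseq_def intro: le_imp_inverse_le order_trans)
  moreover have "(\<Union>n. {a + inverse (real (Suc n))..}) = {a<..}"
  proof (intro equalityI subsetI)
    fix x assume "x \<in> {a<..}"
    then obtain n where "inverse (real (Suc n)) < x - a" using reals_Archimedean[of "x - a"] by auto
    then show "x \<in> (\<Union>n. {a + inverse (real (Suc n))..})" by (auto intro!: exI[of _ n])
  next
    fix x assume "x \<in> (\<Union>n. {a + inverse (real (Suc n))..})"
    then obtain n where "a + inverse (real (Suc n)) \<le> x" by auto
    moreover have "0 < inverse (real (Suc n))" by simp
    ultimately show "x \<in> {a<..}" unfolding greaterThan_iff by linarith
  qed
  ultimately have "\<not> (\<forall>n. measure \<nu> {a + inverse (real (Suc n))..} = 0)"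
    by (auto simp: LIMSEQ_const_iff)
  then obtain n where "measure \<nu> {a + inverse (real (Suc n))..} \<noteq> 0" by blast
  moreover define c where "c = a + inverse (real (Suc n))"
  moreover have "measure \<nu> {c..} = measure \<nu> {c..r}" by (rule measure_eq_Int_bounded) auto
  ultimately have cr: "0 < measure \<nu> {c..r}" by (simp add: zero_less_measure_iff)
  have "a < c" by (simp add: c_def)
  define v where "v = min (measure \<nu> {a}) (measure \<nu> {c..r})"
  have "0 < v" using cr assms by (simp add: v_def)
  have "c \<le> r" using cr by (rule contrapos_pp) simp
  have v_le: "v \<le> measure \<nu> {a<..a + inverse (Suc n) * (r - a)}" for n
  proof -
    let ?t = "inverse (real (Suc n))"
    have "v \<le> measure \<nu> {(1 - ?t) * a + ?t * c..(1 - ?t) * a + ?t * r}"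
      unfolding v_def using quasi_concave[of ?t a a c r] by (simp add: field_simps)
    also have "\<dots> \<le> measure \<nu> {a<..a + ?t * (r - a)}"
    proof (intro finite_measure_mono subsetI)
      fix x assume x: "x \<in> {(1 - ?t) * a + ?t * c..(1 - ?t) * a + ?t * r}"
      have "(1 - ?t) * a + ?t * c = a + ?t * (c - a)" "(1 - ?t) * a + ?t * r = a + ?t * (r - a)"
        by (simp_all add: algebra_simps)
      moreover have "0 < ?t * (c - a)" using \<open>a < c\<close> by simp
      ultimately show "x \<in> {a<..a + ?t * (r - a)}" using x by auto
    qed auto
    finally show ?thesis .
  qed
  have "(\<lambda>n. measure \<nu> {a<..a + inverse (Suc n) * (r - a)}) \<longlonglongrightarrow>
      measure \<nu> (\<Inter>n. {a<..a + inverse (Suc n) * (r - a)})"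
  proof (intro finite_Lim_measure_decseq)
    have "a + inverse (Suc n) * (r - a) \<le> a + inverse (Suc m) * (r - a)" if "m \<le> n" for m n
      using that \<open>a < c\<close> \<open>c \<le> r\<close> by (intro add_left_mono mult_right_mono le_imp_inverse_le) auto
    from order_trans[OF _ this] show "decseq (\<lambda>n. {a<..a + inverse (Suc n) * (r - a)})"
      by (auto simp: decseq_def simp del: of_nat_Suc)
  qed auto
  moreover have "(\<Inter>n. {a<..a + inverse (real (Suc n)) * (r - a)}) = {}"
  proof -
    have "\<exists>n. a + inverse (real (Suc n)) * (r - a) < x" if "a < x" for x
    proof -
      have "0 < (x - a) / (r - a)" using that \<open>a < c\<close> \<open>c \<le> r\<close> by simp
      then obtain n where "inverse (real (Suc n)) < (x - a) / (r - a)"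
        using reals_Archimedean by blast
      then have "inverse (real (Suc n)) * (r - a) < x - a"
        using \<open>a < c\<close> \<open>c \<le> r\<close> by (simp add: pos_less_divide_eq)
      then show ?thesis by (intro exI[of _ n]) linarith
    qed
    then have "x \<notin> (\<Inter>n. {a<..a + inverse (real (Suc n)) * (r - a)})" for x
      by (cases "a < x") (auto simp: not_le simp del: of_nat_Suc)
    then show ?thesis by blast
  qed
  ultimately have "(\<lambda>n. measure \<nu> {a<..a + inverse (Suc n) * (r - a)}) \<longlonglongrightarrow> 0" by simp
  then have "v \<le> 0" by (rule LIMSEQ_le_const) (use v_le in auto)
  with \<open>0 < v\<close> show False by simp
qed

text \<open>So a concave probability is atomless or a Dirac measure. Besides serving the line
  inequality, this gives the corresponding dichotomy for hyperplanes during the bisection.\<close>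

lemma atom_eq_1:
  assumes "0 < measure \<nu> {a}"
  shows "measure \<nu> {a} = 1"
proof -
  interpret R: boxcox_concave_line "distr \<nu> borel uminus" s r by (rule reflect)
  have m: "measure (distr \<nu> borel uminus) E = measure \<nu> (uminus -` E)" if "E \<in> sets borel" for E
    using that by (subst measure_distr) auto
  have "uminus -` {- a} = {a}" "uminus -` {- a<..} = {..<a}" by auto
  then have "measure \<nu> {..<a} = 0"
    using R.atom_right_null[of "- a"] assms by (simp add: m)
  moreover have "measure \<nu> {a<..} = 0" using assms by (rule atom_right_null)
  ultimately have "measure \<nu> ({..<a} \<union> {a<..}) = 0"
    by (subst finite_measure_Union) auto
  then have "measure \<nu> (space \<nu> - ({..<a} \<union> {a<..})) = 1" by (subst prob_compl) auto
  moreover have "space \<nu> - ({..<a} \<union> {a<..}) = {a}" by auto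
  ultimately show ?thesis by simp
qed

end

section \<open>Smoothing an atomless probability\<close>

locale atomless_boxcox_concave_line = boxcox_concave_line +
  assumes no_atom: "measure \<nu> {a} = 0"
begin

lemma measure_Icc_eq_cdf: "a \<le> b \<Longrightarrow> measure \<nu> {a..b} = cdf \<nu> b - cdf \<nu> a"
proof -
  assume "a \<le> b"
  have "{a..b} = {a} \<union> {a<..b}" using \<open>a \<le> b\<close> by auto
  moreover have "measure \<nu> ({a} \<union> {a<..b}) = measure \<nu> {a} + measure \<nu> {a<..b}"
    by (rule finite_measure_Union) auto
  ultimately have "measure \<nu> {a..b} = measure \<nu> {a} + measure \<nu> {a<..b}" by simp
  then show ?thesis using cdf_diff_eq[of a b] \<open>a \<le> b\<close> by (cases "a = b") (auto simp: no_atom)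
qed

lemma continuous_cdf: "continuous_on S (cdf \<nu>)"
  using isCont_cdf no_atom by (auto intro!: continuous_at_imp_continuous_on)

text \<open>Divided by \<open>2 * h\<close>, this is the density of the smoothed measure below. Its
  maximum is the mass of the overlap of the two enlarged sides of the mode, the
  \<open>\<kappa>\<close> of \<open>boxcox_balance\<close>.\<close>

definition window :: "real \<Rightarrow> real \<Rightarrow> real" where
  "window h z = measure \<nu> {z - h..z + h}"

lemma continuous_window: "0 \<le> h \<Longrightarrow> continuous_on S (window h)"
proof -
  assume "0 \<le> h"
  then have "window h = (\<lambda>z. cdf \<nu> (z + h) - cdf \<nu> (z - h))"
    by (auto simp: window_def measure_Icc_eq_cdf)
  moreover have "continuous_on S (\<lambda>z. cdf \<nu> (z + a))" for a
    by (rule continuous_on_compose2[OF continuous_cdf[of UNIV]]) (auto intro!: continuous_intros)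
  from this[of h] this[of "- h"] have "continuous_on S (\<lambda>z. cdf \<nu> (z + h) - cdf \<nu> (z - h))"
    by (auto intro!: continuous_intros)
  ultimately show ?thesis by simp
qed

lemma window_measurable: "0 \<le> h \<Longrightarrow> window h \<in> borel_measurable borel"
  by (intro borel_measurable_continuous_onI continuous_window)

lemma window_zero: "r + h < \<bar>z\<bar> \<Longrightarrow> window h z = 0"
proof -
  assume "r + h < \<bar>z\<bar>"
  then have "measure \<nu> {z - h..z + h} = measure \<nu> {}"
    by (intro measure_eq_Int_bounded) auto
  then show ?thesis by (simp add: window_def)
qed

lemma r_nonneg: "0 \<le> r"
  using bounded by (rule contrapos_pp) simp

lemma window_max:
  assumes "0 \<le> h"
  obtains c where "\<And>z. window h z \<le> window h c"
proof -
  obtain c where c: "c \<in> {-r - h..r + h}" "\<And>z. z \<in> {-r - h..r + h} \<Longrightarrow> window h z \<le> window h c"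
    using continuous_attains_sup[OF _ _ continuous_window[OF assms], of "{-r - h..r + h}"] assms r_nonneg by force
  have "window h z \<le> window h c" for z
  proof (cases "r + h < \<bar>z\<bar>")
    case True
    then show ?thesis by (simp add: window_zero) (simp add: window_def)
  next
    case False
    then show ?thesis by (intro c) auto
  qed
  then show thesis by (rule that)
qed

lemma window_uniformly_small:
  assumes "0 < e" "0 < d"
  obtains h where "0 < h" "h \<le> d" "\<And>z. window h z \<le> e"
proof -
  have "uniformly_continuous_on {-r - 2..r + 2} (cdf \<nu>)"
    by (intro compact_uniformly_continuous continuous_cdf compact_Icc)
  then obtain \<eta> where \<eta>: "0 < \<eta>" "\<And>x y. x \<in> {-r - 2..r + 2} \<Longrightarrow> y \<in> {-r - 2..r + 2} \<Longrightarrow>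
      dist y x < \<eta> \<Longrightarrow> dist (cdf \<nu> y) (cdf \<nu> x) < e"
    using assms unfolding uniformly_continuous_on_def by metis
  \<comment> \<open>With \<open>h \<le> 1\<close> and \<open>\<bar>z\<bar> \<le> r + h\<close>, both
    \<open>z - h\<close> and \<open>z + h\<close> stay in the interval of uniform continuity;
    \<open>\<eta> / 4\<close> makes their distance \<open>2 * h\<close> less than
    \<open>\<eta>\<close>.\<close>
  define h where "h = min d (min 1 (\<eta> / 4))"
  have h: "0 < h" "h \<le> d" "h \<le> 1" "2 * h < \<eta>" using assms \<eta>(1) by (auto simp: h_def)
  have "window h z \<le> e" for z
  proof (cases "r + h < \<bar>z\<bar>")
    case True
    then show ?thesis using assms by (simp add: window_zero)
  next
    case False
    then have "dist (cdf \<nu> (z + h)) (cdf \<nu> (z - h)) < e"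
      using h by (intro \<eta>) (auto simp: dist_real_def)
    then show ?thesis using h by (auto simp: window_def measure_Icc_eq_cdf dist_real_def)
  qed
  with h show thesis by (intro that[of h]) auto
qed

text \<open>The convolution of \<open>\<nu>\<close> with the uniform distribution on \<open>[-h, h]\<close>: its density is unimodal,
  so that no density of \<open>\<nu>\<close> itself is needed.\<close>

definition smoothed :: "real \<Rightarrow> real measure" where
  "smoothed h = density lborel (\<lambda>z. ennreal (window h z / (2 * h)))"

lemma sets_smoothed [simp, measurable_cong]: "sets (smoothed h) = sets borel"
  by (simp add: smoothed_def)

lemma emeasure_smoothed:
  assumes "0 < h" "E \<in> sets borel"
  shows "emeasure (smoothed h) E = (\<integral>\<^sup>+z\<in>E. ennreal (window h z / (2 * h)) \<partial>lborel)"
proof -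
  have [measurable]: "window h \<in> borel_measurable borel" using assms by (intro window_measurable) simp
  show ?thesis unfolding smoothed_def using assms(2) by (intro emeasure_density) simp_all
qed

text \<open>Fubini in the other order: the smoothed mass of \<open>E\<close> is the average over
  \<open>w\<close> of the proportion of \<open>E\<close> in \<open>{w - h..w + h}\<close>. The
  comparisons with \<open>\<nu>\<close> below use only that this proportion is at most 1, is 0 when
  \<open>E\<close> misses the interval, and is 1 when \<open>E\<close> contains it.\<close>

lemma emeasure_smoothed_eq:
  assumes h: "0 < h" and [measurable]: "E \<in> sets borel"
  shows "emeasure (smoothed h) E = (\<integral>\<^sup>+w. ennreal (measure lborel (E \<inter> {w - h..w + h}) / (2 * h)) \<partial>\<nu>)"
proof -
  interpret P: pair_sigma_finite lborel \<nu> ..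
  let ?k = "\<lambda>z w. ennreal (1 / (2 * h)) * indicator {x. fst x \<in> E \<and> \<bar>snd x - fst x\<bar> \<le> h} (z, w)"
  have "emeasure (smoothed h) E = (\<integral>\<^sup>+z. \<integral>\<^sup>+w. ?k z w \<partial>\<nu> \<partial>lborel)"
    unfolding emeasure_smoothed[OF assms]
  proof (intro nn_integral_cong)
    fix z :: real
    have "(\<integral>\<^sup>+w. ?k z w \<partial>\<nu>) = (\<integral>\<^sup>+w. ennreal (1 / (2 * h)) * indicator E z * indicator {z - h..z + h} w \<partial>\<nu>)"
      by (intro nn_integral_cong) (auto split: split_indicator simp: abs_le_iff)
    also have "\<dots> = ennreal (1 / (2 * h)) * indicator E z * emeasure \<nu> {z - h..z + h}"
      by (intro nn_integral_cmult_indicator) simp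
    also have "\<dots> = ennreal (window h z / (2 * h)) * indicator E z"
    proof -
      have "ennreal (1 / (2 * h)) * emeasure \<nu> {z - h..z + h} = ennreal (window h z / (2 * h))"
        using h by (simp add: window_def emeasure_eq_measure flip: ennreal_mult)
      then show ?thesis by (simp add: mult_ac)
    qed
    finally show "ennreal (window h z / (2 * h)) * indicator E z = (\<integral>\<^sup>+w. ?k z w \<partial>\<nu>)" ..
  qed
  also have "\<dots> = (\<integral>\<^sup>+w. \<integral>\<^sup>+z. ?k z w \<partial>lborel \<partial>\<nu>)"
    by (intro P.Fubini' [symmetric]) measurable
  also have "\<dots> = (\<integral>\<^sup>+w. ennreal (measure lborel (E \<inter> {w - h..w + h}) / (2 * h)) \<partial>\<nu>)"
  proof (intro nn_integral_cong)
    fix w :: real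
    have "(\<integral>\<^sup>+z. ?k z w \<partial>lborel) = (\<integral>\<^sup>+z. ennreal (1 / (2 * h)) * indicator (E \<inter> {w - h..w + h}) z \<partial>lborel)"
      by (intro nn_integral_cong) (auto split: split_indicator simp: abs_le_iff)
    also have "\<dots> = ennreal (1 / (2 * h)) * emeasure lborel (E \<inter> {w - h..w + h})"
      by (intro nn_integral_cmult_indicator) simp
    finally show "(\<integral>\<^sup>+z. ?k z w \<partial>lborel) = ennreal (measure lborel (E \<inter> {w - h..w + h}) / (2 * h))"
      using h by (simp add: emeasure_Int_interval flip: ennreal_mult)
  qed
  finally show ?thesis .
qed

lemma emeasure_smoothed_le:
  assumes "0 < h" "E \<in> sets borel" "D \<in> sets borel"
    and "\<And>w. w \<notin> D \<Longrightarrow> E \<inter> {w - h..w + h} = {}"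
  shows "emeasure (smoothed h) E \<le> ennreal (measure \<nu> D)"
proof -
  have "emeasure (smoothed h) E \<le> (\<integral>\<^sup>+w. indicator D w \<partial>\<nu>)"
    unfolding emeasure_smoothed_eq[OF assms(1,2)]
  proof (intro nn_integral_mono)
    fix w
    show "ennreal (measure lborel (E \<inter> {w - h..w + h}) / (2 * h)) \<le> indicator D w"
      using assms(4)[of w] assms(1) measure_Int_interval_le[OF assms(2), of "w - h" "w + h"]
      by (auto split: split_indicator)
  qed
  with assms show ?thesis by (simp add: emeasure_eq_measure)
qed

lemma emeasure_smoothed_ge:
  assumes "0 < h" "E \<in> sets borel" "D \<in> sets borel"
    and "\<And>w. w \<in> D \<Longrightarrow> {w - h..w + h} \<subseteq> E"
  shows "ennreal (measure \<nu> D) \<le> emeasure (smoothed h) E"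
proof -
  have "(\<integral>\<^sup>+w. indicator D w \<partial>\<nu>) \<le> emeasure (smoothed h) E"
    unfolding emeasure_smoothed_eq[OF assms(1,2)]
  proof (intro nn_integral_mono)
    fix w
    have "E \<inter> {w - h..w + h} = {w - h..w + h}" if "w \<in> D" using assms(4)[OF that] by auto
    then show "indicator D w \<le> ennreal (measure lborel (E \<inter> {w - h..w + h}) / (2 * h))"
      using assms(1) by (auto split: split_indicator)
  qed
  with assms show ?thesis by (simp add: emeasure_eq_measure)
qed

lemma finite_measure_smoothed: "0 < h \<Longrightarrow> finite_measure (smoothed h)"
  using emeasure_smoothed_le[of h UNIV UNIV]
  by (intro finite_measureI) (auto simp: smoothed_def top_unique)

lemma measure_smoothed_le:
  assumes "0 < h" "E \<in> sets borel" "D \<in> sets borel"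
    and "\<And>w. w \<notin> D \<Longrightarrow> E \<inter> {w - h..w + h} = {}"
  shows "measure (smoothed h) E \<le> measure \<nu> D"
  using emeasure_smoothed_le[OF assms] finite_measure.emeasure_eq_measure[OF finite_measure_smoothed[OF assms(1)]]
  by simp

lemma measure_smoothed_ge:
  assumes "0 < h" "E \<in> sets borel" "D \<in> sets borel"
    and "\<And>w. w \<in> D \<Longrightarrow> {w - h..w + h} \<subseteq> E"
  shows "measure \<nu> D \<le> measure (smoothed h) E"
  using emeasure_smoothed_ge[OF assms] finite_measure.emeasure_eq_measure[OF finite_measure_smoothed[OF assms(1)]]
  by simp

text \<open>The interval around a point between \<open>x\<close> and the maximum point
  \<open>c\<close> is a convex combination of those around \<open>x\<close> and \<open>c\<close>;
  its mass is at least the smaller of the two, which is the one at \<open>x\<close>.\<close>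

lemma window_mode_mono:
  assumes "\<And>z. window h z \<le> window h c"
  shows "x \<le> y \<Longrightarrow> y \<le> c \<Longrightarrow> window h x \<le> window h y"
    and "c \<le> y \<Longrightarrow> y \<le> x \<Longrightarrow> window h x \<le> window h y"
proof -
  have *: "window h x \<le> window h y" if t: "0 \<le> t" "t \<le> 1" "t * (c - x) = y - x" for t
  proof -
    have "window h x = min (window h x) (window h c)"
      by (rule min_absorb1 [symmetric]) (rule assms)
    also have "\<dots> \<le> window h y"
    proof -
      have "(1 - t) * (x - h) + t * (c - h) = y - h" "(1 - t) * (x + h) + t * (c + h) = y + h"
        using t(3) by (simp_all add: algebra_simps)
      then show ?thesis
        unfolding window_def using quasi_concave[OF t(1,2), of "x - h" "x + h" "c - h" "c + h"] by simp
    qed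
    finally show ?thesis .
  qed
  show "window h x \<le> window h y" if "x \<le> y" "y \<le> c"
    using that by (cases "x = c") (auto intro!: *[of "(y - x) / (c - x)"])
  show "window h x \<le> window h y" if "c \<le> y" "y \<le> x"
    using that by (cases "x = c") (auto intro!: *[of "(y - x) / (c - x)"] simp: divide_nonpos_nonpos divide_le_eq)
qed

text \<open>The function \<open>boxcox s \<circ> cdf \<nu>\<close> is concave, so its mean slope on \<open>[v, z]\<close> is at most the one on
  \<open>[u, z]\<close>.\<close>

lemma cdf_slope_le:
  assumes "u \<le> v" "v < z" and pos: "0 < cdf \<nu> u"
  shows "(cdf \<nu> z - cdf \<nu> v) / (z - v) * (z - u) \<le> cdf \<nu> z * (- boxcox s (cdf \<nu> u / cdf \<nu> z))"
proof -
  \<comment> \<open>All these intervals share the left end \<open>-r\<close>, which convex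
    combinations preserve; so \<open>concave\<close> speaks about distribution functions.\<close>
  have cdf: "cdf \<nu> x = measure \<nu> {-r..x}" for x
    unfolding cdf_def by (rule measure_eq_Int_bounded) auto
  have pos': "0 < cdf \<nu> v" "0 < cdf \<nu> z"
    using pos cdf_nondecreasing[of u v] cdf_nondecreasing[of u z] assms by auto
  define t where "t = (v - u) / (z - u)"
  have t: "0 \<le> t" "t \<le> 1" "1 - t = (z - v) / (z - u)"
    using assms by (auto simp: t_def field_simps)
  have "t * (z - u) = v - u" using assms by (simp add: t_def)
  then have t4: "(1 - t) * u + t * z = v" by (simp add: algebra_simps)
  let ?b = "\<lambda>x. boxcox s (cdf \<nu> x)"
  have "(1 - t) * ?b u + t * ?b z \<le> ?b v"
    using concave[OF t(1,2), of "-r" u "-r" z] pos pos'(2) unfolding t4 by (simp add: cdf algebra_simps)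
  then have "?b z - ?b v \<le> (1 - t) * (?b z - ?b u)" by (simp add: algebra_simps)
  moreover have "cdf \<nu> z powr (s - 1) * (cdf \<nu> z - cdf \<nu> v) \<le> ?b z - ?b v"
    using s_le pos' assms cdf_nondecreasing[of v z] by (intro boxcox_diff_ge) auto
  ultimately have "cdf \<nu> z powr (s - 1) * (cdf \<nu> z - cdf \<nu> v) \<le> (z - v) / (z - u) * (?b z - ?b u)"
    using t(3) by simp
  \<comment> \<open>The factor \<open>cdf \<nu> z powr (1 - s)\<close> cancels the end slope on the
    left and, by \<open>boxcox_divide\<close>, turns the difference on the right into
    \<open>cdf \<nu> z\<close> times a function of the ratio
    \<open>cdf \<nu> u / cdf \<nu> z\<close>.\<close>
  then have "cdf \<nu> z powr (1 - s) * (cdf \<nu> z powr (s - 1) * (cdf \<nu> z - cdf \<nu> v)) \<le>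
      cdf \<nu> z powr (1 - s) * ((z - v) / (z - u) * (?b z - ?b u))"
    by (rule mult_left_mono) simp
  moreover have "cdf \<nu> z powr (1 - s) * cdf \<nu> z powr (s - 1) = 1"
    using pos' by (simp flip: powr_add)
  ultimately have "cdf \<nu> z - cdf \<nu> v \<le> (z - v) / (z - u) * (cdf \<nu> z powr (1 - s) * (?b z - ?b u))"
    by (simp add: mult.assoc [symmetric]) (simp add: mult_ac)
  moreover have "cdf \<nu> z powr (1 - s) * (?b z - ?b u) = cdf \<nu> z * (- boxcox s (cdf \<nu> u / cdf \<nu> z))"
    using pos pos' powr_add[of "cdf \<nu> z" 1 "- s"] by (simp add: boxcox_divide algebra_simps)
  ultimately show ?thesis using assms by (simp add: field_simps)
qed

text \<open>\<open>boxcox_balance\<close> is applied to the sides \<open>{..c + h}\<close> and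
  \<open>{c - h..}\<close>, which overlap in the window of the mode, with \<open>L0\<close> the mass
  of \<open>{..p + h}\<close>, where \<open>p\<close> is the last point of \<open>B\<close> up to
  \<open>c\<close>. The half-lines are enlarged by \<open>h\<close> because smoothing moves mass by
  at most \<open>h\<close>; for the same reason the conclusion concerns \<open>B0\<close> and
  \<open>F0\<close>, whose \<open>h\<close>-neighbourhoods lie in \<open>B\<close> and
  \<open>F\<close>. The assumption \<open>bal\<close> says that \<open>B\<close> has the larger
  proportion on the left.\<close>

lemma measure_le_one_sided:
  assumes h: "0 < h" and mode: "\<And>z. window h z \<le> window h c"
    and B: "closed B" and F: "closed F" and disj: "B \<inter> F = {}" and \<delta>: "0 \<le> \<delta>"
    and right: "\<And>x y. x \<in> B \<Longrightarrow> x \<le> y \<Longrightarrow> measure lborel (F \<inter> {x..y}) \<le> \<delta> * (y - x)"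
    and left: "\<And>x y. x \<in> B \<Longrightarrow> y \<le> x \<Longrightarrow> measure lborel (F \<inter> {y..x}) \<le> \<delta> * (x - y)"
    and B0: "B0 \<in> sets borel" "\<And>w. w \<in> B0 \<Longrightarrow> {w - h..w + h} \<subseteq> B"
    and F0: "F0 \<in> sets borel" "\<And>w. w \<in> F0 \<Longrightarrow> {w - h..w + h} \<subseteq> F"
    and \<kappa>: "window h c < measure \<nu> B0"
    and pos: "0 < measure (smoothed h) (B \<inter> {..c})"
    and bal: "measure (smoothed h) (B \<inter> {c..}) * measure \<nu> {..c + h} \<le>
      measure (smoothed h) (B \<inter> {..c}) * measure \<nu> {c - h..}"
  shows "measure \<nu> F0 \<le> \<delta> * (- boxcox s (measure \<nu> B0 - window h c)
    + window h c * (1 - boxcox s (measure \<nu> B0 / 2)))"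
proof -
  interpret N: finite_measure "smoothed h" using h by (rule finite_measure_smoothed)
  have [measurable]: "B \<in> sets borel" "F \<in> sets borel" using B F by (auto simp: borel_closed)
  define N where "N = measure (smoothed h)"
  have wpos: "0 \<le> window h z" for z by (simp add: window_def)
  have "B \<inter> {..c} \<noteq> {}" using pos by auto
  then obtain x0 where x0: "x0 \<in> B" "x0 \<le> c" by auto
  have "compact (B \<inter> {x0..c})" using B by (simp add: closed_Int_compact)
  moreover have "B \<inter> {x0..c} \<noteq> {}" using x0 by auto
  ultimately obtain p where p': "p \<in> B \<inter> {x0..c}" "\<And>z. z \<in> B \<inter> {x0..c} \<Longrightarrow> z \<le> p"
    using compact_attains_sup[of "B \<inter> {x0..c}"] by meson
  then have p: "p \<in> B" "p \<le> c" by auto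
  have Bp: "B \<inter> {..c} = B \<inter> {..p}"
  proof (intro equalityI subsetI)
    fix z assume z: "z \<in> B \<inter> {..c}"
    then have "z \<le> p" using p'(1) p'(2)[of z] by (cases "x0 \<le> z") auto
    with z show "z \<in> B \<inter> {..p}" by auto
  qed (use p in auto)
  define X where "X = (c - p) * (window h c / (2 * h))"
  have "emeasure (smoothed h) F \<le> ennreal \<delta> * (ennreal X + emeasure (smoothed h) (- B \<inter> {..p})
      + emeasure (smoothed h) (- B \<inter> {c..}))"
  proof -
    have "window h \<in> borel_measurable borel" using h by (intro window_measurable) simp
    note [measurable] = this
    show ?thesis
      unfolding emeasure_smoothed[OF h \<open>F \<in> sets borel\<close>] X_def
      by (subst (1 2) emeasure_smoothed[OF h], measurable,
          rule nn_integral_unimodal_le[OF _ _ _ _ _ B F disj \<delta> right left p, where Y = "r + h"])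
        (use h wpos window_mode_mono[OF mode] window_zero in \<open>auto intro!: divide_right_mono\<close>)
  qed
  also have "\<dots> = ennreal (\<delta> * (X + N (- B \<inter> {..p}) + N (- B \<inter> {c..})))"
    using \<delta> p h wpos by (simp add: N.emeasure_eq_measure N_def X_def ennreal_mult)
  finally have "N F \<le> \<delta> * (X + N (- B \<inter> {..p}) + N (- B \<inter> {c..}))"
    using \<delta> p h wpos by (subst (asm) N.emeasure_eq_measure, subst (asm) ennreal_le_iff) (auto simp: N_def X_def)
  moreover have "measure \<nu> F0 \<le> N F"
    unfolding N_def using F0 h by (intro measure_smoothed_ge) auto
  moreover have "N (- B \<inter> {..p}) + N (B \<inter> {..p}) = N {..p}"
    unfolding N_def by (subst N.finite_measure_Union [symmetric]) (auto intro!: arg_cong[where f = "measure _"])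
  moreover have "N (- B \<inter> {c..}) + N (B \<inter> {c..}) = N {c..}"
    unfolding N_def by (subst N.finite_measure_Union [symmetric]) (auto intro!: arg_cong[where f = "measure _"])
  moreover have "N {..p} \<le> measure \<nu> {..p + h}"
    unfolding N_def using h by (intro measure_smoothed_le) auto
  moreover have "N {c..} \<le> measure \<nu> {c - h..}"
    unfolding N_def using h by (intro measure_smoothed_le) auto
  ultimately have main: "measure \<nu> F0 \<le> \<delta> * (X + (measure \<nu> {..p + h} - N (B \<inter> {..c}))
      + (measure \<nu> {c - h..} - N (B \<inter> {c..})))"
    and \<beta>: "N (B \<inter> {..c}) \<le> measure \<nu> {..p + h}" "N (B \<inter> {c..}) \<le> measure \<nu> {c - h..}"
  proof -
    assume *: "N F \<le> \<delta> * (X + N (- B \<inter> {..p}) + N (- B \<inter> {c..}))" "measure \<nu> F0 \<le> N F"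
      "N (- B \<inter> {..p}) + N (B \<inter> {..p}) = N {..p}" "N (- B \<inter> {c..}) + N (B \<inter> {c..}) = N {c..}"
      "N {..p} \<le> measure \<nu> {..p + h}" "N {c..} \<le> measure \<nu> {c - h..}"
    have "0 \<le> N (- B \<inter> {..p})" "0 \<le> N (- B \<inter> {c..})" by (auto simp: N_def)
    with * show "N (B \<inter> {..c}) \<le> measure \<nu> {..p + h}" "N (B \<inter> {c..}) \<le> measure \<nu> {c - h..}"
      unfolding Bp by linarith+
    have "\<delta> * (X + N (- B \<inter> {..p}) + N (- B \<inter> {c..})) \<le> \<delta> * (X + (measure \<nu> {..p + h} - N (B \<inter> {..c}))
      + (measure \<nu> {c - h..} - N (B \<inter> {c..})))"
      unfolding Bp using * \<delta> by (intro mult_left_mono) linarith+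
    with * show "measure \<nu> F0 \<le> \<delta> * (X + (measure \<nu> {..p + h} - N (B \<inter> {..c}))
      + (measure \<nu> {c - h..} - N (B \<inter> {c..})))" by linarith
  qed
  have posL: "0 < measure \<nu> {..p + h}" using pos \<beta>(1) by (simp add: N_def)
  have leL: "measure \<nu> {..p + h} \<le> measure \<nu> {..c + h}" using p by (intro finite_measure_mono) auto
  have "X \<le> measure \<nu> {..c + h} * (- boxcox s (measure \<nu> {..p + h} / measure \<nu> {..c + h})) + window h c"
  \<comment> \<open>\<open>window h c / (2 * h)\<close> is the mean slope of
    \<open>cdf \<nu>\<close> on \<open>[c - h, c + h]\<close>, and \<open>[p + h, c + h]\<close> has
    length \<open>c - p\<close>; so \<open>cdf_slope_le\<close> bounds \<open>X\<close> if the
    second interval contains the first. Otherwise \<open>c - p < 2 * h\<close>, and \<open>X\<close>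
    is at most \<open>window h c\<close>.\<close>
  proof (cases "p + h \<le> c - h")
    case True
    then have "window h c / (2 * h) * (c - p) \<le>
        measure \<nu> {..c + h} * (- boxcox s (measure \<nu> {..p + h} / measure \<nu> {..c + h}))"
      using cdf_slope_le[of "p + h" "c - h" "c + h"] posL h
      by (simp add: cdf_def window_def measure_Icc_eq_cdf)
    with wpos[of c] show ?thesis by (simp add: X_def mult.commute)
  next
    case False
    then have "X \<le> 2 * h * (window h c / (2 * h))"
      unfolding X_def using h wpos by (intro mult_right_mono) auto
    moreover have "boxcox s (measure \<nu> {..p + h} / measure \<nu> {..c + h}) \<le> boxcox s 1"
      using posL leL by (subst boxcox_le_iff) auto
    then have "0 \<le> measure \<nu> {..c + h} * (- boxcox s (measure \<nu> {..p + h} / measure \<nu> {..c + h}))"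
      by (intro mult_nonneg_nonneg) auto
    ultimately show ?thesis using h by simp
  qed
  then have "X + (measure \<nu> {..p + h} - N (B \<inter> {..c})) + (measure \<nu> {c - h..} - N (B \<inter> {c..})) \<le>
      - boxcox s (measure \<nu> B0 - window h c) + window h c * (1 - boxcox s (measure \<nu> B0 / 2))"
  proof (rule boxcox_balance[rotated -1])
    show "measure \<nu> {..c + h} + measure \<nu> {c - h..} = 1 + window h c"
    proof -
      have "UNIV = {..c + h} \<union> {c + h<..}" "{c - h..} = {c - h..c + h} \<union> {c + h<..}" using h by auto
      moreover have "measure \<nu> ({..c + h} \<union> {c + h<..}) = measure \<nu> {..c + h} + measure \<nu> {c + h<..}"
        "measure \<nu> ({c - h..c + h} \<union> {c + h<..}) = measure \<nu> {c - h..c + h} + measure \<nu> {c + h<..}"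
        by (rule finite_measure_Union; auto)+
      moreover have "measure \<nu> UNIV = 1" using prob_space by simp
      ultimately show ?thesis by (simp add: window_def)
    qed
    show "measure \<nu> B0 \<le> N (B \<inter> {..c}) + N (B \<inter> {c..})"
    proof -
      have "measure \<nu> B0 \<le> N B" unfolding N_def using B0 h by (intro measure_smoothed_ge) auto
      also have "\<dots> = N ((B \<inter> {..c}) \<union> (B \<inter> {c..}))" by (rule arg_cong[where f = N]) auto
      also have "\<dots> \<le> N (B \<inter> {..c}) + N (B \<inter> {c..})"
        unfolding N_def by (intro measure_Un_le) auto
      finally show ?thesis .
    qed
  qed (use s_le wpos \<kappa> prob_le_1 \<beta> leL pos bal in \<open>auto simp: N_def intro: less_imp_le order_trans simp: window_def\<close>)
  then have "\<delta> * (X + (measure \<nu> {..p + h} - N (B \<inter> {..c})) + (measure \<nu> {c - h..} - N (B \<inter> {c..}))) \<le>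
      \<delta> * (- boxcox s (measure \<nu> B0 - window h c) + window h c * (1 - boxcox s (measure \<nu> B0 / 2)))"
    using \<delta> by (rule mult_left_mono)
  with main show ?thesis by linarith
qed

section \<open>Choice of the side and removal of the smoothing\<close>

lemma reflect_atomless: "atomless_boxcox_concave_line (distr \<nu> borel uminus) s r"
proof -
  interpret R: boxcox_concave_line "distr \<nu> borel uminus" s r by (rule reflect)
  show ?thesis
  proof
    fix a :: real
    have "uminus -` {a} = {- a}" by force
    then show "measure (distr \<nu> borel uminus) {a} = 0" by (subst measure_distr) (auto simp: no_atom)
  qed
qed

text \<open>If \<open>B\<close> has the larger proportion to the right of the mode, the one-sided
  bound is applied to the reflected measure.\<close>

lemma measure_le_smoothed:
  assumes h: "0 < h" and mode: "\<And>z. window h z \<le> window h c"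
    and B: "closed B" and F: "closed F" and disj: "B \<inter> F = {}" and \<delta>: "0 \<le> \<delta>"
    and right: "\<And>x y. x \<in> B \<Longrightarrow> x \<le> y \<Longrightarrow> measure lborel (F \<inter> {x..y}) \<le> \<delta> * (y - x)"
    and left: "\<And>x y. x \<in> B \<Longrightarrow> y \<le> x \<Longrightarrow> measure lborel (F \<inter> {y..x}) \<le> \<delta> * (x - y)"
    and B0: "B0 \<in> sets borel" "\<And>w. w \<in> B0 \<Longrightarrow> {w - h..w + h} \<subseteq> B"
    and F0: "F0 \<in> sets borel" "\<And>w. w \<in> F0 \<Longrightarrow> {w - h..w + h} \<subseteq> F"
    and \<kappa>: "window h c < measure \<nu> B0"
  shows "measure \<nu> F0 \<le> \<delta> * (- boxcox s (measure \<nu> B0 - window h c)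
    + window h c * (1 - boxcox s (measure \<nu> B0 / 2)))"
proof -
  interpret N: finite_measure "smoothed h" using h by (rule finite_measure_smoothed)
  have [measurable]: "B \<in> sets borel" "F \<in> sets borel" using B F by (auto simp: borel_closed)
  let ?L = "measure (smoothed h) (B \<inter> {..c})" and ?R = "measure (smoothed h) (B \<inter> {c..})"
  have "measure \<nu> B0 \<le> measure (smoothed h) B" using B0 h by (intro measure_smoothed_ge) auto
  also have "\<dots> = measure (smoothed h) ((B \<inter> {..c}) \<union> (B \<inter> {c..}))" by (rule arg_cong[where f = "measure _"]) auto
  also have "\<dots> \<le> ?L + ?R" by (intro measure_Un_le) auto
  finally have "0 < ?L + ?R" using \<kappa> by (simp add: window_def) (meson le_less_trans measure_nonneg not_less)
  moreover have "0 \<le> ?L" "0 \<le> ?R" by auto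
  \<comment> \<open>The proportions are compared by cross-multiplication. A side that contains no
    mass of \<open>B\<close> is never chosen.\<close>
  ultimately consider "0 < ?L" "?R * measure \<nu> {..c + h} \<le> ?L * measure \<nu> {c - h..}"
    | "0 < ?R" "?L * measure \<nu> {c - h..} \<le> ?R * measure \<nu> {..c + h}"
  proof (cases "?L = 0")
    case True
    with \<open>0 < ?L + ?R\<close> show thesis by (intro that(2)) (auto simp: zero_less_measure_iff)
  next
    case False
    show thesis
    proof (cases "?R * measure \<nu> {..c + h} \<le> ?L * measure \<nu> {c - h..}")
      case True
      with False \<open>0 \<le> ?L\<close> show thesis by (intro that(1)) (auto simp: zero_less_measure_iff)
    next
      case False
      moreover have "0 \<le> ?L * measure \<nu> {c - h..}" by simp
      ultimately have "?R \<noteq> 0" by auto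
      with False \<open>0 \<le> ?R\<close> show thesis by (intro that(2)) (auto simp: zero_less_measure_iff)
    qed
  qed
  then show ?thesis
  proof cases
    case 1
    show ?thesis by (rule measure_le_one_sided[OF assms 1])
  next
    case 2
    interpret R: atomless_boxcox_concave_line "distr \<nu> borel uminus" s r by (rule reflect_atomless)
    have m: "measure (distr \<nu> borel uminus) E = measure \<nu> (uminus -` E)" if "E \<in> sets borel" for E
      using that by (subst measure_distr) auto
    have pre: "uminus -` {a..b} = {-b..-a}" "uminus -` {..b} = {-b..}" "uminus -` {a..} = {..-a}" for a b :: real
      by force+
    have win: "R.window h z = window h (- z)" for z
      by (simp add: R.window_def window_def m pre)
    have vb: "uminus -` E \<in> sets borel" if "E \<in> sets borel" for E :: "real set"
      using that measurable_sets[of uminus borel borel E] by simp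
    have sm: "measure (R.smoothed h) E = measure (smoothed h) (uminus -` E)" if [measurable]: "E \<in> sets borel" for E
    proof -
      have [measurable]: "window h \<in> borel_measurable borel" using h by (intro window_measurable) simp
      have "emeasure (R.smoothed h) E = (\<integral>\<^sup>+z. ennreal (window h (- z) / (2 * h)) * indicator (uminus -` E) (- z) \<partial>lborel)"
        by (simp add: R.emeasure_smoothed[OF h that] win indicator_def)
      also have "\<dots> = (\<integral>\<^sup>+z\<in>uminus -` E. ennreal (window h z / (2 * h)) \<partial>lborel)"
        by (intro nn_integral_lborel_uminus) measurable
      also have "\<dots> = emeasure (smoothed h) (uminus -` E)"
        using vb by (subst emeasure_smoothed[OF h]) auto
      finally show ?thesis by (simp add: measure_def)
    qed
    have cl: "closed (uminus -` E)" if "closed E" for E :: "real set"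
      using that by (intro continuous_closed_vimage) auto
    have int: "uminus -` E \<inter> {x..y} = {z. - z \<in> E \<inter> {-y..-x}}" for E :: "real set" and x y by auto
    have len: "measure lborel (uminus -` F \<inter> {x..y}) = measure lborel (F \<inter> {-y..-x})" for x y
      unfolding int by (intro measure_lborel_uminus) simp
    have dbl: "uminus -` (uminus -` E) = E" for E :: "real set" by auto
    have sub: "{w - h..w + h} \<subseteq> uminus -` E" if "{- w - h..- w + h} \<subseteq> E" for w E
    proof
      fix z assume "z \<in> {w - h..w + h}"
      then have "- z \<in> {- w - h..- w + h}" by auto
      with that show "z \<in> uminus -` E" by auto
    qed
    have BI: "uminus -` B \<inter> {..- c} = uminus -` (B \<inter> {c..})" "uminus -` B \<inter> {- c..} = uminus -` (B \<inter> {..c})"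
      by auto
    have "measure (distr \<nu> borel uminus) (uminus -` F0) \<le> \<delta> * (- boxcox s (measure (distr \<nu> borel uminus) (uminus -` B0) - R.window h (- c))
      + R.window h (- c) * (1 - boxcox s (measure (distr \<nu> borel uminus) (uminus -` B0) / 2)))"
    proof (rule R.measure_le_one_sided[where B = "uminus -` B" and F = "uminus -` F"])
      show "0 < measure (R.smoothed h) (uminus -` B \<inter> {..- c})"
        unfolding BI using 2 vb by (subst sm) (auto simp: dbl)
      show "measure (R.smoothed h) (uminus -` B \<inter> {- c..}) * measure (distr \<nu> borel uminus) {..- c + h}
        \<le> measure (R.smoothed h) (uminus -` B \<inter> {..- c}) * measure (distr \<nu> borel uminus) {- c - h..}"
        unfolding BI using 2 vb by (subst (1 2) sm) (auto simp: dbl m pre add.commute)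
      show "measure lborel (uminus -` F \<inter> {x..y}) \<le> \<delta> * (y - x)" if "x \<in> uminus -` B" "x \<le> y" for x y
        unfolding len using left[of "- x" "- y"] that by simp
      show "measure lborel (uminus -` F \<inter> {y..x}) \<le> \<delta> * (x - y)" if "x \<in> uminus -` B" "y \<le> x" for x y
        unfolding len using right[of "- x" "- y"] that by simp
      show "{w - h..w + h} \<subseteq> uminus -` B" if "w \<in> uminus -` B0" for w
        using B0(2)[of "- w"] that by (intro sub) auto
      show "{w - h..w + h} \<subseteq> uminus -` F" if "w \<in> uminus -` F0" for w
        using F0(2)[of "- w"] that by (intro sub) auto
      show "R.window h (- c) < measure (distr \<nu> borel uminus) (uminus -` B0)"
        using \<kappa> B0 vb by (simp add: win m dbl)
    qed (use h mode cl B F disj \<delta> B0 F0 vb in \<open>auto simp: win\<close>)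
    then show ?thesis using B0 F0 vb by (simp add: win m dbl)
  qed
qed

text \<open>Here \<open>h \<le> \<epsilon>\<close> is free; as it becomes small, so does the maximal
  window, and the error terms of the smoothed inequality disappear.\<close>

lemma measure_le_boxcox_atomless:
  assumes B: "closed B" and F: "closed F" and disj: "B \<inter> F = {}" and \<delta>: "0 \<le> \<delta>"
    and right: "\<And>x y. x \<in> B \<Longrightarrow> x \<le> y \<Longrightarrow> measure lborel (F \<inter> {x..y}) \<le> \<delta> * (y - x)"
    and left: "\<And>x y. x \<in> B \<Longrightarrow> y \<le> x \<Longrightarrow> measure lborel (F \<inter> {y..x}) \<le> \<delta> * (x - y)"
    and \<epsilon>: "0 < \<epsilon>"
    and B0: "B0 \<in> sets borel" "\<And>w. w \<in> B0 \<Longrightarrow> {w - \<epsilon>..w + \<epsilon>} \<subseteq> B"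
    and F0: "F0 \<in> sets borel" "\<And>w. w \<in> F0 \<Longrightarrow> {w - \<epsilon>..w + \<epsilon>} \<subseteq> F"
    and pos: "0 < measure \<nu> B0"
  shows "measure \<nu> F0 \<le> \<delta> * (- boxcox s (measure \<nu> B0))"
proof -
  let ?b = "measure \<nu> B0"
  let ?g = "\<lambda>k. \<delta> * (- boxcox s (?b - k) + k * (1 - boxcox s (?b / 2)))"
  \<comment> \<open>The factor \<open>inverse (2 + real n)\<close> is less than 1, so
    \<open>?b - k\<close> stays positive and the maximal window is smaller than
    \<open>?b\<close>.\<close>
  have "\<exists>k. 0 \<le> k \<and> k \<le> ?b * inverse (2 + real n) \<and> measure \<nu> F0 \<le> ?g k" for n
  proof -
    have e: "0 < ?b * inverse (2 + real n)" using pos by simp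
    then obtain h where h: "0 < h" "h \<le> \<epsilon>" "\<And>z. window h z \<le> ?b * inverse (2 + real n)"
      using window_uniformly_small[OF e \<epsilon>] by blast
    obtain c where c: "\<And>z. window h z \<le> window h c" using window_max[of h] h by auto
    have "inverse (2 + real n) < 1" by (simp add: field_simps)
    then have "?b * inverse (2 + real n) < ?b" using pos by simp
    with h(3)[of c] have "window h c < ?b" by linarith
    moreover have "{w - h..w + h} \<subseteq> {w - \<epsilon>..w + \<epsilon>}" for w using h by auto
    ultimately have "measure \<nu> F0 \<le> ?g (window h c)"
      using B0 F0 by (intro measure_le_smoothed[OF h(1) c B F disj \<delta> right left]) blast+
    moreover have "0 \<le> window h c" by (simp add: window_def)
    ultimately show ?thesis using h(3)[of c] by blast
  qed
  then obtain k where k: "\<And>n. 0 \<le> k n" "\<And>n. k n \<le> ?b * inverse (2 + real n)" "\<And>n. measure \<nu> F0 \<le> ?g (k n)"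
    by metis
  have "(\<lambda>n. ?b * inverse (2 + real n)) \<longlonglongrightarrow> 0" by real_asymp
  then have "k \<longlonglongrightarrow> 0"
    by (rule tendsto_sandwich[OF _ _ tendsto_const, rotated 2]) (use k in auto)
  then have "(\<lambda>n. boxcox s (?b - k n)) \<longlonglongrightarrow> boxcox s (?b - 0)"
    using pos by (intro isCont_tendsto_compose[OF isCont_boxcox] tendsto_intros) auto
  then have "(\<lambda>n. ?g (k n)) \<longlonglongrightarrow> \<delta> * (- boxcox s (?b - 0) + 0 * (1 - boxcox s (?b / 2)))"
    using \<open>k \<longlonglongrightarrow> 0\<close> by (intro tendsto_intros)
  then have "measure \<nu> F0 \<le> \<delta> * (- boxcox s (?b - 0) + 0 * (1 - boxcox s (?b / 2)))"
    by (rule LIMSEQ_le_const) (use k in auto)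
  then show ?thesis by simp
qed

end

text \<open>A Dirac measure is excluded: \<open>B0\<close> and \<open>F0\<close> both have positive
  mass, so its atom would lie in \<open>B \<inter> F\<close>.\<close>

lemma (in boxcox_concave_line) measure_le_boxcox:
  assumes B: "closed B" and F: "closed F" and disj: "B \<inter> F = {}" and \<delta>: "0 \<le> \<delta>"
    and right: "\<And>x y. x \<in> B \<Longrightarrow> x \<le> y \<Longrightarrow> measure lborel (F \<inter> {x..y}) \<le> \<delta> * (y - x)"
    and left: "\<And>x y. x \<in> B \<Longrightarrow> y \<le> x \<Longrightarrow> measure lborel (F \<inter> {y..x}) \<le> \<delta> * (x - y)"
    and \<epsilon>: "0 < \<epsilon>"
    and B0: "B0 \<in> sets borel" "\<And>w. w \<in> B0 \<Longrightarrow> {w - \<epsilon>..w + \<epsilon>} \<subseteq> B"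
    and F0: "F0 \<in> sets borel" "\<And>w. w \<in> F0 \<Longrightarrow> {w - \<epsilon>..w + \<epsilon>} \<subseteq> F"
    and pos: "0 < measure \<nu> B0" "0 < measure \<nu> F0"
  shows "measure \<nu> F0 \<le> \<delta> * (- boxcox s (measure \<nu> B0))"
proof -
  have "measure \<nu> {a} = 0" for a
  proof (rule ccontr)
    assume "measure \<nu> {a} \<noteq> 0"
    then have a: "measure \<nu> {a} = 1" by (intro atom_eq_1) (simp add: zero_less_measure_iff)
    have sub: "B0 \<subseteq> B" "F0 \<subseteq> F" using B0(2) F0(2) \<epsilon> by fastforce+
    have "a \<in> E" if "E \<in> sets borel" "0 < measure \<nu> E" for E
    proof (rule ccontr)
      assume "a \<notin> E"
      then have "measure \<nu> ({a} \<union> E) = measure \<nu> {a} + measure \<nu> E"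
        using that by (intro finite_measure_Union) auto
      with a that prob_le_1[of "{a} \<union> E"] show False by simp
    qed
    from this[OF B0(1) pos(1)] this[OF F0(1) pos(2)] sub disj show False by auto
  qed
  then interpret atomless_boxcox_concave_line \<nu> s r by unfold_locales
  show ?thesis by (rule measure_le_boxcox_atomless[OF B F disj \<delta> right left \<epsilon> B0 F0 pos(1)])
qed

section \<open>Localization to needles\<close>

lemma enn_powr_ennreal: "0 < x \<Longrightarrow> enn_powr (ennreal x) a = ennreal (x powr a)"
  by (auto simp: enn_powr_def)

text \<open>The mean in the definition of s-concavity, here \<open>R\<close>, is the
  quasi-arithmetic mean generated by \<open>boxcox s\<close>: its transform is the weighted average
  of the transforms. Since the masses are positive, all extended powers are ordinary real
  ones.\<close>

lemma s_concave_boxcox: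
  fixes \<mu> :: "(real ^ 'n) measure"
  assumes "s_concave s \<mu>" "finite_measure \<mu>" "compact A" "compact B" "C \<in> sets \<mu>"
    and pos: "0 < measure \<mu> A" "0 < measure \<mu> B" and t: "0 \<le> t" "t \<le> 1"
    and sub: "\<And>x y. x \<in> A \<Longrightarrow> y \<in> B \<Longrightarrow> (1 - t) *\<^sub>R x + t *\<^sub>R y \<in> C"
  shows "0 < measure \<mu> C"
    and "(1 - t) * boxcox s (measure \<mu> A) + t * boxcox s (measure \<mu> B) \<le> boxcox s (measure \<mu> C)"
proof -
  interpret finite_measure \<mu> by fact
  define a b where "a = measure \<mu> A" and "b = measure \<mu> B"
  have ab: "0 < a" "0 < b" using pos by (auto simp: a_def b_def)
  let ?S = "{(1 - t) *\<^sub>R x + (1 - (1 - t)) *\<^sub>R y | x y. x \<in> A \<and> y \<in> B}"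
  define R where "R = (if s = 0 then a powr (1 - t) * b powr t
    else ((1 - t) * a powr s + t * b powr s) powr (1 / s))"
  define q where "q = (1 - t) * a powr s + t * b powr s"
  have q: "0 < q"
  proof (cases "t = 0")
    case False
    then have "0 < t * b powr s" using t ab by simp
    moreover have "0 \<le> (1 - t) * a powr s" using t by simp
    ultimately show ?thesis by (simp add: q_def add_nonneg_pos)
  qed (use ab in \<open>simp add: q_def\<close>)
  have R: "0 < R" using ab q by (auto simp: R_def q_def)
  have "ennreal R \<le> emeasure \<mu> ?S"
  proof -
    have "emeasure \<mu> A * emeasure \<mu> B > 0"
      using pos by (simp add: emeasure_eq_measure flip: ennreal_mult)
    then have "(if s = 0 then enn_powr (emeasure \<mu> A) (1 - t) * enn_powr (emeasure \<mu> B) (1 - (1 - t))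
           else enn_powr (ennreal (1 - t) * enn_powr (emeasure \<mu> A) s +
                          ennreal (1 - (1 - t)) * enn_powr (emeasure \<mu> B) s) (1 / s)) \<le> emeasure \<mu> ?S"
      using assms(3,4) t by (intro assms(1)[unfolded s_concave_def, rule_format]) auto
    moreover have "(if s = 0 then enn_powr (emeasure \<mu> A) (1 - t) * enn_powr (emeasure \<mu> B) (1 - (1 - t))
           else enn_powr (ennreal (1 - t) * enn_powr (emeasure \<mu> A) s +
                          ennreal (1 - (1 - t)) * enn_powr (emeasure \<mu> B) s) (1 / s)) = ennreal R"
    proof (cases "s = 0")
      case True
      then show ?thesis
        using ab by (simp add: emeasure_eq_measure a_def [symmetric] b_def [symmetric] enn_powr_ennreal R_def ennreal_mult)
    next
      case False
      have "ennreal (1 - t) * ennreal (a powr s) + ennreal t * ennreal (b powr s) = ennreal q"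
        using t by (simp add: q_def flip: ennreal_mult ennreal_plus)
      with False show ?thesis
        using ab q by (simp add: emeasure_eq_measure a_def [symmetric] b_def [symmetric] enn_powr_ennreal R_def q_def)
    qed
    ultimately show ?thesis by simp
  qed
  also have "\<dots> \<le> emeasure \<mu> C"
    using sub assms(5) by (intro emeasure_mono) auto
  finally have RC: "R \<le> measure \<mu> C" using R by (simp add: emeasure_eq_measure)
  with R show "0 < measure \<mu> C" by simp
  have "(1 - t) * boxcox s a + t * boxcox s b = boxcox s R"
  proof (cases "s = 0")
    case True
    with ab show ?thesis by (simp add: boxcox_def R_def ln_mult)
  next
    case False
    with q have "R powr s = q" by (simp add: R_def q_def powr_powr)
    with False have "boxcox s R = (q - 1) / s" by (simp add: boxcox_def)
    moreover have "(1 - t) * boxcox s a + t * boxcox s b = (q - 1) / s"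
      using False by (simp add: boxcox_def q_def add_divide_distrib diff_divide_distrib algebra_simps)
    ultimately show ?thesis by simp
  qed
  also have "\<dots> \<le> boxcox s (measure \<mu> C)" using R RC by (subst boxcox_le_iff) auto
  finally show "(1 - t) * boxcox s (measure \<mu> A) + t * boxcox s (measure \<mu> B) \<le> boxcox s (measure \<mu> C)"
    by (simp add: a_def b_def)
qed

lemma measure_distr_uniform_measure:
  fixes \<mu> :: "'a :: euclidean_space measure"
  assumes "finite_measure \<mu>" "sets \<mu> = sets borel" "K \<in> sets borel" "0 < measure \<mu> K" "E \<in> sets borel"
  shows "measure (distr (uniform_measure \<mu> K) borel (\<lambda>x. x \<bullet> v)) E =
    measure \<mu> (K \<inter> {x. x \<bullet> v \<in> E}) / measure \<mu> K"
proof -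
  interpret finite_measure \<mu> by fact
  note [measurable_cong] = assms(2)
  have [measurable]: "(\<lambda>x. x \<bullet> v) \<in> borel_measurable \<mu>" by measurable
  have "(\<lambda>x. x \<bullet> v) -` E \<inter> space \<mu> = {x. x \<bullet> v \<in> E}"
    using sets_eq_imp_space_eq[OF assms(2)] by auto
  moreover have "(\<lambda>x. x \<bullet> v) -` E \<inter> space \<mu> \<in> sets \<mu>"
    using assms(5) by measurable
  ultimately show ?thesis
    using assms by (subst measure_distr) (auto simp: emeasure_eq_measure)
qed

text \<open>By convexity of \<open>K\<close>, a combination of two slabs of \<open>K\<close> lies in
  the slab over the combined interval. The slabs are compact, so s-concavity applies to
  them.\<close>

lemma boxcox_concave_line_projection:
  fixes \<mu> :: "(real ^ 'n) measure"
  assumes s: "s \<le> 1" "s_concave s \<mu>" and \<mu>: "finite_measure \<mu>" "sets \<mu> = sets borel"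
    and K: "compact K" "convex K" "0 < measure \<mu> K"
  obtains r where "boxcox_concave_line (distr (uniform_measure \<mu> K) borel (\<lambda>x. x \<bullet> v)) s r"
proof -
  interpret finite_measure \<mu> by fact
  note [measurable_cong] = \<mu>(2)
  let ?\<nu> = "distr (uniform_measure \<mu> K) borel (\<lambda>x. x \<bullet> v)"
  have Kb: "K \<in> sets borel" using K(1) by (simp add: borel_compact)
  note m = measure_distr_uniform_measure[OF \<mu> Kb K(3), of _ v]
  have "compact ((\<lambda>x. x \<bullet> v) ` K)" using K by (intro compact_continuous_image continuous_intros)
  then have "bounded ((\<lambda>x. x \<bullet> v) ` K)" by (rule compact_imp_bounded)
  then obtain r where r: "\<And>x. x \<in> K \<Longrightarrow> \<bar>x \<bullet> v\<bar> \<le> r"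
    by (auto simp: bounded_iff)
  interpret U: prob_space "uniform_measure \<mu> K"
    using K(3) by (intro prob_space_uniform_measure) (auto simp: emeasure_eq_measure)
  interpret R: real_distribution ?\<nu>
    by (rule U.real_distribution_distr) measurable
  have "boxcox_concave_line ?\<nu> s r"
  proof
    show "s \<le> 1" by fact
    have "K \<inter> {x. x \<bullet> v \<in> {-r..r}} = K" using r by (auto simp: abs_le_iff minus_le_iff)
    then show "measure ?\<nu> {-r..r} = 1" using K(3) by (subst m) auto
    fix a b a' b' t :: real
    assume t: "0 \<le> t" "t \<le> 1" and "0 < measure ?\<nu> {a..b}" "0 < measure ?\<nu> {a'..b'}"
    let ?A = "K \<inter> {x. x \<bullet> v \<in> {a..b}}" and ?B = "K \<inter> {x. x \<bullet> v \<in> {a'..b'}}"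
    let ?C = "K \<inter> {x. x \<bullet> v \<in> {(1 - t) * a + t * a'..(1 - t) * b + t * b'}}"
    have pos: "0 < measure \<mu> ?A" "0 < measure \<mu> ?B"
      using \<open>0 < measure ?\<nu> {a..b}\<close> \<open>0 < measure ?\<nu> {a'..b'}\<close> K(3)
      by (simp_all add: m zero_less_divide_iff)
    have cl: "closed {x. x \<bullet> v \<in> {p..q}}" for p q :: real
      by (simp, intro closed_Collect_conj closed_Collect_le continuous_intros)
    have cpt: "compact (K \<inter> {x. x \<bullet> v \<in> {p..q}})" for p q :: real
      using K(1) cl by (rule compact_Int_closed)
    have "?C \<in> sets \<mu>" using cpt \<mu>(2) by (simp add: borel_compact)
    have "(1 - t) *\<^sub>R x + t *\<^sub>R y \<in> ?C" if "x \<in> ?A" "y \<in> ?B" for x y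
      using that t K(2) by (auto simp: inner_add_left intro!: add_mono mult_left_mono convexD)
    note conc = s_concave_boxcox[OF s(2) \<mu>(1) cpt cpt \<open>?C \<in> sets \<mu>\<close> pos t this]
    let ?k = "measure \<mu> K"
    have "(1 - t) * boxcox s (x / ?k) + t * boxcox s (y / ?k) \<le> boxcox s (z / ?k)"
      if "0 < x" "0 < y" "0 < z" "(1 - t) * boxcox s x + t * boxcox s y \<le> boxcox s z" for x y z
    proof -
      have "?k powr (- s) * ((1 - t) * boxcox s x + t * boxcox s y) \<le> ?k powr (- s) * boxcox s z"
        using that by (intro mult_left_mono) auto
      then show ?thesis using that K(3) by (simp add: boxcox_divide algebra_simps)
    qed
    from this[OF pos conc]
      conc(1) K(3) show "0 < measure ?\<nu> {(1 - t) * a + t * a'..(1 - t) * b + t * b'} \<and>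
      (1 - t) * boxcox s (measure ?\<nu> {a..b}) + t * boxcox s (measure ?\<nu> {a'..b'}) \<le>
        boxcox s (measure ?\<nu> {(1 - t) * a + t * a'..(1 - t) * b + t * b'})"
      by (simp add: m)
  qed
  then show thesis by (rule that)
qed

text \<open>Such a hyperplane is an atom of the marginal in direction \<open>v\<close>, and an atom
  has full mass.\<close>

lemma s_concave_hyperplane:
  fixes \<mu> :: "(real ^ 'n) measure"
  assumes s: "s \<le> 1" "s_concave s \<mu>" and \<mu>: "finite_measure \<mu>" "sets \<mu> = sets borel"
    and K: "compact K" "convex K" "0 < measure \<mu> (K \<inter> {x. x \<bullet> v = a})"
  shows "measure \<mu> (K \<inter> {x. x \<bullet> v = a}) = measure \<mu> K"
proof -
  interpret finite_measure \<mu> by fact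
  have Kb: "K \<in> sets borel" using K(1) by (simp add: borel_compact)
  have "measure \<mu> (K \<inter> {x. x \<bullet> v = a}) \<le> measure \<mu> K"
    using Kb \<mu>(2) by (intro finite_measure_mono) auto
  with K(3) have pos: "0 < measure \<mu> K" by linarith
  obtain r where "boxcox_concave_line (distr (uniform_measure \<mu> K) borel (\<lambda>x. x \<bullet> v)) s r"
    using boxcox_concave_line_projection[OF s \<mu> K(1,2) pos] .
  then interpret boxcox_concave_line "distr (uniform_measure \<mu> K) borel (\<lambda>x. x \<bullet> v)" s r .
  have m: "measure (distr (uniform_measure \<mu> K) borel (\<lambda>x. x \<bullet> v)) {a} =
      measure \<mu> (K \<inter> {x. x \<bullet> v = a}) / measure \<mu> K"
    using measure_distr_uniform_measure[OF \<mu> Kb pos, of "{a}" v] by simp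
  show ?thesis using atom_eq_1[of a] K(3) pos unfolding m by simp
qed

section \<open>Bisection by hyperplanes\<close>

definition good_body :: "'a :: euclidean_space measure \<Rightarrow> 'a set \<Rightarrow> 'a set \<Rightarrow> real \<Rightarrow> real \<Rightarrow> 'a set \<Rightarrow> bool" where
  "good_body \<mu> B F b \<eta> K \<longleftrightarrow> compact K \<and> convex K \<and> 0 < measure \<mu> K \<and>
     b * measure \<mu> K \<le> measure \<mu> (B \<inter> K) \<and> \<eta> * measure \<mu> K \<le> measure \<mu> (F \<inter> K)"

text \<open>The indicators converge at every point off the surface \<open>g \<theta> x = 0\<close>,
  whose part in \<open>E\<close> is null; dominated convergence does the rest.\<close>

lemma continuous_measure_halfspace:
  fixes \<mu> :: "'a :: euclidean_space measure" and g :: "real \<Rightarrow> 'a \<Rightarrow> real"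
  assumes \<mu>: "finite_measure \<mu>" "sets \<mu> = sets borel" and E: "E \<in> sets borel"
    and gm: "\<And>\<theta>. g \<theta> \<in> borel_measurable borel" and gc: "\<And>x. continuous_on UNIV (\<lambda>\<theta>. g \<theta> x)"
    and null: "\<And>\<theta>. measure \<mu> (E \<inter> {x. g \<theta> x = 0}) = 0"
  shows "continuous_on UNIV (\<lambda>\<theta>. measure \<mu> (E \<inter> {x. 0 \<le> g \<theta> x}))"
proof -
  interpret finite_measure \<mu> by fact
  note [measurable_cong] = \<mu>(2) and [measurable] = E gm
  have sp: "space \<mu> = UNIV" using sets_eq_imp_space_eq[OF \<mu>(2)] by simp
  have "(\<lambda>n. measure \<mu> (E \<inter> {x. 0 \<le> g (X n) x})) \<longlonglongrightarrow> measure \<mu> (E \<inter> {x. 0 \<le> g \<theta> x})"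
    if X: "X \<longlonglongrightarrow> \<theta>" for X \<theta>
  proof -
    have eq: "measure \<mu> (E \<inter> {x. 0 \<le> g t x}) = (\<integral>x. indicat_real (E \<inter> {x. 0 \<le> g t x}) x \<partial>\<mu>)" for t
      by (simp add: sp)
    have "E \<inter> {x. g \<theta> x = 0} \<in> sets \<mu>" by measurable
    then have "E \<inter> {x. g \<theta> x = 0} \<in> null_sets \<mu>"
      using null[of \<theta>] by (simp add: null_setsI emeasure_eq_measure)
    then have "AE x in \<mu>. x \<notin> E \<inter> {x. g \<theta> x = 0}" by (rule AE_not_in)
    then have "AE x in \<mu>. (\<lambda>n. indicat_real (E \<inter> {x. 0 \<le> g (X n) x}) x) \<longlonglongrightarrow> indicat_real (E \<inter> {x. 0 \<le> g \<theta> x}) x"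
    proof eventually_elim
      case (elim x)
      show ?case
      proof (cases "x \<in> E")
        case True
        have lim: "(\<lambda>n. g (X n) x) \<longlonglongrightarrow> g \<theta> x"
          using gc[of x] X by (auto simp: continuous_on_eq_continuous_at intro: isCont_tendsto_compose)
        from True elim have "g \<theta> x < 0 \<or> 0 < g \<theta> x" by auto
        then have "\<forall>\<^sub>F n in sequentially. indicat_real (E \<inter> {x. 0 \<le> g (X n) x}) x = indicat_real (E \<inter> {x. 0 \<le> g \<theta> x}) x"
        proof
          assume "g \<theta> x < 0"
          with order_tendstoD(2)[OF lim this] show ?thesis by (auto elim!: eventually_mono simp: indicator_def)
        next
          assume "0 < g \<theta> x"
          with order_tendstoD(1)[OF lim this] show ?thesis by (auto elim!: eventually_mono simp: indicator_def)
        qed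
        then show ?thesis by (rule tendsto_eventually)
      qed simp
    qed
    then show ?thesis
      unfolding eq by (intro integral_dominated_convergence[where w = "\<lambda>_. 1"]) (auto split: split_indicator)
  qed
  then show ?thesis by (auto simp: continuous_on_sequentially o_def)
qed

text \<open>Either some hyperplane of the pencil carries mass, and then all of it, or the mass is continuous
  in \<open>\<theta>\<close> and the intermediate value theorem yields a cut that halves the excess of \<open>B\<close>; one of the
  two halves then keeps the excess of \<open>F\<close> nonnegative.\<close>

lemma good_body_bisect:
  fixes \<mu> :: "(real ^ 'n) measure"
  assumes s: "s \<le> 1" "s_concave s \<mu>" and \<mu>: "finite_measure \<mu>" "sets \<mu> = sets borel"
    and BF: "B \<in> sets borel" "F \<in> sets borel" and K: "good_body \<mu> B F b \<eta> K"
  obtains K' \<theta> where "good_body \<mu> B F b \<eta> K'" "K' \<subseteq> K"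
    "\<And>x. x \<in> K' \<Longrightarrow> 0 \<le> cos \<theta> * (x \<bullet> e1 - a1) + sin \<theta> * (x \<bullet> e2 - a2)"
proof -
  interpret finite_measure \<mu> by fact
  note [measurable_cong] = \<mu>(2) and [measurable] = BF
  define g where "g \<theta> x = cos \<theta> * (x \<bullet> e1 - a1) + sin \<theta> * (x \<bullet> e2 - a2)" for \<theta> and x :: "real ^ 'n"
  have gm [measurable]: "g \<theta> \<in> borel_measurable borel" for \<theta> unfolding g_def by measurable
  have gc: "continuous_on UNIV (\<lambda>\<theta>. g \<theta> x)" for x unfolding g_def by (intro continuous_intros)
  have gx: "continuous_on UNIV (g \<theta>)" for \<theta> unfolding g_def by (intro continuous_intros)
  have g_lin: "g \<theta> x = x \<bullet> (cos \<theta> *\<^sub>R e1 + sin \<theta> *\<^sub>R e2) - (cos \<theta> * a1 + sin \<theta> * a2)" for \<theta> x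
    by (simp add: g_def inner_add_right algebra_simps)
  have K': "compact K" "convex K" "0 < measure \<mu> K" "b * measure \<mu> K \<le> measure \<mu> (B \<inter> K)"
    "\<eta> * measure \<mu> K \<le> measure \<mu> (F \<inter> K)" using K by (auto simp: good_body_def)
  have [measurable]: "K \<in> sets borel" using K'(1) by (simp add: borel_compact)
  show thesis
  proof (cases "\<exists>\<theta>. 0 < measure \<mu> (K \<inter> {x. g \<theta> x = 0})")
    case True
    then obtain \<theta> where \<theta>: "0 < measure \<mu> (K \<inter> {x. g \<theta> x = 0})" by blast
    define K0 where "K0 = K \<inter> {x. g \<theta> x = 0}"
    have [measurable]: "K0 \<in> sets borel" unfolding K0_def by measurable
    have eq: "{x. g \<theta> x = 0} = {x. x \<bullet> (cos \<theta> *\<^sub>R e1 + sin \<theta> *\<^sub>R e2) = cos \<theta> * a1 + sin \<theta> * a2}"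
      by (simp add: g_lin)
    have full: "measure \<mu> K0 = measure \<mu> K"
      unfolding K0_def eq using \<theta> by (intro s_concave_hyperplane[OF s \<mu> K'(1,2)]) (simp add: eq)
    have same: "measure \<mu> (E \<inter> K0) = measure \<mu> (E \<inter> K)" if [measurable]: "E \<in> sets borel" for E
    proof -
      have "measure \<mu> (K - K0) = 0"
        using full by (subst finite_measure_Diff) (auto simp: K0_def)
      then have "K - K0 \<in> null_sets \<mu>" by (intro null_setsI) (auto simp: emeasure_eq_measure)
      then have "AE x in \<mu>. x \<notin> K - K0" by (rule AE_not_in)
      then have "AE x in \<mu>. x \<in> E \<inter> K0 \<longleftrightarrow> x \<in> E \<inter> K" by eventually_elim (auto simp: K0_def)
      then show ?thesis by (intro finite_measure_eq_AE) auto
    qed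
    have "closed {x. g \<theta> x = 0}" using gx[of \<theta>] by (intro closed_Collect_eq continuous_intros) auto
    then have "compact K0" unfolding K0_def using K'(1) by (intro compact_Int_closed)
    moreover have "convex K0"
      unfolding K0_def eq using K'(2) convex_hyperplane[of "cos \<theta> *\<^sub>R e1 + sin \<theta> *\<^sub>R e2"]
      by (intro convex_Int) (auto simp: inner_commute)
    ultimately have "good_body \<mu> B F b \<eta> K0"
      using K' same[of B] same[of F] full by (simp add: good_body_def)
    then show thesis
      by (rule that[of K0 \<theta>]) (auto simp: K0_def g_def)
  next
    case False
    then have null: "measure \<mu> (K \<inter> {x. g \<theta> x = 0}) = 0" for \<theta>
      by (metis measure_nonneg not_less antisym)
    have nullE: "measure \<mu> (E \<inter> K \<inter> {x. g \<theta> x = 0}) = 0" if [measurable]: "E \<in> sets borel" for E \<theta>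
    proof -
      have "measure \<mu> (E \<inter> K \<inter> {x. g \<theta> x = 0}) \<le> measure \<mu> (K \<inter> {x. g \<theta> x = 0})"
        by (intro finite_measure_mono) auto
      with null show ?thesis by (simp add: measure_le_0_iff)
    qed
    have split: "measure \<mu> (E \<inter> K) = measure \<mu> (E \<inter> K \<inter> {x. 0 \<le> g \<theta> x}) + measure \<mu> (E \<inter> K \<inter> {x. g \<theta> x \<le> 0})"
      if [measurable]: "E \<in> sets borel" for E \<theta>
    proof -
      have "E \<inter> K \<inter> {x. g \<theta> x = 0} \<in> null_sets \<mu>"
        using nullE[OF that, of \<theta>] by (intro null_setsI) (auto simp: emeasure_eq_measure)
      then have ae: "AE x in \<mu>. x \<notin> E \<inter> K \<inter> {x. g \<theta> x = 0}" by (rule AE_not_in)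
      have "measure \<mu> ((E \<inter> K \<inter> {x. 0 \<le> g \<theta> x}) \<union> (E \<inter> K \<inter> {x. g \<theta> x \<le> 0})) =
          measure \<mu> (E \<inter> K \<inter> {x. 0 \<le> g \<theta> x}) + measure \<mu> (E \<inter> K \<inter> {x. g \<theta> x \<le> 0})"
      proof (rule measure_Un_AE)
        show "AE x in \<mu>. x \<notin> E \<inter> K \<inter> {x. 0 \<le> g \<theta> x} \<or> x \<notin> E \<inter> K \<inter> {x. g \<theta> x \<le> 0}"
          using ae by eventually_elim auto
      qed (auto simp: fmeasurable_eq_sets)
      moreover have "(E \<inter> K \<inter> {x. 0 \<le> g \<theta> x}) \<union> (E \<inter> K \<inter> {x. g \<theta> x \<le> 0}) = E \<inter> K" by auto
      ultimately show ?thesis by simp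
    qed
    define P where "P \<theta> = K \<inter> {x. 0 \<le> g \<theta> x}" for \<theta>
    define h where "h \<theta> = measure \<mu> (B \<inter> K \<inter> {x. 0 \<le> g \<theta> x}) - b * measure \<mu> (UNIV \<inter> K \<inter> {x. 0 \<le> g \<theta> x})" for \<theta>
    have hcont: "continuous_on {0..pi} h"
    proof -
      have "continuous_on UNIV h"
        unfolding h_def using nullE null by (intro continuous_intros continuous_measure_halfspace[OF \<mu>] gm gc) auto
      then show ?thesis by (rule continuous_on_subset) auto
    qed
    \<comment> \<open>Turning by \<open>pi\<close> exchanges the two halves, so
      \<open>h \<theta> + h (\<theta> + pi)\<close> is the constant \<open>\<sigma>\<close>, and
      \<open>h\<close> takes the value \<open>\<sigma> / 2\<close> between 0 and
      \<open>pi\<close>.\<close>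
    have opp: "{x. g (\<theta> + pi) x \<le> 0} = {x. 0 \<le> g \<theta> x}" "{x. 0 \<le> g (\<theta> + pi) x} = {x. g \<theta> x \<le> 0}" for \<theta>
      by (auto simp: g_def)
    define \<sigma> where "\<sigma> = measure \<mu> (B \<inter> K) - b * measure \<mu> K"
    have hsum: "h \<theta> + h (\<theta> + pi) = \<sigma>" for \<theta>
      unfolding h_def opp \<sigma>_def using split[of B \<theta>] split[of UNIV \<theta>] by (simp add: algebra_simps)
    have "\<exists>\<theta>. h \<theta> = \<sigma> / 2"
    proof (cases "h 0 \<le> \<sigma> / 2")
      case True
      with hsum[of 0] have "\<sigma> / 2 \<le> h pi" by simp
      with True show ?thesis using IVT'[of h 0 "\<sigma> / 2" pi] hcont by auto
    next
      case False
      with hsum[of 0] have "h pi \<le> \<sigma> / 2" by simp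
      with False show ?thesis using IVT2'[of h pi "\<sigma> / 2" 0] hcont by auto
    qed
    then obtain \<theta> where \<theta>: "h \<theta> = \<sigma> / 2" by blast
    have "0 \<le> \<sigma>" using K' by (simp add: \<sigma>_def)
    have B1: "b * measure \<mu> (P \<theta>) \<le> measure \<mu> (B \<inter> P \<theta>)" "b * measure \<mu> (P (\<theta> + pi)) \<le> measure \<mu> (B \<inter> P (\<theta> + pi))"
      using \<theta> hsum[of \<theta>] \<open>0 \<le> \<sigma>\<close> by (simp_all add: h_def P_def Int_assoc)
    have tot: "measure \<mu> K = measure \<mu> (P \<theta>) + measure \<mu> (P (\<theta> + pi))"
      "measure \<mu> (F \<inter> K) = measure \<mu> (F \<inter> P \<theta>) + measure \<mu> (F \<inter> P (\<theta> + pi))"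
      using split[of UNIV \<theta>] split[of F \<theta>] by (simp_all add: P_def opp Int_assoc)
    have "\<exists>\<theta>'. 0 < measure \<mu> (P \<theta>') \<and> b * measure \<mu> (P \<theta>') \<le> measure \<mu> (B \<inter> P \<theta>') \<and> \<eta> * measure \<mu> (P \<theta>') \<le> measure \<mu> (F \<inter> P \<theta>')"
    proof -
      have "\<eta> * measure \<mu> (P \<theta>) + \<eta> * measure \<mu> (P (\<theta> + pi)) \<le> measure \<mu> (F \<inter> P \<theta>) + measure \<mu> (F \<inter> P (\<theta> + pi))"
        using K'(5) unfolding tot by (simp add: distrib_left)
      moreover have zero: "measure \<mu> (F \<inter> P t) = 0" if "measure \<mu> (P t) = 0" for t
      proof -
        have "measure \<mu> (F \<inter> P t) \<le> measure \<mu> (P t)" by (intro finite_measure_mono) (auto simp: P_def)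
        with that show ?thesis by (simp add: measure_le_0_iff)
      qed
      \<comment> \<open>The excesses of \<open>F\<close> in the two halves have a nonnegative sum,
        so one of them is nonnegative. If a half is null, the other one carries all of
        \<open>K\<close>; this secures positive mass.\<close>
      ultimately consider
          "measure \<mu> (P \<theta>) = 0" "\<eta> * measure \<mu> (P (\<theta> + pi)) \<le> measure \<mu> (F \<inter> P (\<theta> + pi))"
        | "measure \<mu> (P (\<theta> + pi)) = 0" "\<eta> * measure \<mu> (P \<theta>) \<le> measure \<mu> (F \<inter> P \<theta>)"
        | "measure \<mu> (P \<theta>) \<noteq> 0" "\<eta> * measure \<mu> (P \<theta>) \<le> measure \<mu> (F \<inter> P \<theta>)"
        | "measure \<mu> (P (\<theta> + pi)) \<noteq> 0" "\<eta> * measure \<mu> (P (\<theta> + pi)) \<le> measure \<mu> (F \<inter> P (\<theta> + pi))"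
        by (cases "measure \<mu> (P \<theta>) = 0"; cases "measure \<mu> (P (\<theta> + pi)) = 0") force+
      then show ?thesis
      proof cases
        case 1
        with B1 tot(1) K'(3) show ?thesis by (intro exI[of _ "\<theta> + pi"]) auto
      next
        case 2
        with B1 tot(1) K'(3) show ?thesis by (intro exI[of _ \<theta>]) auto
      next
        case 3
        with B1 show ?thesis by (intro exI[of _ \<theta>]) (auto simp: zero_less_measure_iff)
      next
        case 4
        with B1 show ?thesis by (intro exI[of _ "\<theta> + pi"]) (auto simp: zero_less_measure_iff)
      qed
    qed
    then obtain t where t: "0 < measure \<mu> (P t)" "b * measure \<mu> (P t) \<le> measure \<mu> (B \<inter> P t)"
      "\<eta> * measure \<mu> (P t) \<le> measure \<mu> (F \<inter> P t)" by blast
    have "closed {x. 0 \<le> g t x}" using gx[of t] by (intro closed_Collect_le continuous_intros) auto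
    then have "compact (P t)" unfolding P_def using K'(1) by (intro compact_Int_closed)
    moreover have "{x. 0 \<le> g t x} = {x. (cos t *\<^sub>R e1 + sin t *\<^sub>R e2) \<bullet> x \<ge> cos t * a1 + sin t * a2}"
      by (auto simp: g_lin inner_commute)
    then have "convex (P t)" unfolding P_def using K'(2) by (simp add: convex_Int convex_halfspace_ge)
    ultimately have "good_body \<mu> B F b \<eta> (P t)" using t by (simp add: good_body_def)
    then show thesis by (rule that[of "P t" t]) (auto simp: P_def g_def)
  qed
qed

section \<open>Shape of the limit set\<close>

lemma rational_in_open:
  fixes U :: "(real \<times> real) set"
  assumes "open U" "p \<in> U"
  obtains a b where "a \<in> \<rat>" "b \<in> \<rat>" "(a, b) \<in> U"
proof -
  obtain A B where AB: "open A" "open B" "fst p \<in> A" "snd p \<in> B" "A \<times> B \<subseteq> U"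
    using open_prod_elim[OF assms] by (metis mem_Times_iff)
  have "\<exists>q\<in>\<rat>. q \<in> A" if A: "open A" "x \<in> A" for A and x :: real
  proof -
    obtain e where e: "0 < e" "ball x e \<subseteq> A" using openE[OF A] .
    obtain q where "q \<in> \<rat>" "\<bar>q - x\<bar> < e" using rational_approximation[OF e(1)] .
    with e show ?thesis by (intro bexI[of _ q]) (auto simp: dist_real_def abs_minus_commute)
  qed
  from this[OF AB(1,3)] this[OF AB(2,4)] AB(5) show thesis by (auto intro: that)
qed

text \<open>A nondegenerate triangle in \<open>S\<close> projects to a nondegenerate triangle in some coordinate plane;
  no line through a rational point in the interior of the latter supports it.\<close>

lemma supported_in_line:
  fixes S :: "'a :: euclidean_space set"
  assumes cut: "\<And>e1 e2 a1 a2. e1 \<in> Basis \<Longrightarrow> e2 \<in> Basis \<Longrightarrow> a1 \<in> \<rat> \<Longrightarrow> a2 \<in> \<rat> \<Longrightarrow>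
      \<exists>\<theta>. \<forall>x\<in>S. 0 \<le> cos \<theta> * (x \<bullet> e1 - a1) + sin \<theta> * (x \<bullet> e2 - a2)"
    and S: "x \<in> S" "y \<in> S" "z \<in> S" and "x \<noteq> y"
  obtains c where "z - x = c *\<^sub>R (y - x)"
proof -
  define v w where "v = y - x" and "w = z - x"
  have "v \<noteq> 0" using assms by (simp add: v_def)
  have par: "v \<bullet> e1 * (w \<bullet> e2) = v \<bullet> e2 * (w \<bullet> e1)" if e: "e1 \<in> Basis" "e2 \<in> Basis" for e1 e2
  proof (rule ccontr)
    define D where "D = v \<bullet> e1 * (w \<bullet> e2) - v \<bullet> e2 * (w \<bullet> e1)"
    assume "v \<bullet> e1 * (w \<bullet> e2) \<noteq> v \<bullet> e2 * (w \<bullet> e1)"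
    then have D: "D \<noteq> 0" by (simp add: D_def)
    \<comment> \<open>By Cramer's rule, \<open>\<beta> p\<close> and \<open>\<gamma> p\<close> are
      the coordinates of \<open>p\<close> with respect to the projected edges at the vertex
      \<open>x\<close>. Thus \<open>U\<close> is the interior of the projected triangle, and
      \<open>p0\<close> below is its centroid.\<close>
    define \<beta> where "\<beta> p = ((fst p - x \<bullet> e1) * (w \<bullet> e2) - (snd p - x \<bullet> e2) * (w \<bullet> e1)) / D" for p :: "real \<times> real"
    define \<gamma> where "\<gamma> p = ((snd p - x \<bullet> e2) * (v \<bullet> e1) - (fst p - x \<bullet> e1) * (v \<bullet> e2)) / D" for p :: "real \<times> real"
    define U where "U = {p. 0 < \<beta> p} \<inter> {p. 0 < \<gamma> p} \<inter> {p. \<beta> p + \<gamma> p < 1}"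
    have "open U"
      unfolding U_def \<beta>_def \<gamma>_def
      by (intro open_Int open_Collect_less continuous_intros) (use D in auto)
    moreover define p0 where "p0 = (x \<bullet> e1 + (v \<bullet> e1 + w \<bullet> e1) / 3, x \<bullet> e2 + (v \<bullet> e2 + w \<bullet> e2) / 3)"
    have "(fst p0 - x \<bullet> e1) * (w \<bullet> e2) - (snd p0 - x \<bullet> e2) * (w \<bullet> e1) = D / 3"
      "(snd p0 - x \<bullet> e2) * (v \<bullet> e1) - (fst p0 - x \<bullet> e1) * (v \<bullet> e2) = D / 3"
      by (simp_all add: p0_def D_def field_simps)
    then have "\<beta> p0 = 1 / 3" "\<gamma> p0 = 1 / 3"
      unfolding \<beta>_def \<gamma>_def using D by simp_all
    then have "p0 \<in> U" by (simp add: U_def)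
    ultimately obtain a1 a2 where a: "a1 \<in> \<rat>" "a2 \<in> \<rat>" "(a1, a2) \<in> U" by (rule rational_in_open)
    define b c where "b = \<beta> (a1, a2)" and "c = \<gamma> (a1, a2)"
    have bc: "0 < b" "0 < c" "b + c < 1" using a by (auto simp: U_def b_def c_def)
    have "b * D = (a1 - x \<bullet> e1) * (w \<bullet> e2) - (a2 - x \<bullet> e2) * (w \<bullet> e1)"
      "c * D = (a2 - x \<bullet> e2) * (v \<bullet> e1) - (a1 - x \<bullet> e1) * (v \<bullet> e2)"
      using D by (simp_all add: b_def c_def \<beta>_def \<gamma>_def)
    then have "(b * (v \<bullet> e1) + c * (w \<bullet> e1)) * D = (a1 - x \<bullet> e1) * D"
      "(b * (v \<bullet> e2) + c * (w \<bullet> e2)) * D = (a2 - x \<bullet> e2) * D"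
      unfolding D_def by algebra+
    then have sol: "b * (v \<bullet> e1) + c * (w \<bullet> e1) = a1 - x \<bullet> e1" "b * (v \<bullet> e2) + c * (w \<bullet> e2) = a2 - x \<bullet> e2"
      using D by auto
    obtain \<theta> where \<theta>: "\<And>x. x \<in> S \<Longrightarrow> 0 \<le> cos \<theta> * (x \<bullet> e1 - a1) + sin \<theta> * (x \<bullet> e2 - a2)"
      using cut[OF e a(1,2)] by blast
    \<comment> \<open>As an affine function on the coordinate plane, \<open>l\<close> is nonnegative
      at the three vertices and vanishes at their strict convex combination \<open>(a1, a2)\<close>,
      so it vanishes at all of them. Then \<open>(cos \<theta>, sin \<theta>)\<close> is orthogonal
      to two independent edges, hence zero.\<close>
    define l where "l x = cos \<theta> * (x \<bullet> e1 - a1) + sin \<theta> * (x \<bullet> e2 - a2)" for x :: 'a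
    have l: "0 \<le> l x" "0 \<le> l y" "0 \<le> l z" using \<theta> S by (auto simp: l_def)
    have dl: "l y = l x + (cos \<theta> * (v \<bullet> e1) + sin \<theta> * (v \<bullet> e2))" "l z = l x + (cos \<theta> * (w \<bullet> e1) + sin \<theta> * (w \<bullet> e2))"
      by (simp_all add: l_def v_def w_def inner_diff_left algebra_simps)
    have "(1 - b - c) * l x + b * l y + c * l z =
        cos \<theta> * (b * (v \<bullet> e1) + c * (w \<bullet> e1)) + sin \<theta> * (b * (v \<bullet> e2) + c * (w \<bullet> e2)) + l x"
      unfolding dl by (simp add: algebra_simps)
    also have "\<dots> = 0" unfolding sol l_def by (simp add: algebra_simps)
    finally have sum0: "(1 - b - c) * l x + b * l y + c * l z = 0" .
    have "0 \<le> (1 - b - c) * l x" "0 \<le> b * l y" "0 \<le> c * l z" using l bc by auto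
    with sum0 have "(1 - b - c) * l x = 0" "b * l y = 0" "c * l z = 0" by linarith+
    with bc have "l x = 0" "l y = 0" "l z = 0" by auto
    with dl have 0: "cos \<theta> * (v \<bullet> e1) + sin \<theta> * (v \<bullet> e2) = 0" "cos \<theta> * (w \<bullet> e1) + sin \<theta> * (w \<bullet> e2) = 0" by auto
    have "cos \<theta> * D = 0" "sin \<theta> * D = 0" using 0 unfolding D_def by algebra+
    with D have "cos \<theta> = 0" "sin \<theta> = 0" by auto
    with sin_cos_squared_add[of \<theta>] show False by simp
  qed
  obtain e where e: "e \<in> Basis" "v \<bullet> e \<noteq> 0" using \<open>v \<noteq> 0\<close> euclidean_all_zero_iff by blast
  have "w = (w \<bullet> e / (v \<bullet> e)) *\<^sub>R v"
  proof (rule euclidean_eqI)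
    fix i :: 'a assume "i \<in> Basis"
    from par[OF e(1) this] e(2) show "w \<bullet> i = ((w \<bullet> e / (v \<bullet> e)) *\<^sub>R v) \<bullet> i"
      by (simp add: field_simps)
  qed
  then show thesis by (intro that) (simp add: v_def w_def)
qed

text \<open>Fattening changes the lengths by an additive error only. Let \<open>d\<close> separate
  \<open>B\<close> from \<open>F\<close>. On segments of length at least \<open>d / 2\<close> the
  gain \<open>(\<delta>' - \<delta>) * \<bar>y - x\<bar>\<close> absorbs the error; shorter segments
  starting near \<open>B\<close> do not reach the neighbourhood of \<open>F\<close>.\<close>

lemma fatten_proportion:
  fixes B F :: "real set"
  assumes B: "compact B" "B \<noteq> {}" and F: "compact F" "F \<noteq> {}" and disj: "B \<inter> F = {}"
    and \<delta>: "0 \<le> \<delta>" "\<delta> < \<delta>'"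
    and dens: "\<And>x y. x \<in> B \<Longrightarrow> measure lborel (F \<inter> closed_segment x y) \<le> \<delta> * \<bar>y - x\<bar>"
  obtains e where "0 < e" "{t. infdist t B \<le> e} \<inter> {t. infdist t F \<le> e} = {}"
    "\<And>x y. infdist x B \<le> e \<Longrightarrow> measure lborel ({t. infdist t F \<le> e} \<inter> closed_segment x y) \<le> \<delta>' * \<bar>y - x\<bar>"
proof -
  define G where "G e = {t. infdist t F \<le> e}" for e
  have clG: "closed (G e)" for e
    unfolding G_def by (intro closed_Collect_le continuous_intros)
  then have [measurable]: "G e \<in> sets borel" for e by (simp add: borel_closed)
  have [measurable]: "F \<in> sets borel" using F by (simp add: borel_compact)
  have near: "\<exists>z\<in>E. \<bar>t - z\<bar> \<le> e" if *: "infdist t E \<le> e" "compact E" "E \<noteq> {}" for t e and E :: "real set"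
  proof -
    obtain z where "z \<in> E" "infdist t E = dist t z"
      using infdist_attains_inf[OF compact_imp_closed[OF *(2)] *(3)] .
    with *(1) show ?thesis by (intro bexI[of _ z]) (auto simp: dist_real_def)
  qed
  obtain d where d: "0 < d" "\<And>x y. x \<in> B \<Longrightarrow> y \<in> F \<Longrightarrow> d \<le> dist x y"
    using separate_compact_closed[OF B(1) compact_imp_closed[OF F(1)] disj] by blast
  obtain R where R: "\<And>x. x \<in> F \<Longrightarrow> \<bar>x\<bar> \<le> R"
    using compact_imp_bounded[OF F(1)] by (auto simp: bounded_iff)
  have GR: "G e \<subseteq> {-R - 1..R + 1}" if "e \<le> 1" for e
  proof
    fix t assume "t \<in> G e"
    then obtain z where "z \<in> F" "\<bar>t - z\<bar> \<le> e" using near[OF _ F, of t e] by (auto simp: G_def)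
    with R[of z] that show "t \<in> {-R - 1..R + 1}" by auto
  qed
  have fin: "G e \<in> fmeasurable lborel" if "e \<le> 1" for e
  proof (rule fmeasurableI2)
    show "{-R - 1..R + 1} \<in> fmeasurable lborel" by (auto simp: fmeasurable_def emeasure_lborel_Icc_eq)
  qed (use GR[OF that] in auto)
  have FG: "F \<subseteq> G e" if "0 \<le> e" for e using that by (auto simp: G_def)
  \<comment> \<open>Two errors of size \<open>\<tau>\<close> are to come, one from thickening
    \<open>F\<close> and one from moving the starting point into \<open>B\<close>; together they use
    up \<open>(\<delta>' - \<delta>) * (d / 2)\<close>.\<close>
  define \<tau> where "\<tau> = (\<delta>' - \<delta>) * d / 4"
  have \<tau>: "0 < \<tau>" using d \<delta> by (simp add: \<tau>_def)
  have "(\<lambda>n. measure lborel (G (inverse (Suc n)))) \<longlonglongrightarrow> measure lborel (\<Inter>n. G (inverse (Suc n)))"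
  proof (rule Lim_measure_decseq)
    show "decseq (\<lambda>n. G (inverse (Suc n)))"
      unfolding decseq_def G_def by (auto intro: order_trans le_imp_inverse_le)
    show "emeasure lborel (G (inverse (Suc n))) \<noteq> \<infinity>" for n
      using fmeasurableD2[OF fin[of "inverse (Suc n)"]] by (simp add: inverse_le_1_iff)
  qed auto
  moreover have "(\<Inter>n. G (inverse (Suc n))) = F"
  proof
    show "(\<Inter>n. G (inverse (Suc n))) \<subseteq> F"
    proof
      fix t assume t: "t \<in> (\<Inter>n. G (inverse (Suc n)))"
      have "infdist t F \<le> 0"
      proof (rule LIMSEQ_le_const[OF LIMSEQ_inverse_real_of_nat])
        show "\<exists>N. \<forall>n\<ge>N. infdist t F \<le> inverse (real (Suc n))" using t by (auto simp: G_def)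
      qed
      then have "infdist t F = 0" using infdist_nonneg[of t F] by linarith
      then show "t \<in> F" using in_closed_iff_infdist_zero[OF compact_imp_closed[OF F(1)] F(2)] by blast
    qed
    show "F \<subseteq> (\<Inter>n. G (inverse (Suc n)))"
      by (intro INT_greatest FG) simp
  qed
  ultimately have "(\<lambda>n. measure lborel (G (inverse (Suc n)))) \<longlonglongrightarrow> measure lborel F" by simp
  then have "\<forall>\<^sub>F n in sequentially. measure lborel (G (inverse (Suc n))) < measure lborel F + \<tau>"
    by (rule order_tendstoD) (use \<tau> in simp)
  then obtain n where n: "measure lborel (G (inverse (Suc n))) < measure lborel F + \<tau>"
    by (auto simp: eventually_sequentially)
  \<comment> \<open>The three bounds serve, in turn, the length of the thickened \<open>F\<close>,
    the separation of the neighbourhoods, and the error \<open>(1 + \<delta>) * e\<close> made when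
    \<open>x\<close> is replaced by \<open>x0 \<in> B\<close>.\<close>
  define e where "e = min (inverse (Suc n)) (min (d / 8) (\<tau> / (1 + \<delta>)))"
  have e: "0 < e" "e \<le> inverse (Suc n)" "e \<le> d / 8" "(1 + \<delta>) * e \<le> \<tau>"
  proof -
    show "0 < e" using d \<tau> \<delta> by (simp add: e_def)
    have "e \<le> \<tau> / (1 + \<delta>)" by (simp add: e_def)
    then show "(1 + \<delta>) * e \<le> \<tau>" using \<delta> by (simp add: pos_le_divide_eq mult.commute)
    show "e \<le> d / 8" unfolding e_def by linarith
  qed (simp add: e_def)
  have "inverse (real (Suc n)) \<le> 1" by (simp add: inverse_le_1_iff)
  with e have "e \<le> 1" by linarith
  have "G e \<subseteq> G (inverse (Suc n))" using e by (auto simp: G_def)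
  then have "measure lborel (G e) \<le> measure lborel (G (inverse (Suc n)))"
    using fin \<open>inverse (real (Suc n)) \<le> 1\<close> by (intro measure_mono_fmeasurable) auto
  then have Ge: "measure lborel (G e) - measure lborel F < \<tau>" using n by simp
  have GF: "measure lborel (G e - F) < \<tau>"
  proof -
    have "measure lborel (G e - F) = measure lborel (G e) - measure lborel F"
      using e FG[of e] fin[OF \<open>e \<le> 1\<close>] by (intro measure_Diff) (auto simp: fmeasurableD2)
    with Ge show ?thesis by simp
  qed
  show thesis
  proof (rule that[OF e(1)])
    show "{t. infdist t B \<le> e} \<inter> {t. infdist t F \<le> e} = {}"
    proof (intro equals0I)
      fix t assume "t \<in> {t. infdist t B \<le> e} \<inter> {t. infdist t F \<le> e}"
      then obtain x y where "x \<in> B" "\<bar>t - x\<bar> \<le> e" "y \<in> F" "\<bar>t - y\<bar> \<le> e"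
        using near[OF _ B, of t e] near[OF _ F, of t e] by blast
      with d(2)[of x y] e d(1) show False by (auto simp: dist_real_def)
    qed
    fix x y assume "infdist x B \<le> e"
    then obtain x0 where x0: "x0 \<in> B" "\<bar>x - x0\<bar> \<le> e" using near[OF _ B] by blast
    have "measure lborel (G e \<inter> closed_segment x y) \<le> \<delta>' * \<bar>y - x\<bar>"
    proof (cases "\<bar>y - x\<bar> < d / 2")
      case True
      have "G e \<inter> closed_segment x y = {}"
      proof (intro equals0I)
        fix z assume z: "z \<in> G e \<inter> closed_segment x y"
        then obtain z0 where "z0 \<in> F" and "\<bar>z - z0\<bar> \<le> e" using near[OF _ F, of z e] by (auto simp: G_def)
        moreover have "\<bar>z - x\<bar> \<le> \<bar>y - x\<bar>" using z by (auto simp: closed_segment_eq_real_ivl split: if_splits)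
        moreover have "d \<le> \<bar>x0 - z0\<bar>"
          using d(2)[OF x0(1) \<open>z0 \<in> F\<close>] by (simp add: dist_real_def)
        ultimately show False using True x0(2) d(1) e(3) by linarith
      qed
      then show ?thesis using \<delta> by simp
    next
      case False
      have seg: "measure lborel (closed_segment a b) = \<bar>b - a\<bar>" for a b :: real
        by (simp add: closed_segment_eq_real_ivl)
      have sb: "closed_segment a b \<in> sets borel" "closed_segment a b \<in> fmeasurable lborel" for a b :: real
        by (auto simp: closed_segment_eq_real_ivl fmeasurable_def emeasure_lborel_Icc_eq)
      note [measurable] = sb(1)
      have fs: "E \<inter> closed_segment a b \<in> fmeasurable lborel" if "E \<in> sets borel" for E and a b :: real
        using that sb by (intro fmeasurableI2[OF sb(2)]) auto
      have "measure lborel (F \<inter> closed_segment x y) \<le>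
          measure lborel (closed_segment x x0 \<union> (F \<inter> closed_segment x0 y))"
      proof (intro measure_mono_fmeasurable)
        show "closed_segment x x0 \<union> (F \<inter> closed_segment x0 y) \<in> fmeasurable lborel"
          by (intro fmeasurable.Un sb fs) auto
      qed (auto simp: closed_segment_eq_real_ivl split: if_splits)
      also have "\<dots> \<le> measure lborel (closed_segment x x0) + measure lborel (F \<inter> closed_segment x0 y)"
        by (intro measure_Un_le) auto
      also have "\<dots> \<le> e + \<delta> * \<bar>y - x0\<bar>"
        using dens[OF x0(1), of y] x0(2) by (simp add: seg abs_minus_commute)
      also have "\<delta> * \<bar>y - x0\<bar> \<le> \<delta> * (\<bar>y - x\<bar> + e)"
        using x0 \<delta> by (intro mult_left_mono) auto
      finally have 1: "measure lborel (F \<inter> closed_segment x y) \<le> (1 + \<delta>) * e + \<delta> * \<bar>y - x\<bar>"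
        by (simp add: algebra_simps)
      have "measure lborel (G e \<inter> closed_segment x y) \<le>
          measure lborel ((F \<inter> closed_segment x y) \<union> (G e - F))"
      proof (intro measure_mono_fmeasurable)
        show "(F \<inter> closed_segment x y) \<union> (G e - F) \<in> fmeasurable lborel"
          by (intro fmeasurable.Un fs fmeasurableI2[OF fin[OF \<open>e \<le> 1\<close>], of "G e - F"]) auto
      qed auto
      also have "\<dots> \<le> measure lborel (F \<inter> closed_segment x y) + measure lborel (G e - F)"
        by (intro measure_Un_le) auto
      also have "\<dots> \<le> \<delta> * \<bar>y - x\<bar> + 2 * \<tau>" using 1 GF e by linarith
      also have "2 * \<tau> = (\<delta>' - \<delta>) * (d / 2)" by (simp add: \<tau>_def)
      also have "\<delta> * \<bar>y - x\<bar> + (\<delta>' - \<delta>) * (d / 2) \<le> \<delta> * \<bar>y - x\<bar> + (\<delta>' - \<delta>) * \<bar>y - x\<bar>"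
        using False \<delta> by (intro add_left_mono mult_left_mono) auto
      finally show ?thesis by (simp add: algebra_simps)
    qed
    then show "measure lborel ({t. infdist t F \<le> e} \<inter> closed_segment x y) \<le> \<delta>' * \<bar>y - x\<bar>"
      by (simp add: G_def)
  qed
qed

section \<open>The needle and the dilation inequality\<close>

lemma measure_lborel_translate:
  fixes E :: "real set"
  assumes "E \<in> sets borel"
  shows "measure lborel {t. c + t \<in> E} = measure lborel E"
proof -
  have "measure (distr lborel borel ((+) c)) E = measure lborel ((+) c -` E \<inter> space lborel)"
    using assms by (intro measure_distr) auto
  then show ?thesis by (simp add: lborel_distr_plus vimage_def)
qed

lemma compact_nest_subset:
  fixes C :: "nat \<Rightarrow> 'a :: heine_borel set"
  assumes "\<And>n. compact (C n)" "\<And>m n. m \<le> n \<Longrightarrow> C n \<subseteq> C m" "open U" "(\<Inter>n. C n) \<subseteq> U"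
  obtains N where "C N \<subseteq> U"
proof (rule ccontr)
  assume "\<not> thesis"
  then have "\<And>n. \<not> C n \<subseteq> U" using that by blast
  then have ne: "C n - U \<noteq> {}" for n by blast
  have "\<Inter>(range (\<lambda>n. C n - U)) \<noteq> {}"
  proof (rule compact_nest)
    show "compact (C n - U)" for n using assms(1,3) by (rule compact_diff)
    show "C n - U \<subseteq> C m - U" if "m \<le> n" for m n using assms(2)[OF that] by blast
  qed (rule ne)
  with assms(4) show False by auto
qed

text \<open>\<open>supported_in_line\<close> asks for one cut for each pair of basis vectors and
  each pair of rationals. These are countably many, so they can be made one after another, and the
  intersection inherits every cut.\<close>

lemma needle_sequence:
  fixes \<mu> :: "(real ^ 'n) measure"
  assumes s: "s \<le> 1" "s_concave s \<mu>" and \<mu>: "finite_measure \<mu>" "sets \<mu> = sets borel"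
    and BF: "B \<in> sets borel" "F \<in> sets borel" and K: "good_body \<mu> B F b \<eta> K"
  obtains C :: "nat \<Rightarrow> (real ^ 'n) set" where "\<And>n. good_body \<mu> B F b \<eta> (C n)" "\<And>m n. m \<le> n \<Longrightarrow> C n \<subseteq> C m"
    "\<And>x y z. x \<in> (\<Inter>n. C n) \<Longrightarrow> y \<in> (\<Inter>n. C n) \<Longrightarrow> z \<in> (\<Inter>n. C n) \<Longrightarrow> x \<noteq> y \<Longrightarrow> \<exists>c. z - x = c *\<^sub>R (y - x)"
proof -
  define I :: "((real ^ 'n) \<times> (real ^ 'n) \<times> real \<times> real) set" where "I = Basis \<times> Basis \<times> \<rat> \<times> \<rat>"
  have "countable I" unfolding I_def by (intro countable_SIGMA countable_finite finite_Basis countable_rat)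
  define cut where "cut p C \<longleftrightarrow> (\<exists>\<theta>. \<forall>x\<in>C. 0 \<le> cos \<theta> * (x \<bullet> fst p - fst (snd (snd p)))
      + sin \<theta> * (x \<bullet> fst (snd p) - snd (snd (snd p))))"
    for p :: "(real ^ 'n) \<times> (real ^ 'n) \<times> real \<times> real" and C :: "(real ^ 'n) set"
  have "\<exists>C'. good_body \<mu> B F b \<eta> C' \<and> C' \<subseteq> C \<and> cut p C'" if "good_body \<mu> B F b \<eta> C" for C p
    using good_body_bisect[OF s \<mu> BF that, of "fst p" "fst (snd (snd p))" "fst (snd p)" "snd (snd (snd p))"]
    unfolding cut_def by metis
  then obtain C where C: "\<And>n. good_body \<mu> B F b \<eta> (C n)" "\<And>n. C (Suc n) \<subseteq> C n \<and> cut (from_nat_into I n) (C (Suc n))"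
    using dependent_nat_choice[of "\<lambda>_. good_body \<mu> B F b \<eta>" "\<lambda>n C C'. C' \<subseteq> C \<and> cut (from_nat_into I n) C'"] K
    by blast
  have mono: "C n \<subseteq> C m" if "m \<le> n" for m n
    by (rule lift_Suc_antimono_le[OF _ that]) (use C(2) in auto)
  have cut: "\<exists>\<theta>. \<forall>x\<in>(\<Inter>n. C n). 0 \<le> cos \<theta> * (x \<bullet> e1 - a1) + sin \<theta> * (x \<bullet> e2 - a2)"
    if "e1 \<in> Basis" "e2 \<in> Basis" "a1 \<in> \<rat>" "a2 \<in> \<rat>" for e1 e2 a1 a2
  proof -
    have "(e1, e2, a1, a2) \<in> I" using that by (auto simp: I_def)
    then obtain n where "from_nat_into I n = (e1, e2, a1, a2)"
      using from_nat_into_surj[OF \<open>countable I\<close>] by blast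
    with C(2)[of n] have "cut (e1, e2, a1, a2) (C (Suc n))" by auto
    then show ?thesis unfolding cut_def by auto
  qed
  show thesis
  proof (rule that[of C])
    show "good_body \<mu> B F b \<eta> (C n)" for n by (rule C(1))
    show "C n \<subseteq> C m" if "m \<le> n" for m n using that by (rule mono)
    fix x y z assume xyz: "x \<in> (\<Inter>n. C n)" "y \<in> (\<Inter>n. C n)" "z \<in> (\<Inter>n. C n)" "x \<noteq> y"
    obtain c where "z - x = c *\<^sub>R (y - x)" by (rule supported_in_line[OF cut xyz])
    then show "\<exists>c. z - x = c *\<^sub>R (y - x)" by blast
  qed
qed

theorem s_concave_dilation:
  fixes \<mu> :: "(real ^ 'n) measure"
  assumes s: "s \<le> 1" "s_concave s \<mu>" and prob: "prob_space \<mu>" and sets: "sets \<mu> = sets borel"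
    and B: "compact B" and F: "compact F" and disj: "B \<inter> F = {}" and \<delta>: "0 \<le> \<delta>"
    and dens: "\<And>x u r. x \<in> B \<Longrightarrow> norm u = 1 \<Longrightarrow> 0 \<le> r \<Longrightarrow>
      measure lborel {t \<in> {0..r}. x + t *\<^sub>R u \<in> F} \<le> \<delta> * r"
    and pos: "0 < measure \<mu> B"
  shows "measure \<mu> F \<le> \<delta> * (- boxcox s (measure \<mu> B))"
proof (cases "measure \<mu> F = 0")
  case True
  interpret prob_space \<mu> by fact
  have "boxcox s (measure \<mu> B) \<le> boxcox s 1" using pos by (subst boxcox_le_iff) auto
  with True \<delta> show ?thesis by (simp add: mult_nonneg_nonpos)
next
  case False
  interpret prob_space \<mu> by fact
  have fin: "finite_measure \<mu>" by unfold_locales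
  note [measurable_cong] = sets
  have BF [measurable]: "B \<in> sets borel" "F \<in> sets borel" using B F by (auto simp: borel_compact)
  define b \<eta> where "b = measure \<mu> B" and "\<eta> = measure \<mu> F"
  have "0 < b" "0 < \<eta>" using pos False by (auto simp: b_def \<eta>_def zero_less_measure_iff)
  obtain R where R: "B \<union> F \<subseteq> cball 0 R"
    
    using compact_imp_bounded[OF compact_Un[OF B F]] by (auto simp: bounded_iff subset_eq)
  \<comment> \<open>The whole ball qualifies, with \<open>b\<close> and \<open>\<eta>\<close> the
    masses of \<open>B\<close> and \<open>F\<close>, because its own mass is at most 1.\<close>
  have gb: "good_body \<mu> B F b \<eta> (cball 0 R)"
  proof -
    have "B \<inter> cball 0 R = B" "F \<inter> cball 0 R = F" using R by auto
    moreover have "measure \<mu> B \<le> measure \<mu> (cball 0 R)" using R by (intro finite_measure_mono) auto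
    moreover have "b * measure \<mu> (cball 0 R) \<le> b * 1" "\<eta> * measure \<mu> (cball 0 R) \<le> \<eta> * 1"
      using \<open>0 < b\<close> \<open>0 < \<eta>\<close> by (intro mult_left_mono; simp)+
    ultimately show ?thesis using pos by (simp add: good_body_def b_def \<eta>_def)
  qed
  obtain C :: "nat \<Rightarrow> (real ^ 'n) set" where good: "\<And>n. good_body \<mu> B F b \<eta> (C n)" and mono: "\<And>m n. m \<le> n \<Longrightarrow> C n \<subseteq> C m"
    and line: "\<And>x y z. x \<in> (\<Inter>n. C n) \<Longrightarrow> y \<in> (\<Inter>n. C n) \<Longrightarrow> z \<in> (\<Inter>n. C n) \<Longrightarrow> x \<noteq> y \<Longrightarrow> \<exists>c. z - x = c *\<^sub>R (y - x)"
    by (rule needle_sequence[OF s fin sets BF gb]) (rule that, assumption+)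
  define S where "S = (\<Inter>n. C n)"
  have cptC: "compact (C n)" for n using good[of n] by (simp add: good_body_def)
  have ne: "B \<inter> C n \<noteq> {}" "F \<inter> C n \<noteq> {}" for n
  proof -
    have "0 < measure \<mu> (C n)" "b * measure \<mu> (C n) \<le> measure \<mu> (B \<inter> C n)" "\<eta> * measure \<mu> (C n) \<le> measure \<mu> (F \<inter> C n)"
      using good[of n] by (auto simp: good_body_def)
    moreover have "0 < b * measure \<mu> (C n)" "0 < \<eta> * measure \<mu> (C n)"
      using calculation \<open>0 < b\<close> \<open>0 < \<eta>\<close> by auto
    ultimately have "0 < measure \<mu> (B \<inter> C n)" "0 < measure \<mu> (F \<inter> C n)" by linarith+
    then show "B \<inter> C n \<noteq> {}" "F \<inter> C n \<noteq> {}" by (auto intro!: notI)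
  qed
  \<comment> \<open>Both sets keep positive mass in every body, so by compactness both meet the
    limit set; being disjoint, they provide two distinct points of it and hence its
    direction.\<close>
  have neS: "E \<inter> S \<noteq> {}" if "compact E" "\<And>n. E \<inter> C n \<noteq> {}" for E
  proof -
    have "\<Inter>(range (\<lambda>n. E \<inter> C n)) \<noteq> {}"
      using that mono cptC by (intro compact_nest compact_Int) blast+
    then show ?thesis by (auto simp: S_def)
  qed
  obtain x0 where x0: "x0 \<in> B" "x0 \<in> S" using neS[OF B ne(1)] by blast
  obtain y0 where y0: "y0 \<in> F" "y0 \<in> S" using neS[OF F ne(2)] by blast
  have "x0 \<noteq> y0" using x0 y0 disj by auto
  define u where "u = (y0 - x0) /\<^sub>R norm (y0 - x0)"
  have u: "norm u = 1" using \<open>x0 \<noteq> y0\<close> by (simp add: u_def)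
  then have uu: "u \<bullet> u = 1" by (simp add: norm_eq_1)
  \<comment> \<open>\<open>q t\<close> is the point of the line with
    \<open>q t \<bullet> u = t\<close>: the parameter is the coordinate onto which the measure is
    projected later.\<close>
  define q where "q t = x0 + (t - x0 \<bullet> u) *\<^sub>R u" for t
  have qS: "z = q (z \<bullet> u)" if z: "z \<in> S" for z
  proof -
    obtain c where "z - x0 = c *\<^sub>R (y0 - x0)" using line x0 y0 z \<open>x0 \<noteq> y0\<close> unfolding S_def by metis
    then have "z - x0 = (c * norm (y0 - x0)) *\<^sub>R u" using \<open>x0 \<noteq> y0\<close> by (simp add: u_def)
    then obtain k where k: "z = x0 + k *\<^sub>R u" by (metis diff_add_cancel add.commute)
    then show ?thesis by (simp add: q_def inner_add_left uu)
  qed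
  have qadd: "q (t + r) = q t + r *\<^sub>R u" for t r by (simp add: q_def algebra_simps)
  have cptS: "compact S" unfolding S_def using cptC by (intro compact_Inter) auto
  define B1 F1 where "B1 = (\<lambda>z. z \<bullet> u) ` (B \<inter> S)" and "F1 = (\<lambda>z. z \<bullet> u) ` (F \<inter> S)"
  have cpt1: "compact B1" "compact F1"
    unfolding B1_def F1_def using B F cptS by (auto intro!: compact_continuous_image continuous_intros compact_Int)
  have ne1: "B1 \<noteq> {}" "F1 \<noteq> {}" using x0 y0 by (auto simp: B1_def F1_def)
  have q1: "t \<in> B1 \<Longrightarrow> q t \<in> B" "t \<in> F1 \<Longrightarrow> q t \<in> F" for t
    using qS by (auto simp: B1_def F1_def)
  have disj1: "B1 \<inter> F1 = {}" using q1 disj by blast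
  have F1b [measurable]: "F1 \<in> sets borel" using cpt1 by (simp add: borel_compact)
  have qF [measurable]: "{t. q t \<in> F} \<in> sets borel"
  proof -
    have "q -` F \<inter> space borel \<in> sets borel"
      using BF by (intro measurable_sets[of q borel borel]) (auto simp: q_def intro!: borel_measurable_continuous_onI continuous_intros)
    then show ?thesis by (simp add: vimage_def)
  qed
  have dens1: "measure lborel (F1 \<inter> closed_segment x y) \<le> \<delta> * \<bar>y - x\<bar>" if x: "x \<in> B1" for x y
  proof -
    \<comment> \<open>With the sign \<open>e\<close>, the segment from \<open>x\<close> to
      \<open>y\<close> is traversed from \<open>x\<close> in the unit direction
      \<open>e *\<^sub>R u\<close>, as \<open>dens\<close> requires.\<close>
    define e :: real where "e = (if x \<le> y then 1 else - 1)"
    have e: "\<bar>e\<bar> = 1" "e * e = 1" by (auto simp: e_def)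
    define r where "r = \<bar>y - x\<bar>"
    let ?E = "{t. q t \<in> F} \<inter> closed_segment x y"
    have [measurable]: "closed_segment x y \<in> sets borel" by (auto simp: closed_segment_eq_real_ivl)
    have seg: "x + e * t \<in> closed_segment x y \<longleftrightarrow> t \<in> {0..r}" for t
      by (auto simp: closed_segment_eq_real_ivl e_def r_def)
    have "measure lborel (F1 \<inter> closed_segment x y) \<le> measure lborel ?E"
      using q1 by (intro measure_mono_fmeasurable)
        (auto simp: closed_segment_eq_real_ivl fmeasurable_def emeasure_Int_interval)
    also have "\<dots> = measure lborel {t. x + t \<in> ?E}" by (rule measure_lborel_translate [symmetric]) measurable
    also have "\<dots> = measure lborel {t. x + e * t \<in> ?E}"
    proof (cases "x \<le> y")
      case False
      then have "measure lborel {t. - t \<in> {t. x + t \<in> ?E}} = measure lborel {t. x + t \<in> ?E}"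
        by (intro measure_lborel_uminus) measurable
      with False show ?thesis by (simp add: e_def)
    qed (simp add: e_def)
    also have "{t. x + e * t \<in> ?E} = {t \<in> {0..r}. q x + t *\<^sub>R (e *\<^sub>R u) \<in> F}"
      using seg by (auto simp: qadd mult.commute)
    also have "measure lborel \<dots> \<le> \<delta> * r"
      using q1(1)[OF x] u e by (intro dens) (auto simp: r_def)
    finally show ?thesis by (simp add: r_def)
  qed
  have "\<eta> \<le> \<delta>' * (- boxcox s b)" if \<delta>': "\<delta> < \<delta>'" for \<delta>'
  proof -
    obtain e where e: "0 < e" "{t. infdist t B1 \<le> e} \<inter> {t. infdist t F1 \<le> e} = {}"
      and dense: "\<And>x y. infdist x B1 \<le> e \<Longrightarrow> measure lborel ({t. infdist t F1 \<le> e} \<inter> closed_segment x y) \<le> \<delta>' * \<bar>y - x\<bar>"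
      using fatten_proportion[OF cpt1(1) ne1(1) cpt1(2) ne1(2) disj1 \<delta> \<delta>' dens1] by metis
    \<comment> \<open>By compactness of the nested sets, the projections of
      \<open>E \<inter> C n\<close> close in on that of \<open>E \<inter> S\<close>.\<close>
    have near: "\<exists>N. E \<inter> C N \<subseteq> {z. infdist (z \<bullet> u) ((\<lambda>z. z \<bullet> u) ` (E \<inter> S)) < e / 2}" if "compact E" for E
    proof (rule compact_nest_subset)
      show "compact (E \<inter> C n)" for n using that cptC by (rule compact_Int)
      show "E \<inter> C n \<subseteq> E \<inter> C m" if "m \<le> n" for m n using mono[OF that] by blast
      show "open {z. infdist (z \<bullet> u) ((\<lambda>z. z \<bullet> u) ` (E \<inter> S)) < e / 2}"
        by (intro open_Collect_less continuous_intros)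
      show "(\<Inter>n. E \<inter> C n) \<subseteq> {z. infdist (z \<bullet> u) ((\<lambda>z. z \<bullet> u) ` (E \<inter> S)) < e / 2}"
        using e(1) by (auto simp: S_def)
    qed blast
    obtain N1 N2 where N: "B \<inter> C N1 \<subseteq> {z. infdist (z \<bullet> u) B1 < e / 2}" "F \<inter> C N2 \<subseteq> {z. infdist (z \<bullet> u) F1 < e / 2}"
      using near[OF B] near[OF F] unfolding B1_def F1_def by blast
    define K where "K = C (max N1 N2)"
    have K: "compact K" "convex K" "0 < measure \<mu> K" "b * measure \<mu> K \<le> measure \<mu> (B \<inter> K)" "\<eta> * measure \<mu> K \<le> measure \<mu> (F \<inter> K)"
      using good[of "max N1 N2"] by (auto simp: K_def good_body_def)
    have [measurable]: "K \<in> sets borel" using K(1) by (simp add: borel_compact)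
    \<comment> \<open>The width \<open>e / 2\<close> suffices to catch the projections of
      \<open>B \<inter> K\<close> and \<open>F \<inter> K\<close>; the other half of
      \<open>e\<close> is the margin that smoothing on the line needs.\<close>
    define B0 F0 where "B0 = {t. infdist t B1 \<le> e / 2}" and "F0 = {t. infdist t F1 \<le> e / 2}"
    have cl: "closed {t. infdist t E \<le> r}" for E :: "real set" and r by (intro closed_Collect_le continuous_intros)
    then have b0: "B0 \<in> sets borel" "F0 \<in> sets borel" unfolding B0_def F0_def by (simp_all only: borel_closed)
    have BK: "B \<inter> K \<subseteq> K \<inter> {x. x \<bullet> u \<in> B0}" "F \<inter> K \<subseteq> K \<inter> {x. x \<bullet> u \<in> F0}"
      using N mono[of N1 "max N1 N2"] mono[of N2 "max N1 N2"] by (force simp: K_def B0_def F0_def)+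
    obtain r where "boxcox_concave_line (distr (uniform_measure \<mu> K) borel (\<lambda>x. x \<bullet> u)) s r"
      using boxcox_concave_line_projection[OF s fin sets K(1-3)] .
    then interpret L: boxcox_concave_line "distr (uniform_measure \<mu> K) borel (\<lambda>x. x \<bullet> u)" s r .
    let ?\<nu> = "distr (uniform_measure \<mu> K) borel (\<lambda>x. x \<bullet> u)"
    have low: "c \<le> measure ?\<nu> E0" if "c * measure \<mu> K \<le> measure \<mu> (E \<inter> K)" "E \<inter> K \<subseteq> K \<inter> {x. x \<bullet> u \<in> E0}" "E0 \<in> sets borel" for c E E0
    proof -
      have "(\<lambda>x. x \<bullet> u) -` E0 \<inter> space borel \<in> sets borel"
        using that(3) by (intro measurable_sets[of _ borel borel]) auto
      then have [measurable]: "{x. x \<bullet> u \<in> E0} \<in> sets borel" by (simp add: vimage_def)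
      have "measure \<mu> (E \<inter> K) \<le> measure \<mu> (K \<inter> {x. x \<bullet> u \<in> E0})"
        using that(2) sets by (intro finite_measure_mono) auto
      with that(1) have "c * measure \<mu> K \<le> measure \<mu> (K \<inter> {x. x \<bullet> u \<in> E0})" by linarith
      then show ?thesis
        using K(3) that(3) by (simp add: measure_distr_uniform_measure[OF fin sets] pos_le_divide_eq)
    qed
    have lowB: "b \<le> measure ?\<nu> B0" and lowF: "\<eta> \<le> measure ?\<nu> F0"
      using low[OF K(4) BK(1) b0(1)] low[OF K(5) BK(2) b0(2)] by auto
    have fat: "{w - e / 2..w + e / 2} \<subseteq> {t. infdist t E \<le> e}" if "w \<in> {t. infdist t E \<le> e / 2}" for w and E :: "real set"
    proof
      fix t assume "t \<in> {w - e / 2..w + e / 2}"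
      then have "dist t w \<le> e / 2" unfolding dist_real_def atLeastAtMost_iff by linarith
      with that infdist_triangle[of t E w] show "t \<in> {t. infdist t E \<le> e}" by auto
    qed
    have "measure ?\<nu> F0 \<le> \<delta>' * (- boxcox s (measure ?\<nu> B0))"
    proof (rule L.measure_le_boxcox[OF cl cl e(2)])
      show "0 \<le> \<delta>'" using \<delta> \<delta>' by simp
      show "0 < e / 2" using e by simp
      show "measure lborel ({t. infdist t F1 \<le> e} \<inter> {x..y}) \<le> \<delta>' * (y - x)" if "x \<in> {t. infdist t B1 \<le> e}" "x \<le> y" for x y
        using dense[of x y] that by (simp add: closed_segment_eq_real_ivl)
      show "measure lborel ({t. infdist t F1 \<le> e} \<inter> {y..x}) \<le> \<delta>' * (x - y)" if "x \<in> {t. infdist t B1 \<le> e}" "y \<le> x" for x y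
        using dense[of x y] that by (cases "x = y") (simp_all add: closed_segment_eq_real_ivl)
    qed (use b0 fat lowB lowF \<open>0 < b\<close> \<open>0 < \<eta>\<close> in \<open>auto simp: B0_def F0_def\<close>)
    \<comment> \<open>Lower bounds for both relative masses suffice, since \<open>- boxcox s\<close>
      is decreasing.\<close>
    also have "\<dots> \<le> \<delta>' * (- boxcox s b)"
    proof (intro mult_left_mono)
      show "- boxcox s (measure ?\<nu> B0) \<le> - boxcox s b" using lowB \<open>0 < b\<close> by (simp add: boxcox_le_iff)
    qed (use \<delta> \<delta>' in simp)
    finally show ?thesis using lowF by simp
  qed
  then have "\<eta> \<le> (\<delta> + inverse (real (Suc n))) * (- boxcox s b)" for n by simp
  moreover have "(\<lambda>n. (\<delta> + inverse (real (Suc n))) * (- boxcox s b)) \<longlonglongrightarrow> (\<delta> + 0) * (- boxcox s b)"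
    by (intro tendsto_intros LIMSEQ_inverse_real_of_nat)
  ultimately have "\<eta> \<le> (\<delta> + 0) * (- boxcox s b)" by (intro LIMSEQ_le_const) auto
  then show ?thesis by (simp add: \<eta>_def b_def)
qed

section \<open>Functions of bounded Chebyshev degree\<close>

text \<open>In the Chebyshev bound for the segment \<open>I\<close> from \<open>x\<close> and its
  part \<open>J\<close> in \<open>F\<close>, the supremum over \<open>I\<close> is at least
  \<open>a\<close> and that over \<open>J\<close> at most \<open>c\<close>; solving for the length
  of \<open>J\<close> gives the proportion. For \<open>c = 0\<close> the bound reads 0, by
  \<open>0 powr (1 / d) = 0\<close>.\<close>

lemma chebyshev_bound_proportion:
  fixes f :: "real ^ 'n \<Rightarrow> real"
  assumes cheb: "chebyshev_bound f A d" and A: "0 < A" and d: "0 < d" and F: "compact F"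
    and a: "0 < a" "a \<le> \<bar>f x\<bar>" and c: "0 \<le> c" "\<And>y. y \<in> F \<Longrightarrow> \<bar>f y\<bar> \<le> c"
    and u: "norm u = 1" and r: "0 \<le> r"
  shows "measure lborel {t \<in> {0..r}. x + t *\<^sub>R u \<in> F} \<le> A * (c / a) powr (1 / d) * r"
proof (cases "measure lborel {t \<in> {0..r}. x + t *\<^sub>R u \<in> F} = 0")
  case True
  then show ?thesis using A r by simp
next
  case False
  define j where "j = measure lborel {t \<in> {0..r}. x + t *\<^sub>R u \<in> F}"
  have j: "0 < j" using False by (simp add: j_def zero_less_measure_iff)
  define I J where "I = (\<lambda>t. x + t *\<^sub>R u) ` {0..r}" and "J = I \<inter> F"
  have "u \<noteq> 0" using u by auto
  then have inj: "x + t *\<^sub>R u = x + t' *\<^sub>R u \<longleftrightarrow> t = t'" for t t' by simp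
  have cI: "compact I" unfolding I_def by (intro compact_continuous_image continuous_intros compact_Icc)
  have lI: "line_measure x u I = r"
  proof -
    have "{t. x + t *\<^sub>R u \<in> I} = {0..r}" using \<open>u \<noteq> 0\<close> by (auto simp: I_def)
    then show ?thesis using r by (simp add: line_measure_def)
  qed
  have lJ: "line_measure x u J = j"
  proof -
    have "{t. x + t *\<^sub>R u \<in> J} = {t \<in> {0..r}. x + t *\<^sub>R u \<in> F}" using \<open>u \<noteq> 0\<close> by (auto simp: I_def J_def)
    then show ?thesis by (simp add: line_measure_def j_def)
  qed
  have "convex I"
  proof -
    have "convex ((+) x ` ((\<lambda>t. t *\<^sub>R u) ` {0..r}))"
      by (intro convex_translation convex_linear_image) (auto intro!: linearI simp: algebra_simps)
    then show ?thesis by (simp add: I_def image_image)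
  qed
  moreover have "J \<in> sets borel" using cI F by (simp add: J_def borel_compact compact_Int)
  moreover have "I \<subseteq> range (\<lambda>t. x + t *\<^sub>R u)" "J \<subseteq> I" by (auto simp: I_def J_def)
  moreover have "0 < line_measure x u J" using j lJ by simp
  ultimately have "(SUP y\<in>I. ennreal \<bar>f y\<bar>) \<le> ennreal ((A * r / j) powr d) * (SUP y\<in>J. ennreal \<bar>f y\<bar>)"
    using cheb[unfolded chebyshev_bound_def, rule_format, of u I x J] u compact_imp_bounded[OF cI]
    by (simp add: lI lJ)
  moreover have "ennreal a \<le> (SUP y\<in>I. ennreal \<bar>f y\<bar>)"
  proof (rule SUP_upper2)
    show "x \<in> I" unfolding I_def using r by (intro image_eqI[of _ _ 0]) auto
  qed (use a in \<open>simp add: ennreal_leI\<close>)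
  moreover have "(SUP y\<in>J. ennreal \<bar>f y\<bar>) \<le> ennreal c"
    using c by (intro SUP_least ennreal_leI) (auto simp: J_def)
  then have "ennreal ((A * r / j) powr d) * (SUP y\<in>J. ennreal \<bar>f y\<bar>) \<le> ennreal ((A * r / j) powr d) * ennreal c"
    by (rule mult_left_mono) simp
  ultimately have "ennreal a \<le> ennreal ((A * r / j) powr d * c)"
    using c by (simp add: ennreal_mult)
  then have le: "a \<le> (A * r / j) powr d * c" using a c by (subst (asm) ennreal_le_iff) auto
  with a c have c0: "0 < c" by (cases "c = 0") auto
  have "a / c \<le> (A * r / j) powr d" using le c0 by (simp add: pos_divide_le_eq)
  then have "(a / c) powr (1 / d) \<le> ((A * r / j) powr d) powr (1 / d)"
    using a c0 d by (intro powr_mono2) auto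
  also have "\<dots> = A * r / j" using d A r j by (simp add: powr_powr)
  finally have "(a / c) powr (1 / d) * j \<le> A * r" using j by (simp add: pos_le_divide_eq)
  then have "(c / a) powr (1 / d) * ((a / c) powr (1 / d) * j) \<le> (c / a) powr (1 / d) * (A * r)"
    by (rule mult_left_mono) simp
  moreover have "(c / a) powr (1 / d) * (a / c) powr (1 / d) = 1"
    using a c0 by (simp flip: powr_mult)
  ultimately have "j \<le> (c / a) powr (1 / d) * (A * r)" by (simp flip: mult.assoc)
  then show ?thesis by (simp add: j_def mult_ac)
qed

lemma compact_approximation:
  fixes \<mu> :: "(real ^ 'n) measure"
  assumes "finite_measure \<mu>" "sets \<mu> = sets borel" "E \<in> sets borel" "0 < \<tau>"
  obtains K where "K \<subseteq> E" "compact K" "measure \<mu> E - \<tau> < measure \<mu> K"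
\<comment> \<open>\<open>ennreal\<close> sends negative reals to 0, so a negative bound is treated
  apart; there the empty set serves.\<close>
proof (cases "measure \<mu> E - \<tau> < 0")
  case True
  then show ?thesis by (intro that[of "{}"]) auto
next
  case False
  interpret finite_measure \<mu> by fact
  have "ennreal (measure \<mu> E - \<tau>) < emeasure \<mu> E"
    using False assms(4) by (simp add: emeasure_eq_measure ennreal_less_iff)
  also have "\<dots> = (SUP K \<in> {K. K \<subseteq> E \<and> compact K}. emeasure \<mu> K)"
    using assms by (intro inner_regular) (auto simp: emeasure_eq_measure)
  finally obtain K where "K \<subseteq> E" "compact K" "ennreal (measure \<mu> E - \<tau>) < emeasure \<mu> K"
    by (auto simp: less_SUP_iff)
  with False show ?thesis by (intro that[of K]) (auto simp: emeasure_eq_measure ennreal_less_iff)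
qed

text \<open>The zero set of \<open>f\<close> has length 0 on every segment that starts outside it.
  If both it and its complement had positive mass, compact subsets would contradict the dilation
  inequality with \<open>\<delta> = 0\<close>.\<close>

lemma chebyshev_zero_set:
  fixes f :: "real ^ 'n \<Rightarrow> real" and \<mu> :: "(real ^ 'n) measure"
  assumes f: "f \<in> borel_measurable borel" and cheb: "chebyshev_bound f A d" "0 < A" "0 < d"
    and s: "s \<le> 1" "s_concave s \<mu>" and sets: "sets \<mu> = sets borel" and "prob_space \<mu>"
    and pos: "0 < measure \<mu> {x. f x = 0}"
  shows "AE x in \<mu>. f x = 0"
proof (rule ccontr)
  interpret prob_space \<mu> by fact
  have fin: "finite_measure \<mu>" by unfold_locales
  note [measurable] = f and [measurable_cong] = sets
  have sp: "space \<mu> = UNIV" using sets_eq_imp_space_eq[OF sets] by simp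
  assume "\<not> (AE x in \<mu>. f x = 0)"
  then have "0 < measure \<mu> {x. f x \<noteq> 0}"
    by (subst (asm) AE_iff_measurable[of "{x. f x \<noteq> 0}"])
      (auto simp: sp emeasure_eq_measure zero_less_measure_iff sets)
  then obtain B where B: "B \<subseteq> {x. f x \<noteq> 0}" "compact B" "0 < measure \<mu> B"
    using compact_approximation[OF fin sets, of "{x. f x \<noteq> 0}" "measure \<mu> {x. f x \<noteq> 0}"] by auto
  obtain F where F: "F \<subseteq> {x. f x = 0}" "compact F" "0 < measure \<mu> F"
    using compact_approximation[OF fin sets, of "{x. f x = 0}" "measure \<mu> {x. f x = 0}"] pos by auto
  have "measure \<mu> F \<le> 0 * (- boxcox s (measure \<mu> B))"
  proof (rule s_concave_dilation[OF s \<open>prob_space \<mu>\<close> sets B(2) F(2) _ _ _ B(3)])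
    show "measure lborel {t \<in> {0..r}. x + t *\<^sub>R u \<in> F} \<le> 0 * r" if "x \<in> B" "norm u = 1" "0 \<le> r" for x u r
      using chebyshev_bound_proportion[OF cheb F(2), of "\<bar>f x\<bar>" x 0 u r] that B(1) F(1) by force
  qed (use B F in auto)
  with F(3) show False by simp
qed

text \<open>For \<open>\<bar>f\<bar>\<close> the levels \<open>M\<close> and
  \<open>M * \<epsilon>\<close> of the root become their \<open>d\<close>-th powers, whose ratio has
  root \<open>\<epsilon>\<close>; so \<open>\<delta> = A * \<epsilon>\<close>. The condition
  \<open>\<epsilon> < 1\<close> makes the two sets disjoint, and inner approximation costs
  \<open>\<tau>\<close> in either mass.\<close>

lemma chebyshev_small_ball:
  fixes f :: "real ^ 'n \<Rightarrow> real" and \<mu> :: "(real ^ 'n) measure"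
  assumes f: "f \<in> borel_measurable borel" and cheb: "chebyshev_bound f A d" "0 < A" "0 < d"
    and s: "s \<le> 1" "s_concave s \<mu>" and sets: "sets \<mu> = sets borel" and "prob_space \<mu>"
    and M: "0 < M" "1 / 2 \<le> measure \<mu> {x. M \<le> \<bar>f x\<bar> powr (1 / d)}" and \<epsilon>: "0 < \<epsilon>" "\<epsilon> < 1"
  shows "measure \<mu> {x. \<bar>f x\<bar> powr (1 / d) \<le> M * \<epsilon>} \<le> A * c_const s * \<epsilon>"
proof -
  interpret prob_space \<mu> by fact
  have fin: "finite_measure \<mu>" by unfold_locales
  note [measurable] = f
  let ?F = "{x. \<bar>f x\<bar> powr (1 / d) \<le> M * \<epsilon>}" and ?B = "{x. M \<le> \<bar>f x\<bar> powr (1 / d)}"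
  have mb: "?F \<in> sets borel" "?B \<in> sets borel" by measurable
  have root: "\<bar>z\<bar> = (\<bar>z\<bar> powr (1 / d)) powr d" for z using cheb(3) by (simp add: powr_powr)
  have le: "measure \<mu> ?F \<le> A * \<epsilon> * (- boxcox s (1 / 2 - \<tau>)) + \<tau>" if \<tau>: "0 < \<tau>" "\<tau> < 1 / 2" for \<tau>
  proof -
    obtain B where B: "B \<subseteq> ?B" "compact B" "measure \<mu> ?B - \<tau> < measure \<mu> B"
      by (rule compact_approximation[OF fin sets mb(2) \<tau>(1)])
    obtain F where F: "F \<subseteq> ?F" "compact F" "measure \<mu> ?F - \<tau> < measure \<mu> F"
      by (rule compact_approximation[OF fin sets mb(1) \<tau>(1)])
    have B': "1 / 2 - \<tau> \<le> measure \<mu> B" "0 < measure \<mu> B" using B(3) M \<tau> by auto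
    have "M * \<epsilon> < M" using M \<epsilon> by simp
    have "measure \<mu> F \<le> (A * \<epsilon>) * (- boxcox s (measure \<mu> B))"
    proof (rule s_concave_dilation[OF s \<open>prob_space \<mu>\<close> sets B(2) F(2) _ _ _ B'(2)])
      show "B \<inter> F = {}" using B(1) F(1) \<open>M * \<epsilon> < M\<close> by force
      show "0 \<le> A * \<epsilon>" using cheb \<epsilon> by simp
      show "measure lborel {t \<in> {0..r}. x + t *\<^sub>R u \<in> F} \<le> A * \<epsilon> * r" if "x \<in> B" "norm u = 1" "0 \<le> r" for x u r
      proof -
        have "M powr d \<le> \<bar>f x\<bar>"
          using B(1) that(1) M cheb(3) by (subst root) (auto intro!: powr_mono2)
        moreover have "\<bar>f y\<bar> \<le> (M * \<epsilon>) powr d" if "y \<in> F" for y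
          using F(1) that cheb(3) by (subst root) (auto intro!: powr_mono2)
        ultimately have "measure lborel {t \<in> {0..r}. x + t *\<^sub>R u \<in> F} \<le>
            A * ((M * \<epsilon>) powr d / M powr d) powr (1 / d) * r"
          using M that by (intro chebyshev_bound_proportion[OF cheb F(2)]) auto
        also have "((M * \<epsilon>) powr d / M powr d) powr (1 / d) = \<epsilon>"
          using M \<epsilon> cheb(3) by (simp add: powr_mult powr_powr)
        finally show ?thesis .
      qed
    qed
    also have "\<dots> \<le> (A * \<epsilon>) * (- boxcox s (1 / 2 - \<tau>))"
      using cheb \<epsilon> B' \<tau> by (intro mult_left_mono) (auto simp: boxcox_le_iff)
    finally show ?thesis using F(3) by simp
  qed
  \<comment> \<open>The shift by 2 makes every term at most 1/3, so that
    \<open>1 / 2 - ?\<tau> n\<close> is positive.\<close>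
  let ?\<tau> = "\<lambda>n. inverse (real (Suc (n + 2)))"
  have \<tau>0: "?\<tau> \<longlonglongrightarrow> 0" using LIMSEQ_ignore_initial_segment[OF LIMSEQ_inverse_real_of_nat, of 2] by simp
  then have "(\<lambda>n. boxcox s (1 / 2 - ?\<tau> n)) \<longlonglongrightarrow> boxcox s (1 / 2 - 0)"
    by (intro isCont_tendsto_compose[OF isCont_boxcox] tendsto_intros) auto
  then have "(\<lambda>n. A * \<epsilon> * (- boxcox s (1 / 2 - ?\<tau> n)) + ?\<tau> n) \<longlonglongrightarrow> A * \<epsilon> * (- boxcox s (1 / 2 - 0)) + 0"
    using \<tau>0 by (intro tendsto_intros)
  moreover have "measure \<mu> ?F \<le> A * \<epsilon> * (- boxcox s (1 / 2 - ?\<tau> n)) + ?\<tau> n" for n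
    by (intro le) (auto simp: field_simps)
  ultimately have "measure \<mu> ?F \<le> A * \<epsilon> * (- boxcox s (1 / 2 - 0)) + 0"
    by (intro LIMSEQ_le_const) auto
  then show ?thesis using boxcox_half[of s] by (simp add: mult_ac)
qed

section \<open>Negative moments and the final estimates\<close>

lemma c_const_nonneg: "0 \<le> c_const s"
  using boxcox_half[of s] boxcox_le_iff[of "1 / 2" 1 s] by simp

lemma enn_powr_antimono:
  assumes "a < 0" "x \<le> ennreal y" "0 < y"
  shows "ennreal (y powr a) \<le> enn_powr x a"
proof (cases "x = 0")
  case False
  moreover from assms(2) have "x \<noteq> \<infinity>" by (auto simp: top_unique)
  ultimately obtain z where z: "x = ennreal z" "0 < z"
    by (cases x) (auto simp: ennreal_eq_0_iff not_le)
  with assms have "z \<le> y" by simp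
  with z assms show ?thesis by (simp add: enn_powr_ennreal ennreal_leI powr_mono2')
qed (use assms in \<open>simp add: enn_powr_def\<close>)

text \<open>For \<open>0 < g x < M\<close>, the power \<open>(g x / M) powr q\<close> exceeds 1 by
  the integral of \<open>- q * \<epsilon> powr (q - 1)\<close> over \<open>\<epsilon>\<close> from
  \<open>g x / M\<close> to 1. Fubini and \<open>small\<close> bound the integral of this excess by
  that of \<open>- q * X * \<epsilon> powr q\<close> over (0, 1), which is finite because
  \<open>q > -1\<close> and equals \<open>- q * X / (q + 1)\<close>.\<close>

lemma negative_moment_le:
  assumes prob: "prob_space \<mu>" and g [measurable]: "g \<in> borel_measurable \<mu>" and nonneg: "\<And>x. 0 \<le> g x"
    and M: "0 < M" and q: "-1 < q" "q < 0" and X: "0 \<le> X"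
    and small: "\<And>\<epsilon>. 0 < \<epsilon> \<Longrightarrow> \<epsilon> < 1 \<Longrightarrow> measure \<mu> {x \<in> space \<mu>. g x \<le> M * \<epsilon>} \<le> X * \<epsilon>"
  shows "(\<integral>\<^sup>+x. enn_powr (ennreal \<bar>g x\<bar>) q \<partial>\<mu>) \<le> ennreal (M powr q * (1 - q * X / (q + 1)))"
proof -
  interpret prob_space \<mu> by fact
  interpret P: pair_sigma_finite \<mu> lborel ..
  \<comment> \<open>Where \<open>g x = 0\<close> the extended power is infinite; letting
    \<open>\<epsilon>\<close> tend to 0 in \<open>small\<close> shows that these points form a null
    set.\<close>
  have "measure \<mu> {x \<in> space \<mu>. g x \<le> 0} \<le> 0"
  proof (rule LIMSEQ_le_const)
    show "(\<lambda>n. X * inverse (real (Suc n))) \<longlonglongrightarrow> 0"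
      using tendsto_mult[OF tendsto_const LIMSEQ_inverse_real_of_nat, of X] by simp
    have "measure \<mu> {x \<in> space \<mu>. g x \<le> 0} \<le> X * inverse (real (Suc n))" if "1 \<le> n" for n
    proof -
      have "inverse (real (Suc n)) < 1" using that by (simp add: inverse_less_1_iff)
      moreover have "measure \<mu> {x \<in> space \<mu>. g x \<le> 0} \<le> measure \<mu> {x \<in> space \<mu>. g x \<le> M * inverse (real (Suc n))}"
        using M by (intro finite_measure_mono) (auto intro: order_trans)
      ultimately show ?thesis using small[of "inverse (real (Suc n))"] by simp
    qed
    then show "\<exists>N. \<forall>n\<ge>N. measure \<mu> {x \<in> space \<mu>. g x \<le> 0} \<le> X * inverse (real (Suc n))" by blast
  qed
  then have "measure \<mu> {x \<in> space \<mu>. g x \<le> 0} = 0" by (simp add: measure_le_0_iff)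
  then have "{x \<in> space \<mu>. g x \<le> 0} \<in> null_sets \<mu>" by (intro null_setsI) (auto simp: emeasure_eq_measure)
  then have ae: "AE x in \<mu>. 0 < g x" by (rule AE_I') auto
  let ?k = "\<lambda>x \<epsilon>. ennreal (- q * \<epsilon> powr (q - 1)) * indicator {0<..<1} \<epsilon> * indicator {x \<in> space \<mu>. g x \<le> M * \<epsilon>} x"
  have [measurable]: "(\<lambda>(x, \<epsilon>). ?k x \<epsilon>) \<in> borel_measurable (\<mu> \<Otimes>\<^sub>M lborel)"
    unfolding indicator_def by measurable
  have pt: "enn_powr (ennreal \<bar>g x\<bar>) q \<le> ennreal (M powr q) * (1 + (\<integral>\<^sup>+\<epsilon>. ?k x \<epsilon> \<partial>lborel))"
    if x: "x \<in> space \<mu>" "0 < g x" for x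
  proof (cases "M \<le> g x")
    case True
    then have "enn_powr (ennreal \<bar>g x\<bar>) q \<le> ennreal (M powr q) * 1"
      using x M q by (simp add: enn_powr_ennreal powr_mono2')
    also have "\<dots> \<le> ennreal (M powr q) * (1 + (\<integral>\<^sup>+\<epsilon>. ?k x \<epsilon> \<partial>lborel))"
      by (intro mult_left_mono) auto
    finally show ?thesis .
  next
    case False
    define e where "e = g x / M"
    have e: "0 < e" "e < 1" using False x M by (auto simp: e_def)
    have "(\<integral>\<^sup>+\<epsilon>. ennreal (- q * \<epsilon> powr (q - 1)) * indicator {e..1} \<epsilon> \<partial>lborel) = ennreal (- (1 powr q) - - (e powr q))"
    proof (rule nn_integral_FTC_Icc)
      show "((\<lambda>\<epsilon>. - (\<epsilon> powr q)) has_real_derivative - q * \<epsilon> powr (q - 1)) (at \<epsilon>)" if "\<epsilon> \<in> {e..1}" for \<epsilon>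
        using that e by (auto intro!: derivative_eq_intros)
    qed (use q e in \<open>auto simp: mult_nonpos_nonneg\<close>)
    \<comment> \<open>The fundamental theorem uses a closed interval, the kernel an open one; the
      end point 1 is null.\<close>
    moreover have "(\<integral>\<^sup>+\<epsilon>. ennreal (- q * \<epsilon> powr (q - 1)) * indicator {e..1} \<epsilon> \<partial>lborel) \<le> (\<integral>\<^sup>+\<epsilon>. ?k x \<epsilon> \<partial>lborel)"
    proof (intro nn_integral_mono_AE)
      show "AE \<epsilon> in lborel. ennreal (- q * \<epsilon> powr (q - 1)) * indicator {e..1} \<epsilon> \<le> ?k x \<epsilon>"
        using AE_lborel_singleton[of 1]
      proof eventually_elim
        case (elim \<epsilon>)
        have "g x \<le> M * \<epsilon>" if "e \<le> \<epsilon>" using that M by (simp add: e_def field_simps)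
        with elim e x show ?case by (auto split: split_indicator)
      qed
    qed
    ultimately have "ennreal (e powr q - 1) \<le> (\<integral>\<^sup>+\<epsilon>. ?k x \<epsilon> \<partial>lborel)" by simp
    then have "1 + ennreal (e powr q - 1) \<le> 1 + (\<integral>\<^sup>+\<epsilon>. ?k x \<epsilon> \<partial>lborel)" by (rule add_left_mono)
    moreover have "1 \<le> e powr q" using e q powr_mono2'[of q e 1] by simp
    then have "1 + ennreal (e powr q - 1) = ennreal (e powr q)"
      by (metis add_diff_cancel_left' add.commute diff_add_cancel ennreal_1 ennreal_plus diff_ge_0_iff_ge zero_le_one)
    ultimately have "ennreal (M powr q) * ennreal (e powr q) \<le> ennreal (M powr q) * (1 + (\<integral>\<^sup>+\<epsilon>. ?k x \<epsilon> \<partial>lborel))"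
      by (intro mult_left_mono) auto
    moreover have "M powr q * e powr q = g x powr q"
      using M e by (simp add: e_def flip: powr_mult)
    then have "ennreal (M powr q) * ennreal (e powr q) = enn_powr (ennreal \<bar>g x\<bar>) q"
      using x by (simp add: enn_powr_ennreal flip: ennreal_mult)
    ultimately show ?thesis by simp
  qed
  have "(\<integral>\<^sup>+x. enn_powr (ennreal \<bar>g x\<bar>) q \<partial>\<mu>) \<le> (\<integral>\<^sup>+x. ennreal (M powr q) * (1 + (\<integral>\<^sup>+\<epsilon>. ?k x \<epsilon> \<partial>lborel)) \<partial>\<mu>)"
    by (intro nn_integral_mono_AE) (use ae pt in auto)
  also have "\<dots> = ennreal (M powr q) * (1 + (\<integral>\<^sup>+x. (\<integral>\<^sup>+\<epsilon>. ?k x \<epsilon> \<partial>lborel) \<partial>\<mu>))"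
    by (subst nn_integral_cmult, measurable, subst nn_integral_add) (auto simp: emeasure_space_1)
  also have "(\<integral>\<^sup>+x. (\<integral>\<^sup>+\<epsilon>. ?k x \<epsilon> \<partial>lborel) \<partial>\<mu>) = (\<integral>\<^sup>+\<epsilon>. (\<integral>\<^sup>+x. ?k x \<epsilon> \<partial>\<mu>) \<partial>lborel)"
    by (intro P.Fubini' [symmetric]) measurable
  also have "\<dots> \<le> (\<integral>\<^sup>+\<epsilon>. ennreal (- q * X) * ennreal (indicator {0..1} \<epsilon> * \<epsilon> powr q) \<partial>lborel)"
  proof (intro nn_integral_mono)
    fix \<epsilon> :: real
    have "(\<integral>\<^sup>+x. ?k x \<epsilon> \<partial>\<mu>) = ennreal (- q * \<epsilon> powr (q - 1)) * indicator {0<..<1} \<epsilon> * emeasure \<mu> {x \<in> space \<mu>. g x \<le> M * \<epsilon>}"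
      by (intro nn_integral_cmult_indicator) measurable
    also have "\<dots> \<le> ennreal (- q * X) * ennreal (indicator {0..1} \<epsilon> * \<epsilon> powr q)"
    proof (cases "\<epsilon> \<in> {0<..<1}")
      case True
      then have "- q * \<epsilon> powr (q - 1) * measure \<mu> {x \<in> space \<mu>. g x \<le> M * \<epsilon>} \<le> - q * \<epsilon> powr (q - 1) * (X * \<epsilon>)"
        using q small by (intro mult_left_mono) (auto simp: mult_nonpos_nonneg)
      also have "\<dots> = - q * X * \<epsilon> powr q" using True by (simp add: powr_diff)
      finally show ?thesis
        using True q X by (simp add: emeasure_eq_measure ennreal_leI mult_nonpos_nonneg flip: ennreal_mult)
    qed simp
    finally show "(\<integral>\<^sup>+x. ?k x \<epsilon> \<partial>\<mu>) \<le> ennreal (- q * X) * ennreal (indicator {0..1} \<epsilon> * \<epsilon> powr q)" .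
  qed
  also have "\<dots> = ennreal (- q * X) * (\<integral>\<^sup>+\<epsilon>. ennreal (indicator {0..1} \<epsilon> * \<epsilon> powr q) \<partial>lborel)"
    by (intro nn_integral_cmult) measurable
  also have "(\<integral>\<^sup>+\<epsilon>. ennreal (indicator {0..1} \<epsilon> * \<epsilon> powr q) \<partial>lborel) = ennreal (1 / (q + 1))"
    using nn_integral_has_integral_lebesgue[of "{0..1}" "\<lambda>\<epsilon>. \<epsilon> powr q", OF _ has_integral_powr_from_0[OF q(1) zero_le_one]]
    by simp
  also have "ennreal (M powr q) * (1 + ennreal (- q * X) * ennreal (1 / (q + 1))) = ennreal (M powr q * (1 - q * X / (q + 1)))"
  proof -
    have nn: "0 \<le> - q * X" "0 \<le> 1 / (q + 1)" using q X by (auto simp: mult_nonpos_nonneg)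
    have "1 + ennreal (- q * X) * ennreal (1 / (q + 1)) = ennreal (1 + - q * X * (1 / (q + 1)))"
      unfolding ennreal_mult[OF nn, symmetric] using mult_nonneg_nonneg[OF nn] by (simp flip: ennreal_1 ennreal_plus)
    then show ?thesis by (simp flip: ennreal_mult')
  qed
  finally show ?thesis by (simp add: add_left_mono mult_left_mono)
qed

theorem corollary9:
  fixes f :: "real ^ 'n \<Rightarrow> real" and \<mu> :: "(real ^ 'n) measure" and s d A M :: real
  assumes "f \<in> borel_measurable borel"
    and "is_chebyshev_degree f d"
    and "is_chebyshev_constant f d A"
    and "s \<le> 1"
    and "sets \<mu> = sets borel"
    and "prob_space \<mu>"
    and "s_concave s \<mu>"
    and "is_median \<mu> (\<lambda>x. \<bar>f x\<bar> powr (1 / d)) M"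
  shows "(\<not> (AE x in \<mu>. f x = 0) \<longrightarrow>
            (\<forall>\<epsilon>. 0 < \<epsilon> \<and> \<epsilon> < 1 \<longrightarrow>
               measure \<mu> {x. \<bar>f x\<bar> powr (1 / d) \<le> M * \<epsilon>} \<le> A * c_const s * \<epsilon>)) \<and>
         (\<forall>q. -1 < q \<and> q < 0 \<longrightarrow>
            Lq_norm \<mu> q (\<lambda>x. \<bar>f x\<bar> powr (1 / d))
              \<ge> ennreal (M * (1 - q * A * c_const s / (q + 1)) powr (1 / q)) \<and>
            M * (1 - q * A * c_const s / (q + 1)) powr (1 / q)
              \<ge> M * exp (- (A * c_const s / (q + 1))))"
proof -
  interpret prob_space \<mu> by fact
  note [measurable] = assms(1) and [measurable_cong] = assms(5)
  have sp: "space \<mu> = UNIV" using sets_eq_imp_space_eq[OF assms(5)] by simp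
  define g where "g x = \<bar>f x\<bar> powr (1 / d)" for x
  have cheb: "chebyshev_bound f A d" "0 < A" "0 < d"
    using assms(2,3) by (auto simp: is_chebyshev_degree_def is_chebyshev_constant_def)
  have med: "1 / 2 \<le> measure \<mu> {x. M \<le> g x}" "1 / 2 \<le> measure \<mu> {x. g x \<le> M}"
    using assms(8) by (auto simp: is_median_def sp g_def)
  have "{x. g x \<le> M} \<noteq> {}" using med(2) by (intro notI) simp
  then have M: "0 \<le> M" unfolding g_def using powr_ge_zero order_trans by blast
  \<comment> \<open>A zero median gives the zero set of \<open>f\<close> mass at least 1/2, so
    \<open>f\<close> vanishes almost everywhere. Outside this degenerate case \<open>M\<close> is
    positive; within it the lower bounds for the norm are 0.\<close>
  have zero: "AE x in \<mu>. f x = 0" if "M = 0"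
  proof (rule chebyshev_zero_set[OF assms(1) cheb assms(4,7,5,6)])
    have "{x. g x \<le> M} = {x. f x = 0}"
      using that by (auto simp: g_def)
    then show "0 < measure \<mu> {x. f x = 0}" using med(2) by simp
  qed
  have small: "measure \<mu> {x. g x \<le> M * \<epsilon>} \<le> A * c_const s * \<epsilon>" if "0 < M" "0 < \<epsilon>" "\<epsilon> < 1" for \<epsilon>
    using chebyshev_small_ball[OF assms(1) cheb assms(4,7,5,6) that(1) _ that(2,3)] med(1) by (simp add: g_def)
  define X where "X = A * c_const s"
  have X: "0 \<le> X" using cheb c_const_nonneg[of s] by (simp add: X_def)
  have Lq: "ennreal (M * (1 - q * X / (q + 1)) powr (1 / q)) \<le> Lq_norm \<mu> q g"
    and exp: "M * exp (- (X / (q + 1))) \<le> M * (1 - q * X / (q + 1)) powr (1 / q)"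
    if q: "-1 < q" "q < 0" for q
  proof -
    define Z where "Z = 1 - q * X / (q + 1)"
    have "q * X / (q + 1) \<le> 0" using q X by (simp add: divide_nonpos_pos mult_nonpos_nonneg)
    then have Z: "1 \<le> Z" by (simp add: Z_def)
    \<comment> \<open>In \<open>ln Z \<le> Z - 1\<close>, division by the negative \<open>q\<close>
      reverses the inequality and yields the exponential lower bound.\<close>
    have "ln Z \<le> - q * X / (q + 1)" using ln_le_minus_one[of Z] Z by (simp add: Z_def)
    then have "(- q * X / (q + 1)) / q \<le> ln Z / q"
      using q by (intro divide_right_mono_neg) auto
    moreover have "(- q * X / (q + 1)) / q = - (X / (q + 1))"
      using q nonzero_mult_div_cancel_left[of q "- (X / (q + 1))"] by simp
    ultimately have "exp (- (X / (q + 1))) \<le> Z powr (1 / q)"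
      using Z by (simp add: powr_def)
    with M show "M * exp (- (X / (q + 1))) \<le> M * (1 - q * X / (q + 1)) powr (1 / q)"
      unfolding Z_def by (intro mult_left_mono)
    show "ennreal (M * (1 - q * X / (q + 1)) powr (1 / q)) \<le> Lq_norm \<mu> q g"
    proof (cases "M = 0")
      case False
      with M have "0 < M" by simp
      have "(\<integral>\<^sup>+x. enn_powr (ennreal \<bar>g x\<bar>) q \<partial>\<mu>) \<le> ennreal (M powr q * Z)"
        unfolding Z_def
      proof (rule negative_moment_le[OF assms(6) _ _ \<open>0 < M\<close> q X])
        show "g \<in> borel_measurable \<mu>" unfolding g_def by measurable
        show "0 \<le> g x" for x by (simp add: g_def)
      qed (use small \<open>0 < M\<close> in \<open>simp add: X_def sp\<close>)
      then have "ennreal ((M powr q * Z) powr (1 / q)) \<le> Lq_norm \<mu> q g"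
        unfolding Lq_norm_def using q \<open>0 < M\<close> Z by (intro enn_powr_antimono) auto
      moreover have "(M powr q * Z) powr (1 / q) = M * Z powr (1 / q)"
        using q \<open>0 < M\<close> Z by (simp add: powr_mult powr_powr)
      ultimately show ?thesis by (simp add: Z_def)
    qed simp
  qed
  have "0 < M" if "\<not> (AE x in \<mu>. f x = 0)" using M zero that by (cases "M = 0") auto
  with small Lq exp show ?thesis
    unfolding g_def X_def by (auto simp: mult.assoc)
qed

end
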